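(* Fix $\alpha\in(0,1)$. Let $U\subset\mathbb{C}$ be a smooth bounded simply connected domain and $x_1\in\partial U$. Then $$\lim_{\epsilon\to0}\ \limsup_{n\to\infty}\ \sup_{\substack{A\subset U_n\\ \pi_{RW}(A)\ge\alpha}}\ \Bigl[\sup_{z\in U_n\setminus B(x_1,\frac12)}\mathbb{P}_z\bigl\{\tau(B(x_1,\epsilon))\le\tau(A)\bigr\}\Bigr]=0,$$ where $\pi_{RW}$ is the stationary measure of the random walk on $U_n$ and $B(x_1,\epsilon)$ is the Euclidean ball of radius $\epsilon$ around $x_1$.
   Context: A bounded simply connected domain $U\subset\mathbb{C}$ is smooth if $\partial U$ is an analytic curve (equivalently, a conformal map from $U$ onto the unit disc extends conformally across the boundary). Graph: $U_n=U\cap\frac1n\mathbb{Z}^2$, with the nearest-neighbour edges of $\frac1n\mathbb{Z}^2$ between points of $U_n$, except that every edge (segment) intersecting $U^c$ is deleted; for large $n$ this graph is connected. Random walk: continuous-time simple random walk on $U_n$ with exponential waiting times of mean $\frac1{2n^2}$; $\mathbb{P}_z$ is its law from $z$. Its stationary probability measure is $\pi_{RW}(z)=d_z/\sum_{z'\in U_n}d_{z'}$, where $d_z$ is the degree of $z$ in $U_n$. $\tau(S)$ denotes the hitting time of $S$ by the walk (i.e. of $S\cap U_n$). A supremum of probabilities over an empty set is $0$. *)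

theory Defs
  imports "HOL-Probability.Probability"
begin

text \<open>An analytic curve here is a closed one: a Jordan curve with a regular real-analytic
  parametrisation. A real-analytic map on the unit circle is the restriction of a map that is
  holomorphic in a neighbourhood of the circle.\<close>

definition analytic_curve :: "complex set \<Rightarrow> bool" where
  "analytic_curve \<Gamma> \<longleftrightarrow>
     (\<exists>\<gamma>. \<gamma> analytic_on sphere 0 1 \<and> inj_on \<gamma> (sphere 0 1) \<and>
          (\<forall>w\<in>sphere 0 1. deriv \<gamma> w \<noteq> 0) \<and> \<Gamma> = \<gamma> ` sphere 0 1)"

definition smooth_domain :: "complex set \<Rightarrow> bool" where
  "smooth_domain U \<longleftrightarrow>
     open U \<and> connected U \<and> U \<noteq> {} \<and> bounded U \<and> simply_connected U \<and>
     analytic_curve (frontier U)"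


definition scaled_lattice :: "nat \<Rightarrow> complex set" where
  "scaled_lattice n = {Complex (of_int a / real n) (of_int b / real n) | a b :: int. True}"

definition grid :: "complex set \<Rightarrow> nat \<Rightarrow> complex set" where
  "grid U n = U \<inter> scaled_lattice n"

definition nbrs :: "complex set \<Rightarrow> nat \<Rightarrow> complex \<Rightarrow> complex set" where
  "nbrs U n z = {w \<in> grid U n. dist z w = 1 / real n \<and> closed_segment z w \<subseteq> U}"

definition degree :: "complex set \<Rightarrow> nat \<Rightarrow> complex \<Rightarrow> nat" where
  "degree U n z = card (nbrs U n z)"

definition pi_RW :: "complex set \<Rightarrow> nat \<Rightarrow> complex set \<Rightarrow> real" where
  "pi_RW U n A = (\<Sum>z\<in>A. real (degree U n z) / (\<Sum>z'\<in>grid U n. real (degree U n z')))"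

text \<open>An isolated vertex (possible only for small \<open>n\<close>) is absorbing.\<close>

definition step :: "complex set \<Rightarrow> nat \<Rightarrow> complex \<Rightarrow> complex measure" where
  "step U n z = uniform_count_measure (if nbrs U n z = {} then {z} else nbrs U n z)"

text \<open>The walks from all starting points are built on one probability space by the random mapping
  representation: the \<open>k\<close>-th element \<open>(g, s)\<close> of the i.i.d. driving sequence consists of a random
  map \<open>g\<close> on the vertices, whose value at each \<open>v\<close> is distributed as \<open>step U n v\<close> and gives the
  vertex to which the walk jumps from \<open>v\<close>, and an independent waiting time \<open>s\<close> of rate \<open>2 n\<^sup>2\<close>,
  i.e. of mean \<open>1 / (2 n\<^sup>2)\<close>. The lemma \<open>walk_law\<close> below computes the resulting law.\<close>

definition noise1 :: "complex set \<Rightarrow> nat \<Rightarrow> ((complex \<Rightarrow> complex) \<times> real) measure" where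
  "noise1 U n =
     (\<Pi>\<^sub>M v\<in>grid U n. step U n v) \<Otimes>\<^sub>M density lborel (exponential_density (2 * (real n)\<^sup>2))"

definition noise :: "complex set \<Rightarrow> nat \<Rightarrow> ((complex \<Rightarrow> complex) \<times> real) stream measure" where
  "noise U n = stream_space (noise1 U n)"

primrec jump_chain ::
    "complex \<Rightarrow> ((complex \<Rightarrow> complex) \<times> real) stream \<Rightarrow> nat \<Rightarrow> complex" where
  "jump_chain z \<omega> 0 = z"
| "jump_chain z \<omega> (Suc k) = fst (\<omega> !! k) (jump_chain z \<omega> k)"

definition jump_time :: "((complex \<Rightarrow> complex) \<times> real) stream \<Rightarrow> nat \<Rightarrow> real" where
  "jump_time \<omega> k = (\<Sum>i<k. snd (\<omega> !! i))"

text \<open>The position is \<open>jump_chain z \<omega> k\<close> during \<open>[jump_time \<omega> k, jump_time \<omega> (Suc k))\<close>. The value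
  beyond an explosion (a null event) is irrelevant.\<close>

definition walk :: "complex \<Rightarrow> ((complex \<Rightarrow> complex) \<times> real) stream \<Rightarrow> real \<Rightarrow> complex" where
  "walk z \<omega> t = jump_chain z \<omega> (LEAST k. t < jump_time \<omega> (Suc k))"

definition hitting_time :: "(real \<Rightarrow> complex) \<Rightarrow> complex set \<Rightarrow> ereal" where
  "hitting_time X S = (INF t\<in>{t. 0 \<le> t \<and> X t \<in> S}. ereal t)"

text \<open>\<open>prob_hits_first U n z B A\<close> is the probability, for the walk started at \<open>z\<close>, of
  \<open>\<tau>(B) \<le> \<tau>(A)\<close>. It is a value in \<open>ennreal\<close>, where the supremum of the empty set is 0.\<close>

definition prob_hits_first ::
    "complex set \<Rightarrow> nat \<Rightarrow> complex \<Rightarrow> complex set \<Rightarrow> complex set \<Rightarrow> ennreal" where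
  "prob_hits_first U n z B A =
     emeasure (noise U n)
       {\<omega> \<in> space (noise U n).
          hitting_time (walk z \<omega>) (B \<inter> grid U n) \<le> hitting_time (walk z \<omega>) (A \<inter> grid U n)}"


lemma finite_grid:
  assumes "bounded U" "n > 0"
  shows "finite (grid U n)"
proof -
  obtain r where r: "\<And>z. z \<in> U \<Longrightarrow> norm z \<le> r"
    using assms(1) by (auto simp: bounded_iff)
  define N where "N = \<lceil>real n * r\<rceil>"
  have "grid U n \<subseteq> (\<lambda>(a,b). Complex (of_int a / real n) (of_int b / real n)) ` ({-N..N} \<times> {-N..N})"
  proof
    fix z assume z: "z \<in> grid U n"
    then obtain a b :: int where ab: "z = Complex (of_int a / real n) (of_int b / real n)"
      by (auto simp: grid_def scaled_lattice_def)
    have nz: "norm z \<le> r" using z r by (auto simp: grid_def)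
    have "\<bar>of_int a / real n\<bar> \<le> r" "\<bar>of_int b / real n\<bar> \<le> r"
      using abs_Re_le_cmod[of z] abs_Im_le_cmod[of z] nz ab by auto
    then have "\<bar>of_int a\<bar> \<le> real n * r" "\<bar>of_int b\<bar> \<le> real n * r"
      using assms(2) by (auto simp: field_simps abs_divide)
    then have "\<bar>a\<bar> \<le> N" "\<bar>b\<bar> \<le> N"
      unfolding N_def by linarith+
    then show "z \<in> (\<lambda>(a,b). Complex (of_int a / real n) (of_int b / real n)) ` ({-N..N} \<times> {-N..N})"
      using ab by (intro image_eqI[where x = "(a,b)"]) auto
  qed
  then show ?thesis by (rule finite_subset) auto
qed

lemma finite_nbrs: "bounded U \<Longrightarrow> n > 0 \<Longrightarrow> finite (nbrs U n z)"
  using finite_grid[of U n] by (auto simp: nbrs_def)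

lemma nbrs_subset_grid: "nbrs U n z \<subseteq> grid U n"
  by (auto simp: nbrs_def)

lemma prob_space_step: "bounded U \<Longrightarrow> n > 0 \<Longrightarrow> prob_space (step U n z)"
  unfolding step_def using finite_nbrs[of U n z]
  by (intro prob_space_uniform_count_measure) auto

lemma prob_space_PiM_step:
  "bounded U \<Longrightarrow> n > 0 \<Longrightarrow> prob_space (\<Pi>\<^sub>M v\<in>grid U n. step U n v)"
  by (intro prob_space_PiM prob_space_step)

lemma prob_space_waiting_time:
  "n > 0 \<Longrightarrow> prob_space (density lborel (exponential_density (2 * (real n)\<^sup>2)))"
  by (intro prob_space_exponential_density) simp

lemma prob_space_noise1:
  assumes "bounded U" "n > 0"
  shows "prob_space (noise1 U n)"
proof -
  interpret E: prob_space "density lborel (exponential_density (2 * (real n)\<^sup>2))"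
    by (rule prob_space_waiting_time[OF assms(2)])
  interpret F: prob_space "\<Pi>\<^sub>M v\<in>grid U n. step U n v"
    by (rule prob_space_PiM_step[OF assms])
  interpret P: pair_prob_space "\<Pi>\<^sub>M v\<in>grid U n. step U n v"
    "density lborel (exponential_density (2 * (real n)\<^sup>2))" ..
  show ?thesis unfolding noise1_def by (rule P.prob_space_axioms)
qed

lemma prob_space_noise:
  assumes "bounded U" "n > 0"
  shows "prob_space (noise U n)"
  unfolding noise_def by (rule prob_space.prob_space_stream_space[OF prob_space_noise1[OF assms]])

lemma measurable_snth_noise: "(\<lambda>\<omega>. \<omega> !! k) \<in> measurable (noise U n) (noise1 U n)"
  unfolding noise_def by measurable

lemma measurable_waiting_time: "(\<lambda>\<omega>. snd (\<omega> !! k)) \<in> borel_measurable (noise U n)"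
proof -
  have "snd \<in> borel_measurable (noise1 U n)"
    using measurable_snd[of "\<Pi>\<^sub>M v\<in>grid U n. step U n v"
        "density lborel (exponential_density (2 * (real n)\<^sup>2))"]
    unfolding noise1_def by simp
  then show ?thesis
    using measurable_snth_noise by (rule measurable_compose[rotated])
qed

lemma measurable_jump_time: "(\<lambda>\<omega>. jump_time \<omega> k) \<in> borel_measurable (noise U n)"
  unfolding jump_time_def by (intro borel_measurable_sum measurable_waiting_time)

lemma measurable_jump_map:
  assumes "v \<in> grid U n"
  shows "(\<lambda>x. fst x v) \<in> measurable (noise1 U n) (count_space (grid U n))"
proof -
  have 1: "(\<lambda>x. fst x v) \<in> measurable (noise1 U n) (step U n v)"
    unfolding noise1_def
    using measurable_compose[OF measurable_fst measurable_component_singleton[OF assms]] .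
  have "(\<lambda>x. x) \<in> measurable (step U n v) (count_space (grid U n))"
    unfolding step_def using nbrs_subset_grid[of U n v] assms
    by (auto simp: measurable_def sets_uniform_count_measure space_uniform_count_measure)
  from measurable_compose[OF 1 this] show ?thesis .
qed

lemma measurable_jump_chain:
  assumes "bounded U" "n > 0" "z \<in> grid U n"
  shows "(\<lambda>\<omega>. jump_chain z \<omega> k) \<in> measurable (noise U n) (count_space (grid U n))"
proof (induction k)
  case 0
  then show ?case using assms by simp
next
  case (Suc k)
  have "(\<lambda>\<omega>. (\<lambda>v \<omega>. fst (\<omega> !! k) v) (jump_chain z \<omega> k) \<omega>)
          \<in> measurable (noise U n) (count_space (grid U n))"
  proof (rule measurable_compose_countable'[OF _ Suc.IH])
    show "countable (grid U n)" using finite_grid[OF assms(1,2)] by (rule countable_finite)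
    show "(\<lambda>\<omega>. fst (\<omega> !! k) v) \<in> measurable (noise U n) (count_space (grid U n))"
      if "v \<in> grid U n" for v
      using measurable_compose[OF measurable_snth_noise measurable_jump_map[OF that]] .
  qed
  then show ?case by simp
qed

lemma measurable_walk:
  assumes "bounded U" "n > 0" "z \<in> grid U n"
  shows "(\<lambda>\<omega>. walk z \<omega> t) \<in> measurable (noise U n) (count_space (grid U n))"
proof -
  have "Measurable.pred (noise U n) (\<lambda>\<omega>. t < jump_time \<omega> (Suc k))" for k
    using measurable_jump_time[of "Suc k" U n] by measurable
  then have L: "(\<lambda>\<omega>. LEAST k. t < jump_time \<omega> (Suc k)) \<in> measurable (noise U n) (count_space UNIV)"
    by (intro measurable_Least)
  show ?thesis
    unfolding walk_def
    by (rule measurable_compose_countable[OF measurable_jump_chain[OF assms] L])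
qed

lemma hitting_time_rational:
  "hitting_time (walk z \<omega>) S =
     (INF q\<in>{q. 0 \<le> q \<and> q \<in> \<rat>}. if walk z \<omega> q \<in> S then ereal q else \<infinity>)"
    (is "?L = ?R")
proof (rule antisym)
  show "?L \<le> ?R"
  proof (rule INF_greatest)
    fix q :: real assume "q \<in> {q. 0 \<le> q \<and> q \<in> \<rat>}"
    then show "?L \<le> (if walk z \<omega> q \<in> S then ereal q else \<infinity>)"
      unfolding hitting_time_def by (auto intro!: INF_lower)
  qed
  show "?R \<le> ?L"
    unfolding hitting_time_def
  proof (rule INF_greatest)
    fix t assume t: "t \<in> {t. 0 \<le> t \<and> walk z \<omega> t \<in> S}"
    define P where "P s k \<longleftrightarrow> s < jump_time \<omega> (Suc k)" for s k
    have "\<exists>u>t. \<forall>q. t < q \<and> q < u \<longrightarrow> (LEAST k. P q k) = (LEAST k. P t k)"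
    proof (cases "\<exists>k. P t k")
      case True
      define k where "k = (LEAST k. P t k)"
      have k: "P t k" unfolding k_def using True by (rule LeastI_ex)
      have "(LEAST k. P q k) = k" if "t < q" "q < jump_time \<omega> (Suc k)" for q
      proof (rule Least_equality)
        show "P q k" using that by (simp add: P_def)
        fix j assume "P q j"
        then have "P t j" using that by (simp add: P_def)
        then show "k \<le> j" unfolding k_def by (rule Least_le)
      qed
      then show ?thesis
        using k unfolding k_def[symmetric] by (intro exI[of _ "jump_time \<omega> (Suc k)"]) (simp add: P_def)
    next
      case False
      have "P q k = P t k" if "t < q" for q k
      proof -
        have "\<not> P t k" using False by blast
        then show ?thesis using that by (simp add: P_def)
      qed
      then have "(LEAST k. P q k) = (LEAST k. P t k)" if "t < q" for q
        using that by presburger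
      then show ?thesis using less_add_one[of t] by blast
    qed
    then obtain u where u1: "u > t"
      and u: "\<forall>q. t < q \<and> q < u \<longrightarrow> (LEAST k. P q k) = (LEAST k. P t k)"
      by blast
    have u2: "walk z \<omega> q = walk z \<omega> t" if "t < q" "q < u" for q
      using u that unfolding walk_def P_def by simp
    show "?R \<le> ereal t"
    proof (rule ereal_le_epsilon2)
      fix e :: real assume "0 < e"
      then obtain q where q: "q \<in> \<rat>" "t < q" "q < min u (t + e)"
        using Rats_dense_in_real[of t "min u (t + e)"] u1 by auto
      have "?R \<le> (if walk z \<omega> q \<in> S then ereal q else \<infinity>)"
        using q t by (intro INF_lower) auto
      also have "\<dots> = ereal q" using u2[of q] q t by auto
      also have "\<dots> \<le> ereal t + ereal e" using q by simp
      finally show "?R \<le> ereal t + ereal e" .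
    qed
  qed
qed

lemma measurable_hitting_time:
  assumes "bounded U" "n > 0" "z \<in> grid U n"
  shows "(\<lambda>\<omega>. hitting_time (walk z \<omega>) S) \<in> borel_measurable (noise U n)"
proof -
  have "countable {q::real. 0 \<le> q \<and> q \<in> \<rat>}"
    by (rule countable_subset[OF _ countable_rat]) auto
  moreover have "(\<lambda>\<omega>. if walk z \<omega> q \<in> S then ereal q else \<infinity>) \<in> borel_measurable (noise U n)" for q
    using measurable_compose[OF measurable_walk[OF assms, of q],
      of "\<lambda>w. if w \<in> S then ereal q else \<infinity>" borel] by simp
  ultimately show ?thesis
    unfolding hitting_time_rational by (intro borel_measurable_INF) auto
qed

lemma sets_hits_first:
  assumes "bounded U" "n > 0" "z \<in> grid U n"
  shows "{\<omega> \<in> space (noise U n). hitting_time (walk z \<omega>) S \<le> hitting_time (walk z \<omega>) T}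
           \<in> sets (noise U n)"
  using measurable_hitting_time[OF assms, of S] measurable_hitting_time[OF assms, of T]
  by measurable

lemma jump_chain_Stream: "jump_chain z (x ## \<omega>) (Suc k) = jump_chain (fst x z) \<omega> k"
  by (induction k) auto

lemma walk_law:
  assumes "bounded U" "n > 0" "\<And>i. y i \<in> grid U n" "\<And>i. t i \<ge> 0"
  shows "emeasure (noise U n)
      {\<omega> \<in> space (noise U n).
         \<forall>i<k. jump_chain (y 0) \<omega> (Suc i) = y (Suc i) \<and> snd (\<omega> !! i) > t i} =
    (\<Prod>i<k. emeasure (step U n (y i)) ({y (Suc i)} \<inter> space (step U n (y i)))
           * ennreal (exp (- (t i * (2 * (real n)\<^sup>2)))))"
  using assms(3,4)
proof (induction k arbitrary: y t)
  case 0
  show ?case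
    by (simp add: prob_space.emeasure_space_1[OF prob_space_noise[OF assms(1,2)]])
next
  case (Suc k)
  let ?N = "noise U n" and ?N1 = "noise1 U n"
  let ?W = "density lborel (exponential_density (2 * (real n)\<^sup>2))"
  let ?F = "\<Pi>\<^sub>M v\<in>grid U n. step U n v"
  interpret N1: prob_space ?N1 by (rule prob_space_noise1[OF assms(1,2)])
  interpret W: prob_space ?W by (rule prob_space_waiting_time[OF assms(2)])
  interpret S: product_prob_space "step U n" "grid U n"
    using prob_space_step[OF assms(1,2)]
    unfolding product_prob_space_def product_prob_space_axioms_def product_sigma_finite_def
    by (simp add: prob_space_imp_sigma_finite)
  interpret F: prob_space ?F by (rule prob_space_PiM_step[OF assms(1,2)])
  define E where "E k y t = {\<omega> \<in> space ?N. \<forall>i<k. jump_chain (y 0) \<omega> (Suc i) = y (Suc i) \<and> snd (\<omega> !! i) > t i}"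
    for k and y :: "nat \<Rightarrow> complex" and t :: "nat \<Rightarrow> real"
  define D where "D = {x \<in> space ?N1. fst x (y 0) = y 1 \<and> snd x > t 0}"
  have E_sets: "E k y t \<in> sets ?N" if "\<And>i. y i \<in> grid U n" for k y t
  proof -
    have [measurable]: "Measurable.pred ?N (\<lambda>\<omega>. jump_chain (y 0) \<omega> (Suc i) = y (Suc i))" for i
      by (rule measurable_compose[OF measurable_jump_chain[OF assms(1,2) that]]) simp
    have [measurable]: "(\<lambda>\<omega>. snd (\<omega> !! i)) \<in> borel_measurable ?N" for i
      by (rule measurable_waiting_time)
    show ?thesis unfolding E_def by measurable
  qed
  have split: "{\<omega> \<in> space ?N. x ## \<omega> \<in> E (Suc k) y t} =
      (if x \<in> D then E k (\<lambda>i. y (Suc i)) (\<lambda>i. t (Suc i)) else {})" if "x \<in> space ?N1" for x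
  proof -
    have "x ## \<omega> \<in> space ?N \<longleftrightarrow> \<omega> \<in> space ?N" for \<omega>
      using that by (simp add: noise_def space_stream_space streams_Stream)
    moreover have "(\<forall>i<Suc k. jump_chain (y 0) (x ## \<omega>) (Suc i) = y (Suc i) \<and> snd ((x ## \<omega>) !! i) > t i)
        \<longleftrightarrow> x \<in> D \<and> (\<forall>i<k. jump_chain (y (Suc 0)) \<omega> (Suc i) = y (Suc (Suc i)) \<and> snd (\<omega> !! i) > t (Suc i))"
      for \<omega>
      unfolding All_less_Suc2 jump_chain_Stream using that by (auto simp: D_def)
    ultimately show ?thesis
      unfolding E_def by auto
  qed
  have A: "{y 1} \<inter> space (step U n (y 0)) \<in> sets (step U n (y 0))"
    by (auto simp: step_def sets_uniform_count_measure space_uniform_count_measure)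
  have D_eq: "D = {g \<in> space ?F. g (y 0) \<in> {y 1} \<inter> space (step U n (y 0))} \<times> {t 0<..}"
    using Suc.prems(1)[of 0] unfolding D_def noise1_def
    by (auto simp: space_pair_measure space_PiM PiE_iff extensional_def)
  have sF: "{g \<in> space ?F. g (y 0) \<in> {y 1} \<inter> space (step U n (y 0))} \<in> sets ?F"
    using measurable_sets[OF measurable_component_singleton[OF Suc.prems(1)[of 0],
        of "step U n"] A]
    by (simp add: vimage_def Int_def conj_commute)
  have eF: "emeasure ?F {g \<in> space ?F. g (y 0) \<in> {y 1} \<inter> space (step U n (y 0))} =
      emeasure (step U n (y 0)) ({y 1} \<inter> space (step U n (y 0)))"
    using S.emeasure_PiM_Collect_single[OF Suc.prems(1)[of 0] A] by simp
  have eW: "emeasure ?W {t 0<..} = ennreal (exp (- (t 0 * (2 * (real n)\<^sup>2))))"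
  proof -
    have "distributed ?W lborel (\<lambda>x. x) (exponential_density (2 * (real n)\<^sup>2))"
      unfolding distributed_def by (auto simp: distr_id2)
    from W.exponential_distributedD_gt[OF this, of "t 0"] Suc.prems(2)[of 0] assms(2)
    have "measure ?W {x. t 0 < x} = exp (- t 0 * (2 * (real n)\<^sup>2))" by simp
    then show ?thesis by (simp add: W.emeasure_eq_measure greaterThan_def)
  qed
  have D_sets: "D \<in> sets ?N1"
    unfolding D_eq noise1_def using sF by simp
  have eD: "emeasure ?N1 D = emeasure (step U n (y 0)) ({y 1} \<inter> space (step U n (y 0)))
           * ennreal (exp (- (t 0 * (2 * (real n)\<^sup>2))))"
    unfolding D_eq noise1_def
    by (subst W.emeasure_pair_measure_Times) (use sF eF eW in auto)
  have "emeasure ?N (E (Suc k) y t) = (\<integral>\<^sup>+x. emeasure ?N {\<omega> \<in> space ?N. x ## \<omega> \<in> E (Suc k) y t} \<partial>?N1)"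
    using N1.emeasure_stream_space[of "E (Suc k) y t"] E_sets[OF Suc.prems(1)]
    unfolding noise_def by simp
  also have "\<dots> = (\<integral>\<^sup>+x. emeasure ?N (E k (\<lambda>i. y (Suc i)) (\<lambda>i. t (Suc i))) * indicator D x \<partial>?N1)"
    by (rule nn_integral_cong) (simp add: split split: split_indicator)
  also have "\<dots> = emeasure ?N (E k (\<lambda>i. y (Suc i)) (\<lambda>i. t (Suc i))) * emeasure ?N1 D"
    using D_sets by (rule nn_integral_cmult_indicator)
  finally show ?case
    using Suc.IH[of "\<lambda>i. y (Suc i)" "\<lambda>i. t (Suc i)"] Suc.prems
    unfolding eD E_def[symmetric] prod.lessThan_Suc_shift
    by (simp add: E_def mult.commute)
qed

end

theory Submission
  imports Defs "HOL-Complex_Analysis.Complex_Analysis"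
begin

text \<open>Let \<open>h\<close> be the probability of reaching \<open>B(x\<^sub>1, \<epsilon>)\<close> no later than \<open>A\<close>, where \<open>A\<close> has been
  reduced to its part outside a fixed small ball around \<open>x\<^sub>1\<close>, which still has order \<open>n\<^sup>2\<close> points. By
  the Dirichlet principle the energy of \<open>h\<close> is at most that of a cutoff function that is
  logarithmic in the distance to \<open>x\<^sub>1\<close>, which is \<open>O(1 / K)\<close> if \<open>\<epsilon>\<close> is of order \<open>4\<^sup>-\<^sup>K\<close>. On the
  other hand, by the maximum principle the set \<open>{h \<ge> h z}\<close> contains a lattice path from \<open>z\<close> to
  \<open>B(x\<^sub>1, \<epsilon>)\<close>, and \<open>min (h / h z) 1\<close> is 1 on this path and 0 on \<open>A\<close>. A path of macroscopic
  length and a set of positive density have capacity bounded below uniformly in \<open>n\<close>: energy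
  controls the oscillation of a function along disjoint lattice rays started on the path, and a
  discrete Poincare inequality compares the mean over these rays with the mean over \<open>A\<close>. Hence
  \<open>(h z)\<^sup>2 = O(1 / K)\<close>. Regularity of the boundary enters only through a uniform
  interior cone condition with cones in the coordinate directions.\<close>

section \<open>Hitting probabilities\<close>

text \<open>In the plane a single vertex has capacity of order 1 / log n, so a value of
  \<open>h\<close> at \<open>z\<close> alone forces no energy from below; this is why the value must
  be spread over a connected set of macroscopic diameter. The same borderline effect works in favour
  of the upper bound: the energy is scale invariant, every annulus admits a cutoff of energy below
  one fixed constant, and averaging K of them gains the factor 1 / K. The cutoff can compete with
  \<open>h\<close> only if it vanishes on \<open>A\<close>, which is the reason for discarding the
  part of \<open>A\<close> near the target. The obstacle on the lower side is that the path is
  arbitrary: it may wind and may run along the boundary. Cones keep the rays inside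
  \<open>U\<close>, and taking one starting vertex per level of a coordinate transversal to the rays
  keeps them disjoint. The maximum principle needs every component of the lattice graph to meet
  \<open>A\<close>. This follows for large \<open>n\<close> from the capacity bound itself, so
  connectedness of the graph requires no separate proof.\<close>

definition hits_before ::
    "complex set \<Rightarrow> nat \<Rightarrow> complex set \<Rightarrow> complex set \<Rightarrow> complex \<Rightarrow>
      ((complex \<Rightarrow> complex) \<times> real) stream set" where
  "hits_before U n B A z = {\<omega> \<in> space (noise U n).
     \<forall>k. jump_chain z \<omega> k \<in> A \<longrightarrow> (\<exists>j\<le>k. jump_chain z \<omega> j \<in> B)}"

text \<open>Trajectories that visit neither set belong to \<open>hits_before\<close>, matching
  \<infinity> \<le> \<infinity> for the hitting times. The boundary values, 1 on \<open>B\<close>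
  and 0 on \<open>A - B\<close>, are thus immediate, without any recurrence argument.\<close>

definition hit_prob ::
    "complex set \<Rightarrow> nat \<Rightarrow> complex set \<Rightarrow> complex set \<Rightarrow> complex \<Rightarrow> real" where
  "hit_prob U n B A z = measure (noise U n) (hits_before U n B A z)"

lemma sets_hits_before:
  assumes "bounded U" "n > 0" "z \<in> grid U n"
  shows "hits_before U n B A z \<in> sets (noise U n)"
proof -
  have [measurable]: "Measurable.pred (noise U n) (\<lambda>\<omega>. jump_chain z \<omega> k \<in> S)" for k S
    by (rule measurable_compose[OF measurable_jump_chain[OF assms]]) simp
  show ?thesis unfolding hits_before_def by measurable
qed

lemma hit_prob_target:
  assumes "bounded U" "n > 0" "z \<in> B"
  shows "hit_prob U n B A z = 1"
proof -
  have "hits_before U n B A z = space (noise U n)"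
    unfolding hits_before_def using assms(3) by (auto intro!: exI[of _ 0])
  then show ?thesis
    unfolding hit_prob_def by (simp add: prob_space.prob_space[OF prob_space_noise[OF assms(1,2)]])
qed

lemma hit_prob_obstacle:
  assumes "z \<in> A" "z \<notin> B"
  shows "hit_prob U n B A z = 0"
proof -
  have "hits_before U n B A z = {}"
    unfolding hits_before_def using assms by (auto intro!: exI[of _ 0])
  then show ?thesis by (simp add: hit_prob_def)
qed

text \<open>First-step analysis: the head of the driving stream is separated from its tail. The mean
  value property is written as a vanishing sum of differences, which an isolated vertex satisfies as
  an empty sum.\<close>

lemma hit_prob_harmonic:
  assumes "bounded U" "n > 0" "z \<in> grid U n" "z \<notin> A" "z \<notin> B"
  shows "(\<Sum>w\<in>nbrs U n z. hit_prob U n B A w - hit_prob U n B A z) = 0"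
proof (cases "nbrs U n z = {}")
  case False
  let ?N = "noise U n" and ?N1 = "noise1 U n"
  let ?W = "density lborel (exponential_density (2 * (real n)\<^sup>2))"
  let ?F = "\<Pi>\<^sub>M v\<in>grid U n. step U n v"
  interpret N: prob_space ?N by (rule prob_space_noise[OF assms(1,2)])
  interpret N1: prob_space ?N1 by (rule prob_space_noise1[OF assms(1,2)])
  interpret W: prob_space ?W by (rule prob_space_waiting_time[OF assms(2)])
  define e where "e w = emeasure ?N (hits_before U n B A w)" for w
  have fin: "finite (nbrs U n z)" using finite_nbrs assms by blast
  have step: "step U n z = uniform_count_measure (nbrs U n z)"
    using False by (simp add: step_def)
  have e_meas [measurable]: "e \<in> borel_measurable (step U n z)"
    unfolding step by (auto simp: measurable_def sets_uniform_count_measure space_uniform_count_measure)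
  have comp [measurable]: "(\<lambda>g. g z) \<in> measurable ?F (step U n z)"
    by (rule measurable_component_singleton[OF assms(3)])
  have "e z = (\<integral>\<^sup>+x. emeasure ?N {\<omega> \<in> space ?N. x ## \<omega> \<in> hits_before U n B A z} \<partial>?N1)"
    unfolding e_def using N1.emeasure_stream_space[of "hits_before U n B A z"]
      sets_hits_before[OF assms(1-3)] unfolding noise_def by simp
  also have "\<dots> = (\<integral>\<^sup>+x. e (fst x z) \<partial>?N1)"
  proof (rule nn_integral_cong)
    fix x assume x: "x \<in> space ?N1"
    have "x ## \<omega> \<in> space ?N \<longleftrightarrow> \<omega> \<in> space ?N" for \<omega>
      using x by (simp add: noise_def space_stream_space streams_Stream)
    \<comment> \<open>Time zero contributes to neither side because \<open>z\<close> is outside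
      \<open>A\<close> and \<open>B\<close>; all other times shift by one.\<close>
    moreover have "(\<forall>k. jump_chain z (x ## \<omega>) k \<in> A \<longrightarrow> (\<exists>j\<le>k. jump_chain z (x ## \<omega>) j \<in> B)) \<longleftrightarrow>
        (\<forall>k. jump_chain (fst x z) \<omega> k \<in> A \<longrightarrow> (\<exists>j\<le>k. jump_chain (fst x z) \<omega> j \<in> B))"
      (is "?L \<longleftrightarrow> ?R") for \<omega>
    proof
      assume L: ?L
      show ?R
      proof (intro allI impI)
        fix k assume "jump_chain (fst x z) \<omega> k \<in> A"
        then obtain j where j: "j \<le> Suc k" "jump_chain z (x ## \<omega>) j \<in> B"
          using L[rule_format, of "Suc k"] by (auto simp del: jump_chain.simps(2) simp: jump_chain_Stream)
        moreover have "j \<noteq> 0" using j assms(5) by (intro notI) simp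
        ultimately obtain i where "j = Suc i" by (cases j) auto
        then show "\<exists>j\<le>k. jump_chain (fst x z) \<omega> j \<in> B"
          using j by (auto simp del: jump_chain.simps(2) simp: jump_chain_Stream)
      qed
    next
      assume R: ?R
      show ?L
      proof (intro allI impI)
        fix k assume k: "jump_chain z (x ## \<omega>) k \<in> A"
        then have "k \<noteq> 0" using assms(4) by (intro notI) simp
        then obtain i where i: "k = Suc i" by (cases k) auto
        then obtain j where "j \<le> i" "jump_chain (fst x z) \<omega> j \<in> B"
          using R[rule_format, of i] k by (auto simp del: jump_chain.simps(2) simp: jump_chain_Stream)
        then show "\<exists>j\<le>k. jump_chain z (x ## \<omega>) j \<in> B"
          using i by (intro exI[of _ "Suc j"]) (auto simp del: jump_chain.simps(2) simp: jump_chain_Stream)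
      qed
    qed
    ultimately have "{\<omega> \<in> space ?N. x ## \<omega> \<in> hits_before U n B A z} = hits_before U n B A (fst x z)"
      unfolding hits_before_def by blast
    then show "emeasure ?N {\<omega> \<in> space ?N. x ## \<omega> \<in> hits_before U n B A z} = e (fst x z)"
      by (simp add: e_def)
  qed
  also have "\<dots> = (\<integral>\<^sup>+g. (\<integral>\<^sup>+t. e (fst (g, t) z) \<partial>?W) \<partial>?F)"
    unfolding noise1_def
    by (rule W.nn_integral_fst[symmetric]) measurable
  \<comment> \<open>The waiting time integrates to one; what remains depends on the random map only
    through its value at \<open>z\<close>, whose law is \<open>step U n z\<close>.\<close>
  also have "\<dots> = (\<integral>\<^sup>+g. e (g z) \<partial>?F)"
    using W.emeasure_space_1 by (simp add: nn_integral_const)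
  also have "\<dots> = (\<integral>\<^sup>+w. e w \<partial>(distr ?F (step U n z) (\<lambda>g. g z)))"
    by (rule nn_integral_distr[OF comp, symmetric]) (simp add: e_meas)
  also have "\<dots> = (\<integral>\<^sup>+w. e w \<partial>(step U n z))"
    by (subst distr_PiM_component[OF prob_space_step[OF assms(1,2)] assms(3)]) simp
  also have "\<dots> = (\<Sum>w\<in>nbrs U n z. ennreal (1 / card (nbrs U n z)) * e w)"
    unfolding step uniform_count_measure_def using nn_integral_point_measure_finite[OF fin] by simp
  also have "\<dots> = (\<Sum>w\<in>nbrs U n z. ennreal (hit_prob U n B A w / card (nbrs U n z)))"
    unfolding e_def N.emeasure_eq_measure hit_prob_def by (simp add: ennreal_mult'[symmetric])
  also have "\<dots> = ennreal (\<Sum>w\<in>nbrs U n z. hit_prob U n B A w / card (nbrs U n z))"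
    by (rule sum_ennreal) (simp add: hit_prob_def)
  finally have "ennreal (hit_prob U n B A z) =
      ennreal (\<Sum>w\<in>nbrs U n z. hit_prob U n B A w / card (nbrs U n z))"
    by (simp add: e_def N.emeasure_eq_measure hit_prob_def)
  then have "hit_prob U n B A z = (\<Sum>w\<in>nbrs U n z. hit_prob U n B A w / card (nbrs U n z))"
    by (subst (asm) ennreal_inj) (auto simp: hit_prob_def intro!: sum_nonneg)
  then show ?thesis
    using False fin by (simp add: sum_subtractf sum_divide_distrib[symmetric] field_simps)
qed simp

section \<open>From the continuous-time walk to its jump chain\<close>

lemma AE_waiting_times_pos:
  assumes "bounded U" "n > 0"
  shows "AE \<omega> in noise U n. \<forall>k. 0 < snd (\<omega> !! k)"
proof -
  let ?W = "density lborel (exponential_density (2 * (real n)\<^sup>2))"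
  let ?F = "\<Pi>\<^sub>M v\<in>grid U n. step U n v"
  interpret N1: prob_space "noise1 U n" by (rule prob_space_noise1[OF assms])
  interpret W: prob_space ?W by (rule prob_space_waiting_time[OF assms(2)])
  interpret F: prob_space ?F by (rule prob_space_PiM_step[OF assms])
  interpret P: pair_prob_space ?F ?W ..
  have "AE t in ?W. 0 < t"
    by (subst AE_density)
      (auto intro!: eventually_mono[OF AE_lborel_singleton[of 0]] simp: exponential_density_def)
  then have "AE g in ?F. AE t in ?W. 0 < snd (g, t)" by simp
  then have AE1: "AE x in noise1 U n. 0 < snd x"
    unfolding noise1_def by (intro P.AE_pair_measure) measurable
  have "Measurable.pred (noise1 U n) (\<lambda>x. 0 < snd x)"
    unfolding noise1_def by measurable
  from N1.AE_stream_all[OF this AE1] show ?thesis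
    unfolding noise_def by (simp add: stream_all_def sset_range)
qed

lemma walk_on_jump_interval:
  assumes pos: "\<And>k. 0 < snd (\<omega> !! k)"
    and t: "jump_time \<omega> k \<le> t" "t < jump_time \<omega> (Suc k)"
  shows "walk z \<omega> t = jump_chain z \<omega> k"
proof -
  have "mono (jump_time \<omega>)"
    by (rule incseq_SucI) (simp add: jump_time_def pos less_imp_le)
  then have "(LEAST j. t < jump_time \<omega> (Suc j)) = k"
    using t by (intro Least_equality) (auto simp: mono_def not_less[symmetric] dest: spec, 
      metis Suc_leI leD monoD not_le_imp_less order_le_less_trans)
  then show ?thesis by (simp add: walk_def)
qed

text \<open>If the chain enters \<open>A\<close> at step \<open>k\<close> without an earlier or
  simultaneous visit to \<open>B\<close>, the walk is in \<open>A\<close> at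
  \<open>jump_time \<omega> k\<close> and avoids \<open>B\<close> up to the strictly later time
  \<open>jump_time \<omega> (Suc k)\<close>. Positive waiting times give the strictness and ensure
  that the walk shows state \<open>k\<close> at all. Only times before a fixed jump matter, so
  explosion is harmless.\<close>

lemma hits_before_of_hitting_time_le:
  assumes \<omega>: "\<omega> \<in> space (noise U n)" and pos: "\<And>k. 0 < snd (\<omega> !! k)"
    and le: "hitting_time (walk z \<omega>) B \<le> hitting_time (walk z \<omega>) A"
  shows "\<omega> \<in> hits_before U n B A z"
proof (rule ccontr)
  assume "\<omega> \<notin> hits_before U n B A z"
  then obtain k where k: "jump_chain z \<omega> k \<in> A" "\<And>j. j \<le> k \<Longrightarrow> jump_chain z \<omega> j \<notin> B"
    using \<omega> by (auto simp: hits_before_def)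
  have nonneg: "0 \<le> jump_time \<omega> j" for j
    by (auto simp: jump_time_def intro!: sum_nonneg less_imp_le[OF pos])
  have less: "jump_time \<omega> k < jump_time \<omega> (Suc k)"
    using pos by (simp add: jump_time_def)
  have "walk z \<omega> (jump_time \<omega> k) \<in> A"
    using walk_on_jump_interval[OF pos _ less] k by simp
  then have "hitting_time (walk z \<omega>) A \<le> ereal (jump_time \<omega> k)"
    unfolding hitting_time_def using nonneg by (intro INF_lower) auto
  also have "\<dots> < ereal (jump_time \<omega> (Suc k))" using less by simp
  also have "\<dots> \<le> hitting_time (walk z \<omega>) B"
    unfolding hitting_time_def
  proof (rule INF_greatest)
    fix t assume t: "t \<in> {t. 0 \<le> t \<and> walk z \<omega> t \<in> B}"
    have "\<not> t < jump_time \<omega> (Suc k)"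
    proof
      assume "t < jump_time \<omega> (Suc k)"
      define i where "i = (LEAST i. t < jump_time \<omega> (Suc i))"
      have "i \<le> k" unfolding i_def by (rule Least_le) fact
      then show False using k(2)[of i] t by (simp add: walk_def i_def)
    qed
    then show "ereal (jump_time \<omega> (Suc k)) \<le> ereal t" by simp
  qed
  finally show False using le by simp
qed

text \<open>Shrinking the obstacle to \<open>A'\<close> delays its hitting time and enlarges the
  event. This permits dropping the part of \<open>A\<close> close to the target.\<close>

lemma prob_hits_first_le_hit_prob:
  assumes "bounded U" "n > 0" "z \<in> grid U n" "A' \<subseteq> A"
  shows "prob_hits_first U n z B A \<le> ennreal (hit_prob U n (B \<inter> grid U n) (A' \<inter> grid U n) z)"
proof -
  interpret prob_space "noise U n" by (rule prob_space_noise[OF assms(1,2)])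
  have mono: "hitting_time (walk z \<omega>) (A \<inter> grid U n) \<le> hitting_time (walk z \<omega>) (A' \<inter> grid U n)" for \<omega>
    unfolding hitting_time_def using assms(4) by (intro INF_superset_mono) auto
  have "prob_hits_first U n z B A \<le> emeasure (noise U n) (hits_before U n (B \<inter> grid U n) (A' \<inter> grid U n) z)"
    unfolding prob_hits_first_def
  proof (rule emeasure_mono_AE)
    show "AE \<omega> in noise U n. \<omega> \<in> {\<omega> \<in> space (noise U n).
          hitting_time (walk z \<omega>) (B \<inter> grid U n) \<le> hitting_time (walk z \<omega>) (A \<inter> grid U n)} \<longrightarrow>
        \<omega> \<in> hits_before U n (B \<inter> grid U n) (A' \<inter> grid U n) z"
      using AE_waiting_times_pos[OF assms(1,2)]
      by eventually_elim (auto intro!: hits_before_of_hitting_time_le order_trans[OF _ mono])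
  qed (rule sets_hits_before[OF assms(1-3)])
  then show ?thesis by (simp add: emeasure_eq_measure hit_prob_def)
qed

section \<open>Counting lattice points\<close>

lemma int_interval:
  fixes x R :: real
  assumes "n > 0"
  shows "{a::int. \<bar>of_int a / real n - x\<bar> < R} = {\<lfloor>n * (x - R)\<rfloor> + 1 .. \<lceil>n * (x + R)\<rceil> - 1}"
proof -
  have "\<bar>of_int a / real n - x\<bar> < R \<longleftrightarrow> n * (x - R) < of_int a \<and> of_int a < n * (x + R)" for a :: int
    using assms by (auto simp: abs_less_iff field_simps)
  moreover have "n * (x - R) < of_int a \<longleftrightarrow> \<lfloor>n * (x - R)\<rfloor> + 1 \<le> a" for a :: int
    by (metis add1_zle_eq floor_less_iff)
  moreover have "of_int a < n * (x + R) \<longleftrightarrow> a \<le> \<lceil>n * (x + R)\<rceil> - 1" for a :: int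
    by (metis zle_diff1_eq less_ceiling_iff)
  ultimately show ?thesis by (simp only: set_eq_iff mem_Collect_eq atLeastAtMost_iff simp_thms)
qed

lemma card_int_interval_le:
  fixes x R :: real
  assumes "n > 0" "R > 0"
  shows "real (card {a::int. \<bar>of_int a / real n - x\<bar> < R}) \<le> 2 * R * n + 1"
proof -
  have "real n * (x + R) = n * (x - R) + 2 * R * n" by (simp add: algebra_simps)
  moreover have "0 < R * n" using assms by simp
  ultimately show ?thesis
    unfolding int_interval[OF assms(1)] by simp linarith
qed

lemma card_int_interval_ge:
  fixes x R :: real
  assumes "n > 0"
  shows "2 * R * n - 1 \<le> real (card {a::int. \<bar>of_int a / real n - x\<bar> < R})"
proof -
  have "real n * (x + R) = n * (x - R) + 2 * R * n" by (simp add: algebra_simps)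
  then show ?thesis
    unfolding int_interval[OF assms(1)] by simp linarith
qed

definition lattice_point :: "nat \<Rightarrow> int \<times> int \<Rightarrow> complex" where
  "lattice_point n = (\<lambda>(a, b). Complex (of_int a / real n) (of_int b / real n))"

lemma scaled_lattice_eq: "scaled_lattice n = range (lattice_point n)"
  by (auto simp: scaled_lattice_def lattice_point_def image_iff)

lemma inj_lattice_point: "n > 0 \<Longrightarrow> inj_on (lattice_point n) S"
  by (auto simp: inj_on_def lattice_point_def)

lemma lattice_ball_subset:
  "scaled_lattice n \<inter> ball p R \<subseteq> lattice_point n `
     ({a. \<bar>of_int a / real n - Re p\<bar> < R} \<times> {b. \<bar>of_int b / real n - Im p\<bar> < R})"
proof
  fix z assume z: "z \<in> scaled_lattice n \<inter> ball p R"
  then obtain a b where ab: "z = lattice_point n (a, b)" by (auto simp: scaled_lattice_eq)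
  have "cmod (z - p) < R" using z by (simp add: dist_norm norm_minus_commute)
  then have "\<bar>Re (z - p)\<bar> < R" "\<bar>Im (z - p)\<bar> < R"
    using abs_Re_le_cmod[of "z - p"] abs_Im_le_cmod[of "z - p"] by linarith+
  then show "z \<in> lattice_point n `
     ({a. \<bar>of_int a / real n - Re p\<bar> < R} \<times> {b. \<bar>of_int b / real n - Im p\<bar> < R})"
    using ab by (auto simp: lattice_point_def)
qed

lemma finite_lattice_ball:
  assumes "n > 0"
  shows "finite (scaled_lattice n \<inter> ball p R)"
  using lattice_ball_subset by (rule finite_subset) (simp add: int_interval[OF assms])

lemma card_lattice_ball_le:
  assumes "n > 0" "R > 0" "1 \<le> R * n"
  shows "real (card (scaled_lattice n \<inter> ball p R)) \<le> 9 * R\<^sup>2 * (real n)\<^sup>2"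
proof -
  let ?A = "{a::int. \<bar>of_int a / real n - Re p\<bar> < R}" and ?B = "{a::int. \<bar>of_int a / real n - Im p\<bar> < R}"
  have "card (scaled_lattice n \<inter> ball p R) \<le> card (lattice_point n ` (?A \<times> ?B))"
    by (rule card_mono[OF _ lattice_ball_subset]) (simp add: int_interval[OF assms(1)])
  also have "\<dots> = card ?A * card ?B"
    by (simp add: card_image[OF inj_lattice_point[OF assms(1)]] card_cartesian_product)
  finally have "real (card (scaled_lattice n \<inter> ball p R)) \<le> real (card ?A) * real (card ?B)"
    using of_nat_mono by fastforce
  \<comment> \<open>The mesh condition 1 \<le> R n absorbs the additive 1 of each side count: 2 R n
    + 1 \<le> 3 R n.\<close>
  also have "\<dots> \<le> (3 * R * n) * (3 * R * n)"
    using card_int_interval_le[OF assms(1,2), of "Re p"] card_int_interval_le[OF assms(1,2), of "Im p"] assms(3)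
    by (intro mult_mono) auto
  finally show ?thesis by (simp add: power2_eq_square mult_ac)
qed

lemma card_lattice_ball_ge:
  assumes "n > 0" "R > 0" "2 \<le> R * n"
  shows "R\<^sup>2 * (real n)\<^sup>2 / 4 \<le> real (card (scaled_lattice n \<inter> ball p R))"
proof -
  \<comment> \<open>The open square of side \<open>R\<close> about \<open>p\<close> lies in the
    ball, since the modulus is at most the sum of the coordinates; each side holds at least R n - 1
    \<ge> R n / 2 points.\<close>
  let ?A = "{a::int. \<bar>of_int a / real n - Re p\<bar> < R / 2}" and ?B = "{a::int. \<bar>of_int a / real n - Im p\<bar> < R / 2}"
  have "lattice_point n ` (?A \<times> ?B) \<subseteq> scaled_lattice n \<inter> ball p R"
  proof
    fix z assume "z \<in> lattice_point n ` (?A \<times> ?B)"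
    then have z: "z \<in> scaled_lattice n" "\<bar>Re (z - p)\<bar> < R / 2" "\<bar>Im (z - p)\<bar> < R / 2"
      by (auto simp: scaled_lattice_eq lattice_point_def)
    then have "cmod (z - p) < R" using cmod_le[of "z - p"] by linarith
    then show "z \<in> scaled_lattice n \<inter> ball p R" using z by (simp add: dist_norm norm_minus_commute)
  qed
  then have "card (lattice_point n ` (?A \<times> ?B)) \<le> card (scaled_lattice n \<inter> ball p R)"
    by (rule card_mono[OF finite_lattice_ball[OF assms(1)]])
  then have *: "card ?A * card ?B \<le> card (scaled_lattice n \<inter> ball p R)"
    by (simp add: card_image[OF inj_lattice_point[OF assms(1)]] card_cartesian_product)
  have "(R * n / 2) * (R * n / 2) \<le> real (card ?A) * real (card ?B)"
    using card_int_interval_ge[OF assms(1), of "R / 2" "Re p"] card_int_interval_ge[OF assms(1), of "R / 2" "Im p"] assms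
    by (intro mult_mono) auto
  also have "\<dots> \<le> real (card (scaled_lattice n \<inter> ball p R))"
    using of_nat_mono[OF *, where 'a = real] by simp
  finally show ?thesis by (simp add: power2_eq_square mult_ac)
qed

lemma card_grid_le:
  assumes "bounded U"
  obtains C where "C > 0" "\<And>n. n > 0 \<Longrightarrow> real (card (grid U n)) \<le> C * (real n)\<^sup>2"
proof -
  obtain R where R: "R \<ge> 1" "U \<subseteq> ball 0 R"
  proof -
    obtain r where "U \<subseteq> ball 0 r" using assms bounded_subset_ballD by blast
    then show ?thesis using that[of "max 1 r"] subset_ball[of r "max 1 r" 0] by force
  qed
  have "real (card (grid U n)) \<le> 9 * R\<^sup>2 * (real n)\<^sup>2" if "n > 0" for n
  proof -
    have "card (grid U n) \<le> card (scaled_lattice n \<inter> ball 0 R)"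
      using R by (intro card_mono finite_lattice_ball that) (auto simp: grid_def)
    also have "real (card (scaled_lattice n \<inter> ball 0 R)) \<le> 9 * R\<^sup>2 * (real n)\<^sup>2"
      using R that mult_mono[of 1 R 1 "real n"] by (intro card_lattice_ball_le) auto
    finally show ?thesis by simp
  qed
  then show ?thesis using that[of "9 * R\<^sup>2"] R by simp
qed

lemma card_nbrs_le:
  assumes "n > 0" "z \<in> scaled_lattice n"
  shows "card (nbrs U n z) \<le> 4"
proof -
  obtain a b where z: "z = lattice_point n (a, b)" using assms(2) by (auto simp: scaled_lattice_eq)
  have "nbrs U n z \<subseteq> lattice_point n ` {(a + 1, b), (a - 1, b), (a, b + 1), (a, b - 1)}"
  proof
    fix w assume "w \<in> nbrs U n z"
    then have w: "w \<in> scaled_lattice n" "cmod (z - w) = 1 / n" by (auto simp: nbrs_def grid_def dist_norm)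
    then obtain c d where cd: "w = lattice_point n (c, d)" by (auto simp: scaled_lattice_eq)
    have "(of_int a / n - of_int c / n)\<^sup>2 + (of_int b / n - of_int d / n)\<^sup>2 = (1 / real n)\<^sup>2"
      using w(2) cmod_power2[of "z - w"] unfolding z cd by (simp add: lattice_point_def)
    then have "real_of_int ((a - c)\<^sup>2 + (b - d)\<^sup>2) = real_of_int 1"
      using assms by (simp add: diff_divide_distrib[symmetric] power_divide add_divide_distrib[symmetric])
    then have eq: "(a - c)\<^sup>2 + (b - d)\<^sup>2 = 1" by (simp only: of_int_eq_iff)
    have "(a - c)\<^sup>2 \<le> 1\<^sup>2" "(b - d)\<^sup>2 \<le> 1\<^sup>2" 
      using eq zero_le_power2[of "a - c"] zero_le_power2[of "b - d"] unfolding power_one by linarith+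
    then have "\<bar>a - c\<bar> \<le> 1" "\<bar>b - d\<bar> \<le> 1" by (simp_all add: abs_square_le_1)
    then have "a - c \<in> {-1, 0, 1}" "b - d \<in> {-1, 0, 1}" by auto
    then have "(c, d) \<in> {(a + 1, b), (a - 1, b), (a, b + 1), (a, b - 1)}"
      using eq by (auto simp: algebra_simps)
    then show "w \<in> lattice_point n ` {(a + 1, b), (a - 1, b), (a, b + 1), (a, b - 1)}"
      using cd by blast
  qed
  then have "card (nbrs U n z) \<le> card (lattice_point n ` {(a + 1, b), (a - 1, b), (a, b + 1), (a, b - 1)})"
    by (rule card_mono[rotated]) simp
  also have "\<dots> \<le> card {(a + 1, b), (a - 1, b), (a, b + 1), (a, b - 1)}" by (rule card_image_le) simp
  also have "\<dots> \<le> 4" by (rule order_trans[OF card_insert_le_m1]) (auto simp: card_insert_if)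
  finally show ?thesis .
qed

section \<open>Discrete Dirichlet energy\<close>

text \<open>Each edge is counted from both endpoints, so this is twice the usual Dirichlet form.
  There is no power of \<open>n\<close> in front: in two dimensions the form is scale invariant and
  stays bounded for a fixed smooth function.\<close>

definition energy :: "complex set \<Rightarrow> nat \<Rightarrow> (complex \<Rightarrow> real) \<Rightarrow> real" where
  "energy U n g = (\<Sum>z\<in>grid U n. \<Sum>w\<in>nbrs U n z. (g w - g z)\<^sup>2)"

lemma energy_nonneg: "0 \<le> energy U n g"
  unfolding energy_def by (intro sum_nonneg) auto

lemma nbrs_sym: "z \<in> grid U n \<Longrightarrow> w \<in> nbrs U n z \<Longrightarrow> z \<in> nbrs U n w"
  by (auto simp: nbrs_def dist_commute closed_segment_commute)

lemma sum_edges_swap: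
  fixes F :: "complex \<Rightarrow> complex \<Rightarrow> 'a::comm_monoid_add"
  assumes "bounded U" "n > 0"
  shows "(\<Sum>z\<in>grid U n. \<Sum>w\<in>nbrs U n z. F z w) = (\<Sum>z\<in>grid U n. \<Sum>w\<in>nbrs U n z. F w z)"
proof -
  note fin = finite_grid[OF assms] finite_nbrs[OF assms]
  have "(\<Sum>z\<in>grid U n. \<Sum>w\<in>nbrs U n z. F z w) = (\<Sum>(z,w)\<in>Sigma (grid U n) (nbrs U n). F z w)"
    by (rule sum.Sigma) (use fin in auto)
  also have "\<dots> = (\<Sum>(z,w)\<in>Sigma (grid U n) (nbrs U n). F w z)"
    by (rule sum.reindex_bij_witness[of _ prod.swap prod.swap])
      (auto intro: nbrs_sym subsetD[OF nbrs_subset_grid])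
  also have "\<dots> = (\<Sum>z\<in>grid U n. \<Sum>w\<in>nbrs U n z. F w z)"
    by (rule sum.Sigma[symmetric]) (use fin in auto)
  finally show ?thesis .
qed

text \<open>Dirichlet principle: with f = h + \<phi> and \<phi> zero on \<open>S\<close>, summation
  by parts moves the difference from \<phi> onto \<open>h\<close>, where harmonicity off
  \<open>S\<close> kills it. Hence the energies of \<open>h\<close> and \<phi> add up.\<close>

lemma energy_harmonic_le:
  assumes "bounded U" "n > 0"
    and harm: "\<And>z. z \<in> grid U n \<Longrightarrow> z \<notin> S \<Longrightarrow> (\<Sum>w\<in>nbrs U n z. h w - h z) = 0"
    and eq: "\<And>z. z \<in> grid U n \<Longrightarrow> z \<in> S \<Longrightarrow> f z = h z"
  shows "energy U n h \<le> energy U n f"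
proof -
  define \<phi> where "\<phi> z = f z - h z" for z
  have 0: "(\<Sum>z\<in>grid U n. \<Sum>w\<in>nbrs U n z. (h w - h z) * \<phi> z) = 0"
  proof (rule sum.neutral, rule ballI)
    fix z assume z: "z \<in> grid U n"
    have "(\<Sum>w\<in>nbrs U n z. (h w - h z) * \<phi> z) = (\<Sum>w\<in>nbrs U n z. h w - h z) * \<phi> z"
      by (simp add: sum_distrib_right)
    then show "(\<Sum>w\<in>nbrs U n z. (h w - h z) * \<phi> z) = 0"
      using harm[OF z] eq[OF z] by (cases "z \<in> S") (auto simp: \<phi>_def)
  qed
  have "(\<Sum>z\<in>grid U n. \<Sum>w\<in>nbrs U n z. (h w - h z) * \<phi> w) =
      (\<Sum>z\<in>grid U n. \<Sum>w\<in>nbrs U n z. (h z - h w) * \<phi> z)"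
    by (rule sum_edges_swap[OF assms(1,2)])
  also have "\<dots> = - (\<Sum>z\<in>grid U n. \<Sum>w\<in>nbrs U n z. (h w - h z) * \<phi> z)"
    unfolding sum_negf[symmetric] by (intro sum.cong refl) (simp add: algebra_simps)
  finally have cross: "(\<Sum>z\<in>grid U n. \<Sum>w\<in>nbrs U n z. (h w - h z) * (\<phi> w - \<phi> z)) = 0"
    using 0 by (simp add: right_diff_distrib sum_subtractf)
  have "energy U n f = (\<Sum>z\<in>grid U n. \<Sum>w\<in>nbrs U n z.
      (h w - h z)\<^sup>2 + ((\<phi> w - \<phi> z)\<^sup>2 + 2 * ((h w - h z) * (\<phi> w - \<phi> z))))"
    unfolding energy_def \<phi>_def by (intro sum.cong refl) (simp add: power2_eq_square algebra_simps)
  also have "\<dots> = energy U n h + (energy U n \<phi> + 2 * (\<Sum>z\<in>grid U n. \<Sum>w\<in>nbrs U n z. (h w - h z) * (\<phi> w - \<phi> z)))"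
    by (simp add: energy_def sum.distrib sum_distrib_left)
  finally show ?thesis using cross energy_nonneg[of U n \<phi>] by simp
qed

text \<open>Distinct tails give distinct directed edges, so each term is charged to its own inner
  sum of the energy. The path estimates below reduce to checking this injectivity.\<close>

lemma sum_edges_le_energy:
  assumes "bounded U" "n > 0" "finite I" "inj_on p I"
    and "\<And>i. i \<in> I \<Longrightarrow> p i \<in> grid U n" "\<And>i. i \<in> I \<Longrightarrow> q i \<in> nbrs U n (p i)"
  shows "(\<Sum>i\<in>I. (g (q i) - g (p i))\<^sup>2) \<le> energy U n g"
proof -
  have "(\<Sum>i\<in>I. (g (q i) - g (p i))\<^sup>2) \<le> (\<Sum>i\<in>I. \<Sum>w\<in>nbrs U n (p i). (g w - g (p i))\<^sup>2)"
  proof (rule sum_mono)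
    fix i assume "i \<in> I"
    then show "(g (q i) - g (p i))\<^sup>2 \<le> (\<Sum>w\<in>nbrs U n (p i). (g w - g (p i))\<^sup>2)"
      using assms(6)[of i] finite_nbrs[OF assms(1,2)]
      by (intro member_le_sum[where f = "\<lambda>w. (g w - g (p i))\<^sup>2"]) auto
  qed
  also have "\<dots> = (\<Sum>z\<in>p ` I. \<Sum>w\<in>nbrs U n z. (g w - g z)\<^sup>2)"
    by (simp add: sum.reindex[OF assms(4)])
  also have "\<dots> \<le> energy U n g"
    unfolding energy_def using assms(5) finite_grid[OF assms(1,2)]
    by (intro sum_mono2) (auto intro!: sum_nonneg)
  finally show ?thesis .
qed

section \<open>Telescoping along lattice rays\<close>

definition axes :: "complex set" where
  "axes = {1, -1, \<i>, -\<i>}"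

lemma norm_axis: "d \<in> axes \<Longrightarrow> cmod d = 1"
  by (auto simp: axes_def)

lemma lattice_add: "z \<in> scaled_lattice n \<Longrightarrow> w \<in> scaled_lattice n \<Longrightarrow> z + w \<in> scaled_lattice n"
proof -
  assume "z \<in> scaled_lattice n" "w \<in> scaled_lattice n"
  then obtain a b c d where "z = lattice_point n (a, b)" "w = lattice_point n (c, d)"
    by (auto simp: scaled_lattice_eq)
  then have "z + w = lattice_point n (a + c, b + d)"
    by (simp add: lattice_point_def add_divide_distrib complex_eq_iff)
  then show "z + w \<in> scaled_lattice n" by (simp add: scaled_lattice_eq)
qed

lemma axis_vector_in_lattice:
  assumes "d \<in> axes"
  shows "of_real (of_int k / real n) * d \<in> scaled_lattice n"
proof -
  have "of_real (of_int k / real n) * d \<in> lattice_point n ` {(k, 0), (-k, 0), (0, k), (0, -k)}"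
    using assms by (auto simp: axes_def lattice_point_def complex_eq_iff)
  then show ?thesis by (auto simp: scaled_lattice_eq)
qed

definition ray :: "nat \<Rightarrow> complex \<Rightarrow> complex \<Rightarrow> nat \<Rightarrow> complex" where
  "ray n d z k = z + of_real (real k / real n) * d"

lemma ray_0 [simp]: "ray n d z 0 = z"
  by (simp add: ray_def)

lemma ray_in_lattice: "d \<in> axes \<Longrightarrow> z \<in> scaled_lattice n \<Longrightarrow> ray n d z k \<in> scaled_lattice n"
  unfolding ray_def using axis_vector_in_lattice[of d "int k" n] by (simp add: lattice_add)

lemma ray_Suc: "ray n d z (Suc k) = ray n d z k + of_real (1 / real n) * d"
  by (simp add: ray_def add_divide_distrib algebra_simps)

lemma ray_in_segment:
  assumes "j \<le> k"
  shows "ray n d z j \<in> closed_segment z (ray n d z k)"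
proof (cases "k = 0")
  case False
  have "ray n d z j = (1 - real j / real k) *\<^sub>R z + (real j / real k) *\<^sub>R ray n d z k"
    using False by (simp add: ray_def scaleR_conv_of_real algebra_simps)
  then show ?thesis
    using assms False unfolding closed_segment_def by (auto intro!: exI[of _ "real j / real k"])
qed (use assms in simp)

lemma ray_step:
  assumes "n > 0" "d \<in> axes" "z \<in> scaled_lattice n" "j < k"
    and "closed_segment z (ray n d z k) \<subseteq> U"
  shows "ray n d z j \<in> grid U n" "ray n d z (Suc j) \<in> nbrs U n (ray n d z j)"
proof -
  have in1: "ray n d z i \<in> closed_segment z (ray n d z k)" if "i \<le> k" for i
    using that by (rule ray_in_segment)
  have seg: "closed_segment (ray n d z j) (ray n d z (Suc j)) \<subseteq> U"
    using closed_segment_subset[OF in1[of j] in1[of "Suc j"] convex_closed_segment] assms(4,5) by auto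
  show "ray n d z j \<in> grid U n"
    using seg ray_in_lattice[OF assms(2,3)] by (auto simp: grid_def)
  show "ray n d z (Suc j) \<in> nbrs U n (ray n d z j)"
    using seg ray_in_lattice[OF assms(2,3), of "Suc j"] assms(1) norm_axis[OF assms(2)]
    by (auto simp: nbrs_def grid_def dist_norm ray_Suc[of n d z j] norm_divide)
qed

lemma ray_diff_le:
  fixes g :: "complex \<Rightarrow> real"
  shows "(g (ray n d z k) - g z)\<^sup>2 \<le> k * (\<Sum>j<k. (g (ray n d z (Suc j)) - g (ray n d z j))\<^sup>2)"
proof -
  have "g (ray n d z k) - g z = (\<Sum>j<k. g (ray n d z (Suc j)) - g (ray n d z j))"
    using sum_lessThan_telescope[of "\<lambda>j. g (ray n d z j)" k] by simp
  then show ?thesis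
    using sum_squared_le_sum_of_squares[of "\<lambda>j. g (ray n d z (Suc j)) - g (ray n d z j)" "{..<k}"]
    by (simp add: mult.commute)
qed

text \<open>One factor \<open>k\<close> is Cauchy-Schwarz along a ray; the other counts levels. At a
  fixed level the vertices form a translate of \<open>X\<close>, hence are distinct, and cost at
  most one energy. Rays from different starting points may overlap.\<close>

lemma sum_ray_diff_le:
  assumes "bounded U" "n > 0" "d \<in> axes" "X \<subseteq> grid U n"
    and seg: "\<And>x. x \<in> X \<Longrightarrow> closed_segment x (ray n d x k) \<subseteq> U"
  shows "(\<Sum>x\<in>X. (g (ray n d x k) - g x)\<^sup>2) \<le> (real k)\<^sup>2 * energy U n g"
proof -
  have fin: "finite X" using finite_grid[OF assms(1,2)] assms(4) by (rule finite_subset[rotated])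
  have lat: "x \<in> scaled_lattice n" if "x \<in> X" for x using that assms(4) by (auto simp: grid_def)
  have "(\<Sum>x\<in>X. (g (ray n d x k) - g x)\<^sup>2) \<le>
      (\<Sum>x\<in>X. k * (\<Sum>j<k. (g (ray n d x (Suc j)) - g (ray n d x j))\<^sup>2))"
    by (intro sum_mono ray_diff_le)
  also have "\<dots> = k * (\<Sum>j<k. \<Sum>x\<in>X. (g (ray n d x (Suc j)) - g (ray n d x j))\<^sup>2)"
    by (subst sum.swap) (simp add: sum_distrib_left)
  also have "\<dots> \<le> k * (\<Sum>j<k. energy U n g)"
    using ray_step[OF assms(2,3) lat _ seg]
    by (intro mult_left_mono sum_mono sum_edges_le_energy assms fin) (auto simp: inj_on_def ray_def)
  finally show ?thesis by (simp add: power2_eq_square)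
qed

text \<open>The displacement is travelled along an L-shaped path, horizontally to the corner
  \<open>x + of_real (Re v)\<close> and then vertically. In lattice units the squared lengths of the
  legs add up to \<open>(real n * cmod v)\<^sup>2\<close>.\<close>

lemma sum_shift_le:
  assumes "bounded U" "n > 0" "X \<subseteq> grid U n" "v \<in> scaled_lattice n"
    and seg: "\<And>x. x \<in> X \<Longrightarrow> closed_segment x (x + of_real (Re v)) \<subseteq> U"
      "\<And>x. x \<in> X \<Longrightarrow> closed_segment (x + of_real (Re v)) (x + v) \<subseteq> U"
  shows "(\<Sum>x\<in>X. (g (x + v) - g x)\<^sup>2) \<le> 2 * (real n * cmod v)\<^sup>2 * energy U n g"
proof -
  obtain a b where v: "v = lattice_point n (a, b)" using assms(4) by (auto simp: scaled_lattice_eq)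
  define d1 d2 where "d1 = complex_of_real (if a \<ge> 0 then 1 else -1)" and "d2 = complex_of_real (if b \<ge> 0 then 1 else -1) * \<i>"
  have d: "d1 \<in> axes" "d2 \<in> axes" by (auto simp: d1_def d2_def axes_def)
  have v1: "x + of_real (Re v) = ray n d1 x (nat \<bar>a\<bar>)" for x
    by (simp add: ray_def v lattice_point_def d1_def)
  have v2: "x + v = ray n d2 (x + of_real (Re v)) (nat \<bar>b\<bar>)" for x
    by (simp add: ray_def v lattice_point_def d2_def complex_eq_iff)
  define Y where "Y = (\<lambda>x. x + of_real (Re v)) ` X"
  have Y: "Y \<subseteq> grid U n"
  proof
    fix y assume "y \<in> Y"
    then obtain x where x: "x \<in> X" "y = x + of_real (Re v)" by (auto simp: Y_def)
    then have "y \<in> U" using seg(1)[OF x(1)] by auto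
    moreover have "x \<in> scaled_lattice n" using x assms(3) by (auto simp: grid_def)
    ultimately show "y \<in> grid U n" using x(2) ray_in_lattice[OF d(1)] by (simp add: grid_def v1)
  qed
  have n: "real n * cmod v = sqrt ((of_int a)\<^sup>2 + (of_int b)\<^sup>2)"
  proof -
    have "cmod v = sqrt (((of_int a)\<^sup>2 + (of_int b)\<^sup>2) / (real n)\<^sup>2)"
      by (simp add: v lattice_point_def cmod_def power_divide add_divide_distrib)
    then show ?thesis using assms(2) by (simp add: real_sqrt_divide)
  qed
  have "(\<Sum>x\<in>X. (g (x + v) - g x)\<^sup>2) \<le>
    (\<Sum>x\<in>X. 2 * (g (x + v) - g (x + of_real (Re v)))\<^sup>2 + 2 * (g (x + of_real (Re v)) - g x)\<^sup>2)"
  proof (rule sum_mono)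
    fix x
    have "(s + t)\<^sup>2 \<le> 2 * s\<^sup>2 + 2 * t\<^sup>2" for s t :: real
      using zero_le_power2[of "s - t"] by (simp add: power2_sum power2_diff)
    from this[of "g (x + v) - g (x + of_real (Re v))" "g (x + of_real (Re v)) - g x"]
    show "(g (x + v) - g x)\<^sup>2 \<le> 2 * (g (x + v) - g (x + of_real (Re v)))\<^sup>2 + 2 * (g (x + of_real (Re v)) - g x)\<^sup>2"
      by simp
  qed
  also have "\<dots> = 2 * (\<Sum>x\<in>X. (g (x + v) - g (x + of_real (Re v)))\<^sup>2) + 2 * (\<Sum>x\<in>X. (g (x + of_real (Re v)) - g x)\<^sup>2)"
    by (simp add: sum.distrib sum_distrib_left)
  also have "(\<Sum>x\<in>X. (g (x + of_real (Re v)) - g x)\<^sup>2) \<le> (real (nat \<bar>a\<bar>))\<^sup>2 * energy U n g"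
    using seg(1) unfolding v1 by (intro sum_ray_diff_le assms d) auto
  also have "(\<Sum>x\<in>X. (g (x + v) - g (x + of_real (Re v)))\<^sup>2) = (\<Sum>y\<in>Y. (g (ray n d2 y (nat \<bar>b\<bar>)) - g y)\<^sup>2)"
    unfolding Y_def by (subst sum.reindex) (auto simp: inj_on_def v2[symmetric])
  also have "\<dots> \<le> (real (nat \<bar>b\<bar>))\<^sup>2 * energy U n g"
    using seg(2) v2 by (intro sum_ray_diff_le assms d Y) (auto simp: Y_def)
  finally show ?thesis unfolding n by (simp add: algebra_simps)
qed

text \<open>If the rays are disjoint, summing over all their vertices costs no more than a factor
  \<open>m\<^sup>2\<close>: this is what lets a one-dimensional set \<open>Q\<close> have positive capacity.\<close>

lemma sum_disjoint_rays_le: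
  assumes "bounded U" "n > 0" "d \<in> axes" "Q \<subseteq> grid U n"
    and seg: "\<And>x. x \<in> Q \<Longrightarrow> closed_segment x (ray n d x m) \<subseteq> U"
    and inj: "inj_on (\<lambda>(x, k). ray n d x k) (Q \<times> {..<m})"
  shows "(\<Sum>x\<in>Q. \<Sum>k<m. (g (ray n d x k) - g x)\<^sup>2) \<le> (real m)\<^sup>2 * energy U n g"
proof -
  have fin: "finite Q" using finite_grid[OF assms(1,2)] assms(4) by (rule finite_subset[rotated])
  have lat: "x \<in> scaled_lattice n" if "x \<in> Q" for x using that assms(4) by (auto simp: grid_def)
  let ?e = "\<lambda>x j. (g (ray n d x (Suc j)) - g (ray n d x j))\<^sup>2"
  have "(\<Sum>x\<in>Q. \<Sum>k<m. (g (ray n d x k) - g x)\<^sup>2) \<le> (\<Sum>x\<in>Q. \<Sum>k<m. m * (\<Sum>j<m. ?e x j))"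
  proof (intro sum_mono)
    fix x k assume "k \<in> {..<m}"
    \<comment> \<open>The bound is made independent of \<open>k\<close>, so that summing over
      \<open>k\<close> only contributes a second factor \<open>m\<close>; the double sum that
      remains runs over distinct tails.\<close>
    then have "k * (\<Sum>j<k. ?e x j) \<le> m * (\<Sum>j<m. ?e x j)"
      by (intro mult_mono sum_mono2) (auto intro!: sum_nonneg)
    then show "(g (ray n d x k) - g x)\<^sup>2 \<le> m * (\<Sum>j<m. ?e x j)"
      using ray_diff_le[of g n d x k] by linarith
  qed
  also have "\<dots> = (real m)\<^sup>2 * (\<Sum>x\<in>Q. \<Sum>j<m. ?e x j)"
    by (simp add: sum_distrib_left power2_eq_square mult.assoc)
  also have "(\<Sum>x\<in>Q. \<Sum>j<m. ?e x j) = (\<Sum>i\<in>Q \<times> {..<m}. (g (ray n d (fst i) (Suc (snd i))) - g (ray n d (fst i) (snd i)))\<^sup>2)"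
    by (subst sum.cartesian_product) (simp add: case_prod_unfold)
  also have "\<dots> \<le> energy U n g"
    using ray_step[OF assms(2,3) lat _ seg] fin inj
    by (intro sum_edges_le_energy assms) (auto simp: case_prod_unfold)
  finally show ?thesis by (simp add: mult_left_mono)
qed

section \<open>The discrete Poincare inequality\<close>

abbreviation grid_on :: "complex set \<Rightarrow> complex set \<Rightarrow> nat \<Rightarrow> complex set" where
  "grid_on U X n \<equiv> grid U n \<inter> X"

text \<open>A Poincare inequality for pairs of points: n^4 is the order of the number of pairs, so
  the mean squared difference between \<open>X\<close> and \<open>Y\<close> is bounded by the
  energy, uniformly in \<open>g\<close> and in large \<open>n\<close>. Having two sets instead of
  one lets the inequality be chained through overlapping balls.\<close>

definition linked :: "complex set \<Rightarrow> complex set \<Rightarrow> complex set \<Rightarrow> bool" where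
  "linked U X Y \<longleftrightarrow> (\<exists>C\<ge>0. \<exists>N>0. \<forall>n\<ge>N. \<forall>g::complex \<Rightarrow> real.
     (\<Sum>x\<in>grid_on U X n. \<Sum>y\<in>grid_on U Y n. (g x - g y)\<^sup>2) \<le> C * real n ^ 4 * energy U n g)"

lemma linkedI:
  assumes "C \<ge> 0" "N > 0"
    "\<And>n (g::complex \<Rightarrow> real). n \<ge> N \<Longrightarrow> n > 0 \<Longrightarrow>
       (\<Sum>x\<in>grid_on U X n. \<Sum>y\<in>grid_on U Y n. (g x - g y)\<^sup>2) \<le> C * real n ^ 4 * energy U n g"
  shows "linked U X Y"
  unfolding linked_def using assms(1,2)
  by (intro exI[of _ C] exI[of _ N] conjI allI impI assms(3)) auto

lemma linkedE:
  assumes "linked U X Y"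
  obtains C N where "C \<ge> 0" "N > 0"
    "\<And>n (g::complex \<Rightarrow> real). n \<ge> N \<Longrightarrow>
       (\<Sum>x\<in>grid_on U X n. \<Sum>y\<in>grid_on U Y n. (g x - g y)\<^sup>2) \<le> C * real n ^ 4 * energy U n g"
  using assms unfolding linked_def by blast

lemma linked_sym:
  assumes "linked U X Y"
  shows "linked U Y X"
proof -
  obtain C N where *: "C \<ge> 0" "N > 0"
    "\<And>n (g::complex \<Rightarrow> real). n \<ge> N \<Longrightarrow>
       (\<Sum>x\<in>grid_on U X n. \<Sum>y\<in>grid_on U Y n. (g x - g y)\<^sup>2) \<le> C * real n ^ 4 * energy U n g"
    using assms by (rule linkedE) blast
  show ?thesis
    by (rule linkedI[OF *(1,2)], subst sum.swap, subst power2_commute) (rule *(3))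
qed

lemma linked_mono:
  assumes "bounded U" "linked U X Y" "U \<inter> X' \<subseteq> X" "U \<inter> Y' \<subseteq> Y"
  shows "linked U X' Y'"
proof -
  obtain C N where *: "C \<ge> 0" "N > 0"
    "\<And>n (g::complex \<Rightarrow> real). n \<ge> N \<Longrightarrow>
       (\<Sum>x\<in>grid_on U X n. \<Sum>y\<in>grid_on U Y n. (g x - g y)\<^sup>2) \<le> C * real n ^ 4 * energy U n g"
    using assms(2) by (rule linkedE) blast
  show ?thesis
  proof (rule linkedI[OF *(1,2)])
    fix n and g :: "complex \<Rightarrow> real" assume n: "n \<ge> N" "n > 0"
    have sub: "grid_on U X' n \<subseteq> grid_on U X n" "grid_on U Y' n \<subseteq> grid_on U Y n"
      using assms(3,4) by (auto simp: grid_def)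
    have "(\<Sum>x\<in>grid_on U X' n. \<Sum>y\<in>grid_on U Y' n. (g x - g y)\<^sup>2) \<le>
        (\<Sum>x\<in>grid_on U X' n. \<Sum>y\<in>grid_on U Y n. (g x - g y)\<^sup>2)"
      using finite_grid[OF assms(1) n(2)] sub by (intro sum_mono sum_mono2) auto
    also have "\<dots> \<le> (\<Sum>x\<in>grid_on U X n. \<Sum>y\<in>grid_on U Y n. (g x - g y)\<^sup>2)"
      using finite_grid[OF assms(1) n(2)] sub by (intro sum_mono2) (auto intro!: sum_nonneg)
    also have "\<dots> \<le> C * real n ^ 4 * energy U n g" by (rule *(3)[OF n(1)])
    finally show "(\<Sum>x\<in>grid_on U X' n. \<Sum>y\<in>grid_on U Y' n. (g x - g y)\<^sup>2) \<le> C * real n ^ 4 * energy U n g" .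
  qed
qed

lemma linked_Un:
  assumes "bounded U" "linked U X Y" "linked U X' Y"
  shows "linked U (X \<union> X') Y"
proof -
  obtain C N where *: "C \<ge> 0" "N > 0"
    "\<And>n (g::complex \<Rightarrow> real). n \<ge> N \<Longrightarrow>
       (\<Sum>x\<in>grid_on U X n. \<Sum>y\<in>grid_on U Y n. (g x - g y)\<^sup>2) \<le> C * real n ^ 4 * energy U n g"
    using assms(2) by (rule linkedE) blast
  obtain C' N' where **: "C' \<ge> 0" "N' > 0"
    "\<And>n (g::complex \<Rightarrow> real). n \<ge> N' \<Longrightarrow>
       (\<Sum>x\<in>grid_on U X' n. \<Sum>y\<in>grid_on U Y n. (g x - g y)\<^sup>2) \<le> C' * real n ^ 4 * energy U n g"
    using assms(3) by (rule linkedE) blast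
  show ?thesis
  proof (rule linkedI[of "C + C'" "max N N'"])
    fix n and g :: "complex \<Rightarrow> real" assume n: "n \<ge> max N N'" "n > 0"
    let ?F = "\<lambda>x. \<Sum>y\<in>grid_on U Y n. (g x - g y)\<^sup>2"
    have fin: "finite (grid_on U Z n)" for Z using finite_grid[OF assms(1) n(2)] by simp
    have "grid_on U (X \<union> X') n = grid_on U X n \<union> grid_on U X' n" by blast
    moreover have "0 \<le> sum ?F (grid_on U X n \<inter> grid_on U X' n)" by (intro sum_nonneg) auto
    ultimately have "sum ?F (grid_on U (X \<union> X') n) \<le> sum ?F (grid_on U X n) + sum ?F (grid_on U X' n)"
      using sum.union_inter[OF fin[of X] fin[of X'], of ?F] by simp
    also have "\<dots> \<le> C * real n ^ 4 * energy U n g + C' * real n ^ 4 * energy U n g"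
      using n by (intro add_mono *(3) **(3)) auto
    finally show "sum ?F (grid_on U (X \<union> X') n) \<le> (C + C') * real n ^ 4 * energy U n g"
      by (simp add: algebra_simps)
  qed (use * ** in auto)
qed

lemma linked_empty: "linked U {} Y"
  by (rule linkedI[of 0 1]) auto

lemma linked_UN:
  assumes "bounded U" "finite I" "\<And>i. i \<in> I \<Longrightarrow> linked U (X i) Y"
  shows "linked U (\<Union>i\<in>I. X i) Y"
  using assms(2,3) by (induction I rule: finite_induct) (auto intro: linked_empty linked_Un[OF assms(1)])

lemma square_diff_le: "(a - c)\<^sup>2 \<le> 2 * (a - b)\<^sup>2 + 2 * (b - c)\<^sup>2" for a b c :: real
  using zero_le_power2[of "(a - b) - (b - c)"] by (simp add: power2_eq_square algebra_simps)

text \<open>Every point of \<open>Y\<close> serves as an intermediate point between \<open>x\<close>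
  and \<open>z\<close>; the factor on the left counts these choices.\<close>

lemma sum_square_diff_trans:
  fixes g :: "'a \<Rightarrow> real"
  shows "card Y * (\<Sum>x\<in>X. \<Sum>z\<in>Z. (g x - g z)\<^sup>2) \<le>
    2 * card Z * (\<Sum>x\<in>X. \<Sum>y\<in>Y. (g x - g y)\<^sup>2) + 2 * card X * (\<Sum>y\<in>Y. \<Sum>z\<in>Z. (g y - g z)\<^sup>2)"
proof -
  have "card Y * (\<Sum>x\<in>X. \<Sum>z\<in>Z. (g x - g z)\<^sup>2) = (\<Sum>x\<in>X. \<Sum>z\<in>Z. \<Sum>y\<in>Y. (g x - g z)\<^sup>2)"
    by (simp add: sum_distrib_left)
  also have "\<dots> \<le> (\<Sum>x\<in>X. \<Sum>z\<in>Z. \<Sum>y\<in>Y. 2 * (g x - g y)\<^sup>2 + 2 * (g y - g z)\<^sup>2)"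
    by (intro sum_mono square_diff_le)
  also have "\<dots> = (\<Sum>x\<in>X. \<Sum>z\<in>Z. \<Sum>y\<in>Y. 2 * (g x - g y)\<^sup>2) + (\<Sum>x\<in>X. \<Sum>z\<in>Z. \<Sum>y\<in>Y. 2 * (g y - g z)\<^sup>2)"
    by (simp add: sum.distrib)
  also have "(\<Sum>x\<in>X. \<Sum>z\<in>Z. \<Sum>y\<in>Y. 2 * (g x - g y)\<^sup>2) = 2 * card Z * (\<Sum>x\<in>X. \<Sum>y\<in>Y. (g x - g y)\<^sup>2)"
    by (simp add: sum_distrib_left mult_ac)
  also have "(\<Sum>x\<in>X. \<Sum>z\<in>Z. \<Sum>y\<in>Y. 2 * (g y - g z)\<^sup>2) = 2 * card X * (\<Sum>y\<in>Y. \<Sum>z\<in>Z. (g y - g z)\<^sup>2)"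
    by (subst sum.swap[of _ Y Z]) (simp add: sum_distrib_left mult_ac)
  finally show ?thesis .
qed

text \<open>The intermediate point is averaged over the lattice points of a ball in the overlap.
  There are at least of order n^2 of them, which pays for the cardinalities of \<open>X\<close> and
  \<open>Z\<close>; a smaller overlap would lose a power of \<open>n\<close>.\<close>

lemma linked_trans:
  assumes "bounded U" "linked U X Y" "linked U Y' Z" "r > 0"
    and ball: "ball p r \<subseteq> U" "ball p r \<subseteq> Y" "ball p r \<subseteq> Y'"
  shows "linked U X Z"
proof -
  have "linked U X (ball p r)" "linked U (ball p r) Z"
    using linked_mono[OF assms(1,2), of X "ball p r"] linked_mono[OF assms(1,3), of "ball p r" Z] ball by auto
  then obtain C N C' N' where
    *: "C \<ge> 0" "N > 0" "\<And>n (g::complex \<Rightarrow> real). n \<ge> N \<Longrightarrow>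
       (\<Sum>x\<in>grid_on U X n. \<Sum>y\<in>grid_on U (ball p r) n. (g x - g y)\<^sup>2) \<le> C * real n ^ 4 * energy U n g" and
    **: "C' \<ge> 0" "N' > 0" "\<And>n (g::complex \<Rightarrow> real). n \<ge> N' \<Longrightarrow>
       (\<Sum>x\<in>grid_on U (ball p r) n. \<Sum>y\<in>grid_on U Z n. (g x - g y)\<^sup>2) \<le> C' * real n ^ 4 * energy U n g"
    by (metis linkedE)
  obtain K where K: "K > 0" "\<And>n. n > 0 \<Longrightarrow> real (card (grid U n)) \<le> K * (real n)\<^sup>2"
    using card_grid_le[OF assms(1)] by blast
  define c where "c = r\<^sup>2 / 4"
  have c: "c > 0" using assms(4) by (simp add: c_def)
  obtain M :: nat where M: "M \<ge> 2 / r" using real_arch_simple by blast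
  show ?thesis
  proof (rule linkedI[of "2 * K * (C + C') / c" "max M (max N N')"])
    fix n and g :: "complex \<Rightarrow> real" assume n: "n \<ge> max M (max N N')" "n > 0"
    have fin: "finite (grid U n)" using finite_grid[OF assms(1) n(2)] .
    have E: "energy U n g \<ge> 0" by (rule energy_nonneg)
    let ?Y = "grid_on U (ball p r) n" and ?X = "grid_on U X n" and ?Z = "grid_on U Z n"
    let ?S = "\<Sum>x\<in>?X. \<Sum>z\<in>?Z. (g x - g z)\<^sup>2"
    have card_le: "real (card (grid_on U W n)) \<le> K * (real n)\<^sup>2" for W
      using card_mono[OF fin, of "grid_on U W n"] K(2)[OF n(2)] by simp
    have "2 / r \<le> real n" using M n by (meson max.boundedE of_nat_mono order_trans)
    then have "2 \<le> r * n" using assms(4) by (simp add: field_simps)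
    moreover have "?Y = scaled_lattice n \<inter> ball p r" using ball by (auto simp: grid_def)
    ultimately have "c * (real n)\<^sup>2 \<le> card ?Y"
      using card_lattice_ball_ge[OF n(2) assms(4), of p] by (simp add: c_def)
    then have "c * (real n)\<^sup>2 * ?S \<le> card ?Y * ?S"
      by (intro mult_right_mono sum_nonneg) auto
    also have "\<dots> \<le> 2 * card ?Z * (\<Sum>x\<in>?X. \<Sum>y\<in>?Y. (g x - g y)\<^sup>2) + 2 * card ?X * (\<Sum>y\<in>?Y. \<Sum>z\<in>?Z. (g y - g z)\<^sup>2)"
      by (rule sum_square_diff_trans)
    also have "\<dots> \<le> 2 * (K * (real n)\<^sup>2) * (C * real n ^ 4 * energy U n g) + 2 * (K * (real n)\<^sup>2) * (C' * real n ^ 4 * energy U n g)"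
      using n K(1) by (intro add_mono mult_mono *(3) **(3)) (auto intro!: sum_nonneg simp: card_le)
    also have "\<dots> = (real n)\<^sup>2 * (2 * K * (C + C') * real n ^ 4 * energy U n g)"
      by (simp add: algebra_simps)
    finally have "(real n)\<^sup>2 * (c * ?S) \<le> (real n)\<^sup>2 * (2 * K * (C + C') * real n ^ 4 * energy U n g)"
      by (simp add: mult_ac)
    then have "c * ?S \<le> 2 * K * (C + C') * real n ^ 4 * energy U n g"
      using n(2) by (subst (asm) mult_le_cancel_left_pos) auto
    then show "?S \<le> 2 * K * (C + C') / c * real n ^ 4 * energy U n g"
      using c by (simp add: field_simps)
  qed (use * ** K c in auto)
qed

section \<open>Proof of the inequality: balls, compact subsets, patches at the boundary\<close>

lemma lattice_diff: "z \<in> scaled_lattice n \<Longrightarrow> w \<in> scaled_lattice n \<Longrightarrow> z - w \<in> scaled_lattice n"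
proof -
  assume "z \<in> scaled_lattice n" "w \<in> scaled_lattice n"
  then obtain a b c d where "z = lattice_point n (a, b)" "w = lattice_point n (c, d)"
    by (auto simp: scaled_lattice_eq)
  then have "z - w = lattice_point n (a - c, b - d)"
    by (simp add: lattice_point_def diff_divide_distrib complex_eq_iff)
  then show "z - w \<in> scaled_lattice n" by (simp add: scaled_lattice_eq)
qed

text \<open>Pairs are grouped by their displacement \<open>v\<close>, and for each \<open>v\<close>
  all points are moved at once. The factor 3 keeps the corners of the L-shaped paths in
  \<open>U\<close>: they are within r + 2 r of \<open>p\<close>.\<close>

lemma linked_ball:
  assumes "bounded U" "r > 0" "ball p (3 * r) \<subseteq> U"
  shows "linked U (ball p r) (ball p r)"
proof -
  obtain M :: nat where M: "M \<ge> 1 / (2 * r)" using real_arch_simple by blast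
  show ?thesis
  \<comment> \<open>At most 36 r^2 n^2 lattice displacements are shorter than 2 r, and each costs at
    most 2 (2 r n)^2 = 8 r^2 n^2 energies.\<close>
  proof (rule linkedI[of "36 * r\<^sup>2 * (8 * r\<^sup>2)" "Suc M"])
    fix n and g :: "complex \<Rightarrow> real" assume n: "n \<ge> Suc M" "n > 0"
    let ?X = "grid_on U (ball p r) n"
    define V where "V = scaled_lattice n \<inter> ball 0 (2 * r)"
    have finV: "finite V" unfolding V_def by (rule finite_lattice_ball[OF n(2)])
    have finX: "finite ?X" using finite_grid[OF assms(1) n(2)] by simp
    have "1 / (2 * r) \<le> real n" using M n(1) by linarith
    then have cV: "card V \<le> 36 * r\<^sup>2 * (real n)\<^sup>2"
      using card_lattice_ball_le[OF n(2), of "2 * r" 0] assms(2) by (simp add: V_def field_simps)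
    have "(\<Sum>y\<in>?X. (g x - g y)\<^sup>2) \<le> (\<Sum>v\<in>V. if x + v \<in> ?X then (g (x + v) - g x)\<^sup>2 else 0)" if x: "x \<in> ?X" for x
    proof -
      have "(\<Sum>y\<in>?X. (g x - g y)\<^sup>2) = (\<Sum>v\<in>(\<lambda>y. y - x) ` ?X. (g (x + v) - g x)\<^sup>2)"
        by (subst sum.reindex) (auto simp: inj_on_def power2_commute)
      also have "\<dots> = (\<Sum>v\<in>(\<lambda>y. y - x) ` ?X. if x + v \<in> ?X then (g (x + v) - g x)\<^sup>2 else 0)"
        by (rule sum.cong) auto
      also have "\<dots> \<le> (\<Sum>v\<in>V. if x + v \<in> ?X then (g (x + v) - g x)\<^sup>2 else 0)"
      proof (rule sum_mono2[OF finV])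
        show "(\<lambda>y. y - x) ` ?X \<subseteq> V"
        proof
          fix v assume "v \<in> (\<lambda>y. y - x) ` ?X"
          then obtain y where y: "y \<in> ?X" "v = y - x" by blast
          have "dist x y < 2 * r"
            using x y dist_triangle2[of x y p] by (simp add: dist_commute)
          then show "v \<in> V"
            using x y lattice_diff[of y n x] by (simp add: V_def grid_def dist_norm norm_minus_commute)
        qed
      qed auto
      finally show ?thesis .
    qed
    then have "(\<Sum>x\<in>?X. \<Sum>y\<in>?X. (g x - g y)\<^sup>2) \<le> (\<Sum>x\<in>?X. \<Sum>v\<in>V. if x + v \<in> ?X then (g (x + v) - g x)\<^sup>2 else 0)"
      by (rule sum_mono)
    also have "\<dots> = (\<Sum>v\<in>V. \<Sum>x\<in>?X. if x + v \<in> ?X then (g (x + v) - g x)\<^sup>2 else 0)"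
      by (rule sum.swap)
    also have "\<dots> \<le> (\<Sum>v\<in>V. 8 * r\<^sup>2 * (real n)\<^sup>2 * energy U n g)"
    proof (rule sum_mono)
      fix v assume v: "v \<in> V"
      let ?X' = "{x \<in> ?X. x + v \<in> ?X}"
      have in3: "ball p r \<subseteq> U" using subset_ball[of r "3 * r" p] assms by auto
      have corner: "x + of_real (Re v) \<in> ball p (3 * r)" if "x \<in> ?X'" for x
      proof -
        have "cmod (of_real (Re v)) < 2 * r"
          using v abs_Re_le_cmod[of v] by (simp add: V_def)
        then show ?thesis
          using that norm_triangle_ineq[of "x - p" "of_real (Re v)"]
          by (simp add: dist_norm norm_minus_commute[of p] add_diff_eq diff_add_eq)
      qed
      have seg: "closed_segment a b \<subseteq> U" if "a \<in> ball p (3 * r)" "b \<in> ball p (3 * r)" for a b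
        using closed_segment_subset[OF that convex_ball] assms(3) by blast
      have "(\<Sum>x\<in>?X. if x + v \<in> ?X then (g (x + v) - g x)\<^sup>2 else 0) = (\<Sum>x\<in>?X'. (g (x + v) - g x)\<^sup>2)"
        by (rule sum.inter_filter[OF finX, symmetric])
      also have "\<dots> \<le> 2 * (real n * cmod v)\<^sup>2 * energy U n g"
        using v corner assms(2)
        by (intro sum_shift_le assms n seg) (auto simp: V_def)
      also have "\<dots> \<le> 2 * (real n * (2 * r))\<^sup>2 * energy U n g"
        using v by (intro mult_right_mono mult_left_mono power_mono energy_nonneg) (auto simp: V_def)
      finally show "(\<Sum>x\<in>?X. if x + v \<in> ?X then (g (x + v) - g x)\<^sup>2 else 0) \<le> 8 * r\<^sup>2 * (real n)\<^sup>2 * energy U n g"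
        by (simp add: power_mult_distrib mult_ac)
    qed
    also have "\<dots> = card V * (8 * r\<^sup>2 * (real n)\<^sup>2 * energy U n g)" by simp
    also have "\<dots> \<le> 36 * r\<^sup>2 * (real n)\<^sup>2 * (8 * r\<^sup>2 * (real n)\<^sup>2 * energy U n g)"
      using cV energy_nonneg[of U n g] by (intro mult_right_mono) auto
    finally show "(\<Sum>x\<in>?X. \<Sum>y\<in>?X. (g x - g y)\<^sup>2) \<le> 36 * r\<^sup>2 * (8 * r\<^sup>2) * real n ^ 4 * energy U n g"
      by (simp add: power2_eq_square power4_eq_xxxx mult_ac)
  qed (use assms in auto)
qed

text \<open>The relation is symmetric, transitive and holds between nearby points, so it holds
  throughout a connected set. The radius depends on the pair; a finite subcover removes this
  dependence afterwards.\<close>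

lemma linked_points:
  assumes "bounded U" "open U" "connected U" "p \<in> U" "q \<in> U"
  shows "\<exists>r>0. ball p r \<subseteq> U \<and> ball q r \<subseteq> U \<and> linked U (ball p r) (ball q r)"
  (is "?R p q")
proof (rule connected_equivalence_relation[OF assms(3-5), of ?R])
  fix x y assume "?R x y" then show "?R y x" using linked_sym by blast
next
  fix x y z assume "?R x y" "?R y z"
  then obtain r s where r: "r > 0" "ball x r \<subseteq> U" "ball y r \<subseteq> U" "linked U (ball x r) (ball y r)"
    and s: "s > 0" "ball y s \<subseteq> U" "ball z s \<subseteq> U" "linked U (ball y s) (ball z s)" by blast
  have b: "ball w (min r s) \<subseteq> ball w r" "ball w (min r s) \<subseteq> ball w s" for w :: complex
    by (simp_all add: subset_ball)
  have "linked U (ball x r) (ball z s)"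
    using r s b by (intro linked_trans[OF assms(1) r(4) s(4), of "min r s" y]) auto
  then have "linked U (ball x (min r s)) (ball z (min r s))"
    by (rule linked_mono[OF assms(1)]) (use b in blast)+
  moreover have "ball x (min r s) \<subseteq> U" "ball z (min r s) \<subseteq> U" using r(2) s(3) b by blast+
  ultimately show "?R x z" using r(1) s(1) by (intro exI[of _ "min r s"]) auto
next
  fix a assume "a \<in> U"
  then obtain e where e: "e > 0" "ball a e \<subseteq> U" using assms(2) open_contains_ball by blast
  define r where "r = e / 3"
  have r: "r > 0" "ball a (3 * r) \<subseteq> U" using e by (auto simp: r_def)
  have "?R a x" if "x \<in> ball a (r / 2)" for x
  proof -
    have sub: "ball x (r / 2) \<subseteq> ball a r" "ball a (r / 2) \<subseteq> ball a r" "ball a r \<subseteq> ball a (3 * r)"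
    proof -
      show "ball x (r / 2) \<subseteq> ball a r"
      proof
        fix y assume "y \<in> ball x (r / 2)"
        then show "y \<in> ball a r" using that dist_triangle[of a y x] by simp
      qed
    qed (use r(1) in \<open>simp_all add: subset_ball\<close>)
    have "linked U (ball a (r / 2)) (ball x (r / 2))"
      by (rule linked_mono[OF assms(1) linked_ball[OF assms(1) r]]) (use sub in blast)+
    moreover have "ball a (r / 2) \<subseteq> U" "ball x (r / 2) \<subseteq> U" using sub r(2) by blast+
    ultimately show ?thesis using r(1) by (intro exI[of _ "r / 2"]) simp
  qed
  moreover have "ball a (r / 2) \<subseteq> U" using r subset_ball[of "r / 2" "3 * r" a] by auto
  ultimately show "\<exists>T. openin (top_of_set U) T \<and> a \<in> T \<and> (\<forall>x\<in>T. ?R a x)"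
    using r(1) by (intro exI[of _ "ball a (r / 2)"]) (auto intro: open_subset)
qed

lemma linked_compact:
  assumes "bounded U" "open U" "connected U" "p \<in> U" "s > 0" "ball p (3 * s) \<subseteq> U"
    and "compact K" "K \<subseteq> U"
  shows "linked U K (ball p s)"
proof -
  have "\<forall>q\<in>K. \<exists>r>0. linked U (ball q r) (ball p s)"
  proof
    fix q assume "q \<in> K"
    then obtain r where r: "r > 0" "ball p r \<subseteq> U" "linked U (ball q r) (ball p r)"
      using linked_points[OF assms(1-3), of q p] assms(4,8) by auto
    have "linked U (ball q r) (ball p s)"
      using r assms(5)
      by (intro linked_trans[OF assms(1) r(3) linked_ball[OF assms(1,5,6)], of "min r s" p])
        (auto intro: subset_ball)
    then show "\<exists>r>0. linked U (ball q r) (ball p s)" using r by blast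
  qed
  then obtain r where r: "\<And>q. q \<in> K \<Longrightarrow> r q > 0 \<and> linked U (ball q (r q)) (ball p s)" by metis
  have "K \<subseteq> (\<Union>q\<in>K. ball q (r q))" using r by force
  then obtain I where I: "I \<subseteq> K" "finite I" "K \<subseteq> (\<Union>q\<in>I. ball q (r q))"
    using compactE_image[OF assms(7), of K "\<lambda>q. ball q (r q)"] by auto
  have "linked U (\<Union>q\<in>I. ball q (r q)) (ball p s)"
    using I r by (intro linked_UN assms) auto
  then show ?thesis by (rule linked_mono[OF assms(1)]) (use I in blast)+
qed

text \<open>\<open>d * Complex s u\<close> is the vector with component \<open>s\<close> along the
  axis \<open>d\<close> and \<open>u\<close> across it, so the points form a truncated cone with
  apex \<open>q\<close> and slope 1/8. One direction serves all points of \<open>U\<close> near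
  \<open>p\<close>: a whole patch, or a piece of a path, can be moved along parallel lattice rays
  inside \<open>U\<close>.\<close>

definition cone_at :: "complex set \<Rightarrow> complex \<Rightarrow> real \<Rightarrow> bool" where
  "cone_at U p r \<longleftrightarrow> (\<exists>d\<in>axes. \<forall>q\<in>U \<inter> ball p r. \<forall>s u.
     0 \<le> s \<longrightarrow> s \<le> r \<longrightarrow> \<bar>u\<bar> \<le> s / 8 \<longrightarrow> q + d * Complex s u \<in> U)"

definition axis_cone :: "complex set \<Rightarrow> real \<Rightarrow> bool" where
  "axis_cone U r \<longleftrightarrow> 0 < r \<and> (\<forall>p\<in>U. cone_at U p r)"

lemma compact_ball_inside:
  fixes U :: "complex set"
  assumes "bounded U" "\<delta> > 0"
  shows "compact {x. ball x \<delta> \<subseteq> U}"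
proof -
  have "{x. ball x \<delta> \<subseteq> U} = - (\<Union>w\<in>-U. ball w \<delta>)" by (auto simp: dist_commute)
  then have "closed {x. ball x \<delta> \<subseteq> U}" by (auto simp: closed_def)
  moreover have "{x. ball x \<delta> \<subseteq> U} \<subseteq> U" using assms(2) by auto
  ultimately show ?thesis using assms(1) bounded_subset by (auto simp: compact_eq_bounded_closed)
qed

text \<open>Translation by about r/2 in the common cone direction carries the patch injectively to
  points of depth r/64, where the inequality is already available.\<close>

lemma linked_boundary_patch:
  assumes "bounded U" "axis_cone U r" "q \<in> U"
    and K: "linked U {x. ball x (r / 64) \<subseteq> U} Y"
  shows "linked U (ball q r) Y"
proof -
  have r: "r > 0" using assms(2) by (simp add: axis_cone_def)
  obtain d where d: "d \<in> axes" and cone: "\<And>x s u. x \<in> U \<Longrightarrow> x \<in> ball q r \<Longrightarrow> 0 \<le> s \<Longrightarrow> s \<le> r \<Longrightarrow>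
      \<bar>u\<bar> \<le> s / 8 \<Longrightarrow> x + d * Complex s u \<in> U"
    using assms(2,3) unfolding axis_cone_def cone_at_def by (metis IntI)
  obtain C N where *: "C \<ge> 0" "N > 0"
    "\<And>n (g::complex \<Rightarrow> real). n \<ge> N \<Longrightarrow>
       (\<Sum>x\<in>grid_on U {x. ball x (r / 64) \<subseteq> U} n. \<Sum>y\<in>grid_on U Y n. (g x - g y)\<^sup>2) \<le> C * real n ^ 4 * energy U n g"
    using K by (rule linkedE) blast
  obtain D where D: "D > 0" "\<And>n. n > 0 \<Longrightarrow> real (card (grid U n)) \<le> D * (real n)\<^sup>2"
    using card_grid_le[OF assms(1)] by blast
  obtain M :: nat where M: "M \<ge> 4 / r" using real_arch_simple by blast
  show ?thesis
  proof (rule linkedI[of "2 * D * r\<^sup>2 + 2 * C" "max N M"])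
    fix n and g :: "complex \<Rightarrow> real" assume n: "n \<ge> max N M" "n > 0"
    let ?X = "grid_on U (ball q r) n" and ?Y = "grid_on U Y n" and ?K = "grid_on U {x. ball x (r / 64) \<subseteq> U} n"
    define k where "k = nat \<lfloor>real n * r / 2\<rfloor>"
    define s where "s = real k / real n"
    have E: "energy U n g \<ge> 0" by (rule energy_nonneg)
    have fin: "finite (grid U n)" using finite_grid[OF assms(1) n(2)] .
    have "4 / r \<le> real n" using M n by linarith
    then have nr: "4 \<le> real n * r" using r by (simp add: field_simps)
    have k: "real k \<le> real n * r / 2" "real n * r / 4 \<le> real k"
      using nr unfolding k_def by linarith+
    have s: "r / 4 \<le> s" "s \<le> r / 2" using k n(2) by (auto simp: s_def field_simps)
    have ray: "ray n d x k = x + d * Complex s 0" for x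
      by (simp add: ray_def s_def mult.commute complex_of_real_def)
    have seg: "closed_segment x (ray n d x k) \<subseteq> U" if x: "x \<in> ?X" for x
    proof
      fix y assume "y \<in> closed_segment x (ray n d x k)"
      then obtain t where t: "0 \<le> t" "t \<le> 1" "y = (1 - t) *\<^sub>R x + t *\<^sub>R ray n d x k"
        by (auto simp: closed_segment_def)
      then have "y = x + d * Complex (t * s) 0"
        by (simp add: ray scaleR_conv_of_real algebra_simps complex_of_real_def[symmetric] Complex_eq)
      moreover have "t * s \<le> 1 * r" using t s r by (intro mult_mono) auto
      ultimately show "y \<in> U" using cone[of x "t * s" 0] x t s r by (auto simp: grid_def)
    qed
    have inK: "ray n d x k \<in> ?K" if x: "x \<in> ?X" for x
    proof -
      \<comment> \<open>As \<open>s\<close> is at least r/4, the cone is wide enough there: its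
        half-width over the disc is at least (r/4 - r/64) / 8 = 15 r / 512, which exceeds
        r/64.\<close>
      have "ball (ray n d x k) (r / 64) \<subseteq> U"
      proof
        fix y assume y: "y \<in> ball (ray n d x k) (r / 64)"
        define w where "w = (y - ray n d x k) / d"
        have dn: "d \<noteq> 0" using norm_axis[OF d] by auto
        have "cmod w < r / 64" using y norm_axis[OF d] by (simp add: w_def norm_divide dist_norm norm_minus_commute)
        then have w: "\<bar>Re w\<bar> < r / 64" "\<bar>Im w\<bar> < r / 64"
          using abs_Re_le_cmod[of w] abs_Im_le_cmod[of w] by linarith+
        have "y = x + d * Complex (s + Re w) (Im w)"
        proof -
          have "Complex (s + Re w) (Im w) = Complex s 0 + w" by (simp add: complex_eq_iff)
          then show ?thesis using dn by (simp add: ray w_def distrib_left)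
        qed
        moreover have "x + d * Complex (s + Re w) (Im w) \<in> U"
          using w s r x by (intro cone) (auto simp: grid_def)
        ultimately show "y \<in> U" by simp
      qed
      moreover have "ray n d x k \<in> grid U n"
        using x seg[OF x] ray_in_lattice[OF d] by (auto simp: grid_def)
      ultimately show ?thesis by simp
    qed
    have cY: "card ?Y \<le> D * (real n)\<^sup>2"
      using card_mono[OF fin, of ?Y] D(2)[OF n(2)] by simp
    have "(\<Sum>x\<in>?X. (g (ray n d x k) - g x)\<^sup>2) \<le> (real k)\<^sup>2 * energy U n g"
      using seg by (intro sum_ray_diff_le assms n d) auto
    also have "\<dots> \<le> (real n * r)\<^sup>2 * energy U n g"
      using k r E by (intro mult_right_mono power_mono) auto
    finally have shift: "(\<Sum>x\<in>?X. (g (ray n d x k) - g x)\<^sup>2) \<le> (real n * r)\<^sup>2 * energy U n g" .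
    have "(\<Sum>x\<in>?X. \<Sum>y\<in>?Y. (g (ray n d x k) - g y)\<^sup>2) = (\<Sum>x\<in>(\<lambda>x. ray n d x k) ` ?X. \<Sum>y\<in>?Y. (g x - g y)\<^sup>2)"
      by (subst sum.reindex) (auto simp: inj_on_def ray_def)
    also have "\<dots> \<le> (\<Sum>x\<in>?K. \<Sum>y\<in>?Y. (g x - g y)\<^sup>2)"
      by (rule sum_mono2) (use fin inK in \<open>simp_all add: image_subset_iff sum_nonneg\<close>)
    also have "\<dots> \<le> C * real n ^ 4 * energy U n g" using n by (intro *(3)) auto
    finally have inner: "(\<Sum>x\<in>?X. \<Sum>y\<in>?Y. (g (ray n d x k) - g y)\<^sup>2) \<le> C * real n ^ 4 * energy U n g" .
    have "(\<Sum>x\<in>?X. \<Sum>y\<in>?Y. (g x - g y)\<^sup>2) \<le>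
        (\<Sum>x\<in>?X. \<Sum>y\<in>?Y. 2 * (g x - g (ray n d x k))\<^sup>2 + 2 * (g (ray n d x k) - g y)\<^sup>2)"
      by (intro sum_mono square_diff_le)
    also have "\<dots> = 2 * (real (card ?Y) * (\<Sum>x\<in>?X. (g (ray n d x k) - g x)\<^sup>2)) +
        2 * (\<Sum>x\<in>?X. \<Sum>y\<in>?Y. (g (ray n d x k) - g y)\<^sup>2)"
      by (simp add: sum.distrib sum_distrib_left mult_ac power2_commute[of "g (ray n d _ k)"])
    also have "\<dots> \<le> 2 * (D * (real n)\<^sup>2 * ((real n * r)\<^sup>2 * energy U n g)) + 2 * (C * real n ^ 4 * energy U n g)"
      using D(1) E by (intro add_mono mult_left_mono mult_mono cY shift inner) (auto intro!: sum_nonneg)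
    also have "\<dots> = (2 * D * r\<^sup>2 + 2 * C) * real n ^ 4 * energy U n g"
      by (simp add: power_mult_distrib power2_eq_square power4_eq_xxxx algebra_simps)
    finally show "(\<Sum>x\<in>?X. \<Sum>y\<in>?Y. (g x - g y)\<^sup>2) \<le> (2 * D * r\<^sup>2 + 2 * C) * real n ^ 4 * energy U n g" .
  qed (use * D r in auto)
qed

text \<open>Finitely many patches cover the closure, and each is linked to the same interior ball,
  which then mediates between \<open>U\<close> and itself.\<close>

lemma discrete_poincare:
  assumes "bounded U" "open U" "connected U" "axis_cone U r"
  shows "linked U U U"
proof (cases "U = {}")
  case True then show ?thesis using linked_empty by metis
next
  case False
  then obtain p where p: "p \<in> U" by blast
  have r: "r > 0" using assms(4) by (simp add: axis_cone_def)
  obtain e where e: "e > 0" "ball p e \<subseteq> U" using p assms(2) open_contains_ball by blast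
  define s where "s = e / 3"
  have s: "s > 0" "ball p (3 * s) \<subseteq> U" "ball p s \<subseteq> U"
    using e subset_ball[of s e p] by (auto simp: s_def)
  have "linked U {x. ball x (r / 64) \<subseteq> U} (ball p s)"
    using r by (intro linked_compact assms p s compact_ball_inside) auto
  then have patch: "linked U (ball q r) (ball p s)" if "q \<in> U" for q
    using that by (intro linked_boundary_patch assms)
  have "closure U \<subseteq> (\<Union>q\<in>U. ball q r)"
    using r by (auto simp: closure_approachable)
  then obtain I where I: "I \<subseteq> U" "finite I" "closure U \<subseteq> (\<Union>q\<in>I. ball q r)"
    using compactE_image[of "closure U" U "\<lambda>q. ball q r"] assms(1) by (auto simp: compact_closure)
  have "linked U (\<Union>q\<in>I. ball q r) (ball p s)"
    using I patch by (intro linked_UN assms) auto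
  then have L: "linked U U (ball p s)"
    by (rule linked_mono[OF assms(1)]) (use I closure_subset[of U] in blast)+
  show ?thesis
    using s by (intro linked_trans[OF assms(1) L linked_sym[OF L], of s p]) auto
qed

section \<open>Smooth domains satisfy a uniform cone condition\<close>

text \<open>By the Jordan curve theorem \<open>U\<close> is the inside of its frontier, since a
  connected set that meets \<open>U\<close> and avoids the frontier lies in \<open>U\<close>. The
  set \<open>V\<close> is the outside; having the same frontier, it rules out that \<open>U\<close>
  lies on both sides of its boundary curve.\<close>

lemma smooth_domain_complement:
  assumes "smooth_domain U"
  obtains V where "open V" "U \<inter> V = {}" "U \<union> V = - frontier U" "frontier V = frontier U"
proof -
  have U: "open U" "connected U" "U \<noteq> {}" "bounded U" "analytic_curve (frontier U)"
    using assms by (auto simp: smooth_domain_def)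
  obtain \<gamma> where \<gamma>: "\<gamma> analytic_on sphere 0 1" "inj_on \<gamma> (sphere 0 1)" "frontier U = \<gamma> ` sphere 0 1"
    using U(5) by (auto simp: analytic_curve_def)
  define c where "c = \<gamma> \<circ> circlepath 0 1"
  have img: "path_image c = frontier U"
    by (simp add: c_def path_image_compose \<gamma>(3))
  have "continuous_on (sphere 0 1) \<gamma>"
    using \<gamma>(1) by (intro holomorphic_on_imp_continuous_on analytic_imp_holomorphic)
  then have "simple_path c"
    unfolding c_def using \<gamma>(2) by (intro simple_path_continuous_image) (auto simp: simple_path_circlepath)
  moreover have "pathfinish c = pathstart c"
    by (simp add: c_def pathfinish_compose pathstart_compose)
  ultimately have J: "connected (inside (frontier U))" "connected (outside (frontier U))"
      "open (inside (frontier U))" "open (outside (frontier U))" "\<not> bounded (outside (frontier U))"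
      "inside (frontier U) \<inter> outside (frontier U) = {}"
      "inside (frontier U) \<union> outside (frontier U) = - frontier U"
      "frontier (outside (frontier U)) = frontier U"
    using Jordan_inside_outside[of c] unfolding img by auto
  have disj: "U \<inter> frontier U = {}"
    using U(1) frontier_disjoint_eq by blast
  have max: "W \<subseteq> U" if "connected W" "W \<inter> U \<noteq> {}" "W \<inter> frontier U = {}" for W
    using connected_Int_frontier[OF that(1,2)] that(3) by blast
  have out: "outside (frontier U) \<inter> frontier U = {}" "inside (frontier U) \<inter> frontier U = {}"
    using J(7) by auto
  have "outside (frontier U) \<inter> U = {}"
    using max[OF J(2) _ out(1)] U(4) J(5) bounded_subset by blast
  then have "U \<subseteq> inside (frontier U)" using disj J(7) by blast
  moreover have "inside (frontier U) \<subseteq> U"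
    using max[OF J(1) _ out(2)] calculation U(3) by blast
  ultimately have "U = inside (frontier U)" by blast
  then show ?thesis using that[of "outside (frontier U)"] J by simp
qed

text \<open>In the coordinate \<zeta> with w = w0 exp(i \<zeta>) the unit circle becomes the real
  axis, and \<open>G\<close> is, up to sign, the local inverse of the parametrisation in this
  coordinate. Two things must be excluded: a distant piece of the curve returning to
  \<open>p\<close>, and \<open>U\<close> occupying both sides.\<close>

lemma smooth_domain_chart:
  assumes "smooth_domain U" "p \<in> frontier U"
  obtains G V where "open V" "p \<in> V" "G holomorphic_on V" "deriv G p \<noteq> 0"
    "\<And>z. z \<in> V \<Longrightarrow> z \<in> U \<longleftrightarrow> 0 < Im (G z)"
proof -
  obtain W where W: "open W" "U \<inter> W = {}" "U \<union> W = - frontier U" "frontier W = frontier U"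
    using smooth_domain_complement[OF assms(1)] by blast
  have U: "open U" using assms(1) by (simp add: smooth_domain_def)
  obtain \<gamma> where \<gamma>: "\<gamma> analytic_on sphere 0 1" "inj_on \<gamma> (sphere 0 1)"
      "\<And>w. w \<in> sphere 0 1 \<Longrightarrow> deriv \<gamma> w \<noteq> 0" "frontier U = \<gamma> ` sphere 0 1"
    using assms(1) unfolding smooth_domain_def analytic_curve_def by blast
  obtain w0 where w0: "cmod w0 = 1" "p = \<gamma> w0" using assms(2) \<gamma>(4) by auto
  obtain T where T: "open T" "sphere 0 1 \<subseteq> T" "\<gamma> holomorphic_on T"
    using \<gamma>(1) analytic_on_holomorphic by blast
  have w0': "w0 \<noteq> 0" "w0 \<in> T" using w0 T by auto
  define e where "e \<zeta> = w0 * exp (\<i> * \<zeta>)" for \<zeta>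
  define \<psi> where "\<psi> \<zeta> = \<gamma> (e \<zeta>)" for \<zeta>
  define S where "S = e -` T"
  have e_hol: "e holomorphic_on A" for A unfolding e_def by (intro holomorphic_intros)
  have "open S" unfolding S_def
    by (intro open_vimage T continuous_intros holomorphic_on_imp_continuous_on e_hol)
  have e0: "e 0 = w0" by (simp add: e_def)
  then have "0 \<in> S" using w0' by (simp add: S_def)
  have \<psi>_hol: "\<psi> holomorphic_on S"
    using holomorphic_on_compose_gen[OF e_hol T(3), of S] by (auto simp: S_def comp_def \<psi>_def[abs_def])
  have "(\<psi> has_field_derivative deriv \<gamma> w0 * (w0 * \<i>)) (at 0)"
  proof -
    have "(e has_field_derivative w0 * \<i>) (at 0)"
      unfolding e_def by (auto intro!: derivative_eq_intros)
    moreover have "(\<gamma> has_field_derivative deriv \<gamma> w0) (at (e 0))"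
      unfolding e0 by (rule holomorphic_derivI[OF T(3,1) w0'(2)])
    ultimately show ?thesis unfolding \<psi>_def by (rule DERIV_chain2[rotated])
  qed
  then have "deriv \<psi> 0 \<noteq> 0"
    using \<gamma>(3)[of w0] w0 w0' by (simp add: DERIV_imp_deriv)
  then obtain \<rho>1 where \<rho>1: "\<rho>1 > 0" "ball 0 \<rho>1 \<subseteq> S" "inj_on \<psi> (ball 0 \<rho>1)"
    using has_complex_derivative_locally_injective[OF \<psi>_hol \<open>0 \<in> S\<close> \<open>open S\<close>] by blast
  have on_curve: "\<psi> \<zeta> \<in> frontier U" if "Im \<zeta> = 0" for \<zeta>
    using that w0 \<gamma>(4) by (auto simp: \<psi>_def e_def norm_mult)
  \<comment> \<open>Continuity of the logarithm at 1 shows that a short arc about \<open>w0\<close>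
    comes from real \<zeta> near 0.\<close>
  have "\<exists>\<delta>>0. \<forall>w. cmod w = 1 \<and> dist w w0 < \<delta> \<longrightarrow> (\<exists>\<zeta>\<in>ball 0 \<rho>1. Im \<zeta> = 0 \<and> w = e \<zeta>)"
  proof -
    have "isCont Ln (1::complex)" by (intro continuous_at_Ln) auto
    then obtain \<delta> where \<delta>: "\<delta> > 0" "\<And>z. dist z 1 < \<delta> \<Longrightarrow> cmod (Ln z) < \<rho>1"
      using \<rho>1(1) unfolding continuous_at_eps_delta by (metis Ln_1 dist_0_norm dist_commute)
    have "\<exists>\<zeta>\<in>ball 0 \<rho>1. Im \<zeta> = 0 \<and> w = e \<zeta>" if w: "cmod w = 1" "dist w w0 < \<delta>" for w
    proof (intro bexI[of _ "-\<i> * Ln (w / w0)"] conjI)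
      have nz: "w / w0 \<noteq> 0" using w w0' by auto
      have "w / w0 - 1 = (w - w0) / w0" using w0' by (simp add: field_simps)
      then have "dist (w / w0) 1 = dist w w0" using w0(1) by (simp add: dist_norm norm_divide)
      then show "-\<i> * Ln (w / w0) \<in> ball 0 \<rho>1" using \<delta>(2)[of "w / w0"] w by (simp add: norm_mult)
      show "Im (-\<i> * Ln (w / w0)) = 0" using nz w w0 by (simp add: norm_divide)
      show "w = e (-\<i> * Ln (w / w0))" using nz w0' by (simp add: e_def exp_Ln)
    qed
    then show ?thesis using \<delta>(1) by blast
  qed
  then obtain \<delta> where \<delta>: "\<delta> > 0" "\<And>w. cmod w = 1 \<Longrightarrow> dist w w0 < \<delta> \<Longrightarrow> \<exists>\<zeta>\<in>ball 0 \<rho>1. Im \<zeta> = 0 \<and> w = e \<zeta>"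
    by blast
  \<comment> \<open>The rest of the curve is compact and misses \<open>p\<close> by injectivity, so
    a small enough disc has an image disjoint from it.\<close>
  define K where "K = \<gamma> ` (sphere 0 1 - ball w0 \<delta>)"
  have "compact K" unfolding K_def
  proof (rule compact_continuous_image)
    show "continuous_on (sphere 0 1 - ball w0 \<delta>) \<gamma>"
      by (rule continuous_on_subset[OF holomorphic_on_imp_continuous_on[OF T(3)]]) (use T(2) in blast)
    show "compact (sphere (0::complex) 1 - ball w0 \<delta>)" by (simp add: compact_diff)
  qed
  then have "open (- K)" by (simp add: compact_imp_closed open_Compl)
  have "p \<notin> K"
  proof
    assume "p \<in> K"
    then obtain w where "w \<in> sphere 0 1" "w \<notin> ball w0 \<delta>" "\<gamma> w0 = \<gamma> w" using w0(2) by (auto simp: K_def)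
    then show False using \<gamma>(2) w0(1) \<delta>(1) by (auto dest: inj_onD)
  qed
  have "open (ball 0 \<rho>1 \<inter> \<psi> -` (- K))"
    by (intro continuous_open_preimage holomorphic_on_imp_continuous_on
          holomorphic_on_subset[OF \<psi>_hol \<rho>1(2)] \<open>open (- K)\<close>) auto
  moreover have "0 \<in> ball 0 \<rho>1 \<inter> \<psi> -` (- K)"
    using \<rho>1(1) \<open>p \<notin> K\<close> w0(2) by (simp add: \<psi>_def e0)
  ultimately obtain \<rho> where \<rho>: "\<rho> > 0" "ball 0 \<rho> \<subseteq> ball 0 \<rho>1 \<inter> \<psi> -` (- K)"
    using open_contains_ball by metis
  have curve_iff: "\<psi> \<zeta> \<in> frontier U \<longleftrightarrow> Im \<zeta> = 0" if \<zeta>: "\<zeta> \<in> ball 0 \<rho>" for \<zeta>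
  proof
    assume "\<psi> \<zeta> \<in> frontier U"
    then obtain w where w: "cmod w = 1" "\<psi> \<zeta> = \<gamma> w" using \<gamma>(4) by auto
    have "\<psi> \<zeta> \<notin> K" using \<rho>(2) \<zeta> by blast
    then have "w \<in> ball w0 \<delta>" using w by (auto simp: K_def)
    then obtain \<xi> where \<xi>: "\<xi> \<in> ball 0 \<rho>1" "Im \<xi> = 0" "w = e \<xi>"
      using \<delta>(2)[OF w(1)] by (auto simp: dist_commute)
    have "\<psi> \<zeta> = \<psi> \<xi>" using w \<xi> by (simp add: \<psi>_def)
    moreover have "\<zeta> \<in> ball 0 \<rho>1" using \<rho>(2) \<zeta> by blast
    ultimately have "\<zeta> = \<xi>" using inj_onD[OF \<rho>1(3)] \<xi>(1) by blast
    then show "Im \<zeta> = 0" using \<xi> by simp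
  qed (rule on_curve)
  have inj: "inj_on \<psi> (ball 0 \<rho>)" by (rule inj_on_subset[OF \<rho>1(3)]) (use \<rho> in blast)
  have hol: "\<psi> holomorphic_on ball 0 \<rho>" by (rule holomorphic_on_subset[OF \<psi>_hol]) (use \<rho> \<rho>1 in blast)
  define V where "V = \<psi> ` ball 0 \<rho>"
  have "open V" unfolding V_def by (rule open_mapping_thm3[OF hol open_ball inj])
  have "p \<in> V" using \<rho>(1) w0(2) by (auto simp: V_def \<psi>_def e0 intro!: image_eqI[of _ _ 0])
  obtain F where F: "F holomorphic_on V" "\<And>\<zeta>. \<zeta> \<in> ball 0 \<rho> \<Longrightarrow> deriv \<psi> \<zeta> * deriv F (\<psi> \<zeta>) = 1"
      "\<And>\<zeta>. \<zeta> \<in> ball 0 \<rho> \<Longrightarrow> F (\<psi> \<zeta>) = \<zeta>"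
    using holomorphic_has_inverse[OF hol open_ball inj] unfolding V_def by blast
  have "deriv F p \<noteq> 0" using F(2)[of 0] \<rho>(1) w0(2) by (auto simp: \<psi>_def e0)
  \<comment> \<open>Off the real axis the image avoids the boundary, so a connected piece falls into
    one of the disjoint open sets \<open>U\<close> and \<open>W\<close>.\<close>
  have side: "\<psi> ` H \<subseteq> U \<or> \<psi> ` H \<subseteq> W"
    if H: "connected H" "H \<subseteq> ball 0 \<rho>" "\<And>\<zeta>. \<zeta> \<in> H \<Longrightarrow> Im \<zeta> \<noteq> 0" for H
  proof -
    have "connected (\<psi> ` H)"
      by (intro connected_continuous_image H holomorphic_on_imp_continuous_on holomorphic_on_subset[OF hol])
    moreover have "\<psi> ` H \<subseteq> U \<union> W" using curve_iff H W(3) by blast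
    ultimately show ?thesis
      using connectedD[of "\<psi> ` H" U W] U W(1,2) by blast
  qed
  define P N where "P = ball 0 \<rho> \<inter> {\<zeta>. 0 < Im \<zeta>}" and "N = ball 0 \<rho> \<inter> {\<zeta>. Im \<zeta> < 0}"
  have conn: "connected P" "connected N"
    unfolding P_def N_def by (intro convex_connected convex_Int convex_ball convex_halfspace_Im_gt convex_halfspace_Im_lt)+
  have "\<psi> ` P \<subseteq> U \<or> \<psi> ` P \<subseteq> W" by (rule side[OF conn(1)]) (auto simp: P_def)
  moreover have "\<psi> ` N \<subseteq> U \<or> \<psi> ` N \<subseteq> W" by (rule side[OF conn(2)]) (auto simp: N_def)
  ultimately have PN: "(\<forall>\<zeta>\<in>P. \<psi> \<zeta> \<in> U) \<or> (\<forall>\<zeta>\<in>P. \<psi> \<zeta> \<in> W)" "(\<forall>\<zeta>\<in>N. \<psi> \<zeta> \<in> U) \<or> (\<forall>\<zeta>\<in>N. \<psi> \<zeta> \<in> W)"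
    by (simp_all only: image_subset_iff)
  \<comment> \<open>Both \<open>U\<close> and \<open>W\<close> accumulate at \<open>p\<close>; hence
    the two half discs cannot be mapped to the same one.\<close>
  have meets: "\<exists>\<zeta>\<in>ball 0 \<rho>. \<psi> \<zeta> \<in> X \<and> Im \<zeta> \<noteq> 0" if X: "X = U \<or> X = W" for X
  proof -
    have "p \<in> closure X" using X assms(2) W(4) by (auto simp: frontier_def)
    then have "V \<inter> X \<noteq> {}" using \<open>open V\<close> \<open>p \<in> V\<close> open_Int_closure_eq_empty by blast
    then obtain \<zeta> where \<zeta>: "\<zeta> \<in> ball 0 \<rho>" "\<psi> \<zeta> \<in> X" by (auto simp: V_def)
    then have "\<psi> \<zeta> \<notin> frontier U" using W(3) X by auto
    then show ?thesis using \<zeta> curve_iff by blast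
  qed
  have split: "\<zeta> \<in> P \<or> \<zeta> \<in> N" if "\<zeta> \<in> ball 0 \<rho>" "Im \<zeta> \<noteq> 0" for \<zeta>
    using that by (auto simp: P_def N_def)
  have notU: "\<psi> \<zeta> \<notin> U" if "\<zeta> \<in> ball 0 \<rho>" "Im \<zeta> = 0" for \<zeta>
    using that curve_iff[of \<zeta>] W(3) by blast
  have "\<not> ((\<forall>\<zeta>\<in>P. \<psi> \<zeta> \<in> U) \<and> (\<forall>\<zeta>\<in>N. \<psi> \<zeta> \<in> U))" using meets[of W] split W(2) by blast
  moreover have "\<not> ((\<forall>\<zeta>\<in>P. \<psi> \<zeta> \<in> W) \<and> (\<forall>\<zeta>\<in>N. \<psi> \<zeta> \<in> W))" using meets[of U] split W(2) by blast
  ultimately consider "\<forall>\<zeta>\<in>P. \<psi> \<zeta> \<in> U" "\<forall>\<zeta>\<in>N. \<psi> \<zeta> \<in> W" | "\<forall>\<zeta>\<in>P. \<psi> \<zeta> \<in> W" "\<forall>\<zeta>\<in>N. \<psi> \<zeta> \<in> U"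
    using PN by blast
  then show ?thesis
  proof cases
    case 1
    have "\<psi> \<zeta> \<in> U \<longleftrightarrow> 0 < Im \<zeta>" if "\<zeta> \<in> ball 0 \<rho>" for \<zeta>
      using that 1 notU[OF that] W(2)
      by (cases "Im \<zeta>" "0::real" rule: linorder_cases) (auto simp: P_def N_def)
    then have "z \<in> U \<longleftrightarrow> 0 < Im (F z)" if "z \<in> V" for z
      using \<open>z \<in> V\<close> F(3) unfolding V_def by auto
    then show ?thesis using that[of V F] \<open>open V\<close> \<open>p \<in> V\<close> F(1) \<open>deriv F p \<noteq> 0\<close> by blast
  next
    case 2
    have "\<psi> \<zeta> \<in> U \<longleftrightarrow> Im \<zeta> < 0" if "\<zeta> \<in> ball 0 \<rho>" for \<zeta>
      using that 2 notU[OF that] W(2)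
      by (cases "Im \<zeta>" "0::real" rule: linorder_cases) (auto simp: P_def N_def)
    then have "z \<in> U \<longleftrightarrow> 0 < Im (- F z)" if "z \<in> V" for z
      using \<open>z \<in> V\<close> F(3) unfolding V_def by auto
    moreover have "deriv (\<lambda>z. - F z) p \<noteq> 0"
      using \<open>deriv F p \<noteq> 0\<close> holomorphic_on_imp_differentiable_at[OF F(1) \<open>open V\<close> \<open>p \<in> V\<close>]
      by simp
    moreover have "(\<lambda>z. - F z) holomorphic_on V" by (intro holomorphic_intros F(1))
    ultimately show ?thesis
      using that[of V "\<lambda>z. - F z"] \<open>open V\<close> \<open>p \<in> V\<close> by blast
  qed
qed

section \<open>From the boundary chart to cones along the axes\<close>

lemma cmod_cone_vector:
  assumes "d \<in> axes" "0 \<le> s" "\<bar>u\<bar> \<le> s / 8"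
  shows "cmod (d * Complex s u) \<le> 9 / 8 * s"
  using cmod_le[of "Complex s u"] assms by (simp add: norm_mult norm_axis)

text \<open>For a = G'(p) the number \<open>Im (a * d)\<close> is the growth rate of
  \<open>Im G\<close> at \<open>p\<close> in direction \<open>d\<close>. One of the four axes
  therefore points into the domain at a definite angle.\<close>

lemma axis_close_to_normal: "\<exists>d\<in>axes. cmod a / 2 \<le> Im (a * d)"
proof -
  have "cmod a / 2 \<le> \<bar>Re a\<bar> \<or> cmod a / 2 \<le> \<bar>Im a\<bar>" using cmod_le[of a] by linarith
  then show ?thesis by (auto simp: axes_def abs_if split: if_splits)
qed

text \<open>Near \<open>p\<close> the chart is close enough to linear that \<open>Im G\<close> is
  nowhere smaller on the cone than at its apex; it is positive at an apex in \<open>U\<close>, hence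
  on the whole cone.\<close>

lemma cone_at_frontier:
  assumes "smooth_domain U" "p \<in> frontier U"
  shows "\<exists>r>0. cone_at U p r"
proof -
  obtain G V where V: "open V" "p \<in> V" and G: "G holomorphic_on V" "deriv G p \<noteq> 0"
    and iff: "\<And>z. z \<in> V \<Longrightarrow> z \<in> U \<longleftrightarrow> 0 < Im (G z)"
    using smooth_domain_chart[OF assms] by metis
  define a where "a = deriv G p"
  have a: "cmod a > 0" using G(2) by (simp add: a_def)
  have "continuous_on V (deriv G)"
    using holomorphic_deriv[OF G(1) V(1)] holomorphic_on_imp_continuous_on by blast
  then have "isCont (deriv G) p" using V continuous_on_eq_continuous_at by blast
  then obtain \<delta>1 where \<delta>1: "\<delta>1 > 0" "\<And>z. dist z p < \<delta>1 \<Longrightarrow> dist (deriv G z) a < cmod a / 8"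
    unfolding continuous_at_eps_delta a_def[symmetric] using a by (metis divide_pos_pos zero_less_numeral)
  obtain \<delta>2 where \<delta>2: "\<delta>2 > 0" "ball p \<delta>2 \<subseteq> V" using V open_contains_ball by blast
  define \<delta> where "\<delta> = min \<delta>1 \<delta>2"
  have \<delta>: "\<delta> > 0" "ball p \<delta> \<subseteq> V" using \<delta>1 \<delta>2 by (auto simp: \<delta>_def)
  have lin: "cmod (G x - G y - a * (x - y)) \<le> cmod a / 8 * cmod (x - y)"
    if xy: "x \<in> ball p \<delta>" "y \<in> ball p \<delta>" for x y
  proof -
    have "cmod ((G x - a * x) - (G y - a * y)) \<le> cmod a / 8 * cmod (x - y)"
    proof (rule field_differentiable_bound[OF convex_ball _ _ xy])
      fix z assume z: "z \<in> ball p \<delta>"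
      then have "z \<in> V" using \<delta> by blast
      then have "(G has_field_derivative deriv G z) (at z)" by (rule holomorphic_derivI[OF G(1) V(1)])
      then have "((\<lambda>z. G z - a * z) has_field_derivative deriv G z - a * 1) (at z)"
        by (intro DERIV_diff DERIV_cmult DERIV_ident)
      then show "((\<lambda>z. G z - a * z) has_field_derivative deriv G z - a) (at z within ball p \<delta>)"
        using has_field_derivative_at_within by simp
      show "cmod (deriv G z - a) \<le> cmod a / 8"
        using \<delta>1(2)[of z] z by (simp add: \<delta>_def dist_norm norm_minus_commute less_imp_le)
    qed
    then show ?thesis by (simp add: algebra_simps)
  qed
  obtain d where d: "d \<in> axes" "cmod a / 2 \<le> Im (a * d)" using axis_close_to_normal by blast
  have "q + d * Complex s u \<in> U"
    if q: "q \<in> U" "q \<in> ball p (\<delta> / 4)" and su: "0 \<le> s" "s \<le> \<delta> / 4" "\<bar>u\<bar> \<le> s / 8" for q s u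
  proof -
    define v where "v = d * Complex s u"
    have v: "cmod v \<le> 9 / 8 * s" unfolding v_def by (rule cmod_cone_vector[OF d(1) su(1,3)])
    have qV: "q \<in> ball p \<delta>" using q \<delta>(1) by auto
    have "dist p (q + v) \<le> dist p q + cmod v"
      using dist_triangle[of p "q + v" q] by (simp add: dist_norm)
    also have "\<dots> < \<delta>" using q(2) v su(2) \<delta>(1) by simp
    finally have qv: "q + v \<in> ball p \<delta>" by simp
    have "cmod (G (q + v) - G q - a * v) \<le> cmod a / 8 * (9 / 8 * s)"
      using order_trans[OF lin[OF qv qV], of "cmod a / 8 * (9 / 8 * s)"] mult_left_mono[OF v, of "cmod a / 8"] by simp
    then have 1: "\<bar>Im (G (q + v)) - Im (G q) - Im (a * v)\<bar> \<le> 9 / 64 * (cmod a * s)"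
      using abs_Im_le_cmod[of "G (q + v) - G q - a * v"] by simp
    have "a * v = (a * d) * Complex s u" by (simp add: v_def)
    then have "Im (a * v) = s * Im (a * d) + u * Re (a * d)" by (simp only: times_complex.simps complex.sel) (simp add: algebra_simps)
    moreover have "s * cmod a / 2 \<le> s * Im (a * d)" using mult_left_mono[OF d(2) su(1)] by simp
    moreover have "\<bar>u * Re (a * d)\<bar> \<le> s / 8 * cmod a"
      using abs_Re_le_cmod[of "a * d"] su norm_axis[OF d(1)] unfolding abs_mult by (intro mult_mono) (auto simp: norm_mult)
    moreover have "0 \<le> s * cmod a" using su by simp
    \<comment> \<open>In units of s |a|: the gain is at least 1/2, the transversal part loses at
      most 1/8 and the nonlinear error is at most (1/8)(9/8) = 9/64, which leaves 15/64.\<close>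
    ultimately have "Im (G q) \<le> Im (G (q + v))" using 1 unfolding mult.commute[of "cmod a" s] by linarith
    moreover have "q \<in> V" "q + v \<in> V" using qV qv \<delta>(2) by blast+
    ultimately show ?thesis using iff[of q] iff[of "q + v"] q(1) unfolding v_def by linarith
  qed
  then show ?thesis using \<delta>(1) d(1) unfolding cone_at_def
    by (intro exI[of _ "\<delta> / 4"] conjI bexI[of _ d] ballI allI impI) auto
qed

lemma cone_at_interior:
  assumes "open U" "p \<in> U"
  shows "\<exists>r>0. cone_at U p r"
proof -
  obtain e where e: "e > 0" "ball p e \<subseteq> U" using assms open_contains_ball by blast
  have "q + 1 * Complex s u \<in> U"
    if q: "q \<in> ball p (e / 3)" and su: "0 \<le> s" "s \<le> e / 3" "\<bar>u\<bar> \<le> s / 8" for q s u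
  proof -
    have "cmod (1 * Complex s u) \<le> 9 / 8 * s" by (rule cmod_cone_vector) (use su in \<open>simp_all add: axes_def\<close>)
    moreover have "dist p (q + 1 * Complex s u) \<le> dist p q + cmod (1 * Complex s u)"
      using dist_triangle[of p "q + 1 * Complex s u" q] by (simp add: dist_norm)
    ultimately have "q + 1 * Complex s u \<in> ball p e" using q su(2) e(1) by simp
    then show ?thesis using e by blast
  qed
  then show ?thesis using e(1) unfolding cone_at_def
    by (intro exI[of _ "e / 3"] conjI bexI[of _ 1]) (auto simp: axes_def)
qed

text \<open>A Lebesgue number argument on the compact closure: with the radii halved, a ball of
  radius \<open>r\<close> about any point of \<open>U\<close> fits into a single ball in which one
  cone direction is valid.\<close>

lemma smooth_domain_axis_cone:
  assumes "smooth_domain U"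
  obtains r where "axis_cone U r"
proof -
  have U: "open U" "bounded U" "U \<noteq> {}" using assms by (auto simp: smooth_domain_def)
  have "\<exists>r>0. cone_at U p r" if "p \<in> closure U" for p
    using that cone_at_interior[OF U(1)] cone_at_frontier[OF assms] U(1)
    by (auto simp: frontier_def interior_open)
  then obtain \<rho> where \<rho>: "\<And>p. p \<in> closure U \<Longrightarrow> \<rho> p > 0 \<and> cone_at U p (\<rho> p)" by metis
  have cover: "closure U \<subseteq> (\<Union>p\<in>closure U. ball p (\<rho> p / 2))"
  proof
    fix p assume "p \<in> closure U"
    then show "p \<in> (\<Union>p\<in>closure U. ball p (\<rho> p / 2))" using \<rho>[of p] by (intro UN_I[of p]) auto
  qed
  have "compact (closure U)" using U(2) by simp
  then obtain I where I: "I \<subseteq> closure U" "finite I" "closure U \<subseteq> (\<Union>p\<in>I. ball p (\<rho> p / 2))"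
    by (rule compactE_image[OF _ _ cover]) (simp, blast)
  have "I \<noteq> {}" using I U(3) by auto
  define r where "r = Min ((\<lambda>p. \<rho> p / 2) ` I)"
  have r: "r > 0" using I \<open>I \<noteq> {}\<close> \<rho> by (auto simp: r_def)
  have r_le: "r \<le> \<rho> p / 2" if "p \<in> I" for p
    unfolding r_def by (rule Min_le) (use I that in auto)
  have "\<exists>d\<in>axes. \<forall>q\<in>U \<inter> ball p r. \<forall>s u. 0 \<le> s \<longrightarrow> s \<le> r \<longrightarrow> \<bar>u\<bar> \<le> s / 8 \<longrightarrow> q + d * Complex s u \<in> U"
    if "p \<in> U" for p
  proof -
    have "p \<in> closure U" using that closure_subset[of U] by (rule subsetD[rotated])
    then have "p \<in> (\<Union>p\<in>I. ball p (\<rho> p / 2))" by (rule subsetD[OF I(3)])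
    then obtain c where c: "c \<in> I" "p \<in> ball c (\<rho> c / 2)" by (rule UN_E)
    obtain d where d: "d \<in> axes" and cone: "\<forall>q\<in>U \<inter> ball c (\<rho> c). \<forall>s u.
        0 \<le> s \<longrightarrow> s \<le> \<rho> c \<longrightarrow> \<bar>u\<bar> \<le> s / 8 \<longrightarrow> q + d * Complex s u \<in> U"
      using \<rho>[OF subsetD[OF I(1) c(1)]] unfolding cone_at_def by blast
    have "q + d * Complex s u \<in> U"
      if "q \<in> U \<inter> ball p r" "0 \<le> s" "s \<le> r" "\<bar>u\<bar> \<le> s / 8" for q s u
    proof -
      have "q \<in> ball c (\<rho> c)" using that(1) c(2) r_le[OF c(1)] dist_triangle[of c q p] by simp
      moreover have "s \<le> \<rho> c" using that(2,3) r r_le[OF c(1)] by simp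
      ultimately show ?thesis using cone that by blast
    qed
    then show ?thesis using d by blast
  qed
  then have "axis_cone U r" using r unfolding axis_cone_def cone_at_def by blast
  then show ?thesis by (rule that)
qed

section \<open>Capacity of a long lattice path\<close>

text \<open>The rays spread the value 1 from \<open>Q\<close> to at least b n^2 vertices, on which
  \<open>g\<close> is near 1 in mean square if the energy is small. The Poincare inequality then
  confronts these with the vertices of \<open>A\<close>, where \<open>g\<close> is 0. The set
  \<open>Q\<close> alone, of order n vertices, is too thin to be compared with \<open>A\<close> in
  this way.\<close>

lemma capacity_of_disjoint_rays:
  assumes "bounded U" "linked U U U" "a > 0" "b > 0" "D > 0"
  obtains \<kappa> N where "\<kappa> > 0"
    "\<And>n (g::complex \<Rightarrow> real) A Q d m. \<lbrakk>n \<ge> N; n > 0; A \<subseteq> grid U n; a * (real n)\<^sup>2 \<le> card A;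
      \<And>y. y \<in> A \<Longrightarrow> g y = 0; d \<in> axes; Q \<subseteq> grid U n; \<And>q. q \<in> Q \<Longrightarrow> g q = 1;
      \<And>q. q \<in> Q \<Longrightarrow> closed_segment q (ray n d q m) \<subseteq> U;
      inj_on (\<lambda>(q, k). ray n d q k) (Q \<times> {..<m});
      b * (real n)\<^sup>2 \<le> real (card Q) * real m; real m \<le> D * real n\<rbrakk> \<Longrightarrow> \<kappa> \<le> energy U n g"
proof -
  obtain C N where *: "C \<ge> 0" "N > 0"
    "\<And>n (g::complex \<Rightarrow> real). n \<ge> N \<Longrightarrow>
       (\<Sum>x\<in>grid_on U U n. \<Sum>y\<in>grid_on U U n. (g x - g y)\<^sup>2) \<le> C * real n ^ 4 * energy U n g"
    using assms(2) by (rule linkedE) blast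
  obtain K where K: "K > 0" "\<And>n. n > 0 \<Longrightarrow> real (card (grid U n)) \<le> K * (real n)\<^sup>2"
    using card_grid_le[OF assms(1)] by blast
  define M where "M = 2 * K * D\<^sup>2 + 2 * C"
  have M: "M > 0" using K * assms by (simp add: M_def add_pos_nonneg)
  have "a * b / M \<le> energy U n g"
    if n: "n \<ge> N" "n > 0" and A: "A \<subseteq> grid U n" "a * (real n)\<^sup>2 \<le> card A"
      and gA: "\<And>y. y \<in> A \<Longrightarrow> g y = 0" and d: "d \<in> axes" and Q: "Q \<subseteq> grid U n" and gQ: "\<And>q. q \<in> Q \<Longrightarrow> g q = 1"
      and seg: "\<And>q. q \<in> Q \<Longrightarrow> closed_segment q (ray n d q m) \<subseteq> U"
      and inj: "inj_on (\<lambda>(q, k). ray n d q k) (Q \<times> {..<m})"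
      and card: "b * (real n)\<^sup>2 \<le> real (card Q) * real m" and m: "real m \<le> D * real n"
    for n :: nat and g :: "complex \<Rightarrow> real" and A Q d m
  proof -
    define W where "W = (\<lambda>(q, k). ray n d q k) ` (Q \<times> {..<m})"
    have fin: "finite (grid U n)" using finite_grid[OF assms(1) n(2)] .
    have E: "energy U n g \<ge> 0" by (rule energy_nonneg)
    have W: "W \<subseteq> grid U n"
    proof
      fix w assume "w \<in> W"
      then obtain q k where q: "q \<in> Q" "k < m" "w = ray n d q k" by (auto simp: W_def)
      have "q \<in> scaled_lattice n" using q Q by (auto simp: grid_def)
      then show "w \<in> grid U n" using ray_step(1)[OF n(2) d _ q(2) seg[OF q(1)]] q(3) by simp
    qed
    have cW: "card W = card Q * m"
      unfolding W_def card_image[OF inj] by (simp add: card_cartesian_product)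
    have "(\<Sum>w\<in>W. (g w - 1)\<^sup>2) = (\<Sum>i\<in>Q \<times> {..<m}. (g (ray n d (fst i) (snd i)) - 1)\<^sup>2)"
      unfolding W_def by (subst sum.reindex[OF inj]) (simp add: case_prod_unfold)
    also have "\<dots> = (\<Sum>q\<in>Q. \<Sum>k<m. (g (ray n d q k) - g q)\<^sup>2)"
      by (subst sum.cartesian_product) (auto intro!: sum.cong simp: gQ)
    also have "\<dots> \<le> (real m)\<^sup>2 * energy U n g"
      by (rule sum_disjoint_rays_le[OF assms(1) n(2) d Q seg inj])
    also have "\<dots> \<le> (D * n)\<^sup>2 * energy U n g"
      using m E by (intro mult_right_mono power_mono) auto
    finally have sW: "(\<Sum>w\<in>W. (g w - 1)\<^sup>2) \<le> (D * n)\<^sup>2 * energy U n g" .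
    have "(\<Sum>w\<in>W. \<Sum>y\<in>A. (g w - g y)\<^sup>2) \<le> (\<Sum>w\<in>W. \<Sum>y\<in>grid U n. (g w - g y)\<^sup>2)"
      by (intro sum_mono sum_mono2 fin A) auto
    also have "\<dots> \<le> (\<Sum>w\<in>grid U n. \<Sum>y\<in>grid U n. (g w - g y)\<^sup>2)"
      by (intro sum_mono2 fin W) (auto intro!: sum_nonneg)
    also have "\<dots> \<le> C * real n ^ 4 * energy U n g"
    proof -
      have "grid_on U U n = grid U n" by (auto simp: grid_def)
      then show ?thesis using *(3)[OF n(1), of g] by simp
    qed
    finally have sWA: "(\<Sum>w\<in>W. \<Sum>y\<in>A. (g w - g y)\<^sup>2) \<le> C * real n ^ 4 * energy U n g" .
    have "a * b * real n ^ 4 = (a * (real n)\<^sup>2) * (b * (real n)\<^sup>2)"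
      by (simp add: power2_eq_square power4_eq_xxxx mult_ac)
    also have "\<dots> \<le> real (card A) * real (card W)"
      using A card assms by (intro mult_mono) (auto simp: cW)
    also have "\<dots> = (\<Sum>w\<in>W. \<Sum>y\<in>A. 1)" by simp
    also have "\<dots> \<le> (\<Sum>w\<in>W. \<Sum>y\<in>A. 2 * (g w - 1)\<^sup>2 + 2 * (g w - g y)\<^sup>2)"
    proof (intro sum_mono)
      fix w y assume "y \<in> A"
      then show "1 \<le> 2 * (g w - 1)\<^sup>2 + 2 * (g w - g y)\<^sup>2"
        using square_diff_le[of 1 "g y" "g w"] gA by (simp add: power2_commute)
    qed
    also have "\<dots> = 2 * (real (card A) * (\<Sum>w\<in>W. (g w - 1)\<^sup>2)) + 2 * (\<Sum>w\<in>W. \<Sum>y\<in>A. (g w - g y)\<^sup>2)"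
      by (simp add: sum.distrib sum_distrib_left mult_ac)
    also have "\<dots> \<le> 2 * (K * (real n)\<^sup>2 * ((D * n)\<^sup>2 * energy U n g)) + 2 * (C * real n ^ 4 * energy U n g)"
    proof -
      have "card A \<le> K * (real n)\<^sup>2" using card_mono[OF fin A(1)] K(2)[OF n(2)] by simp
      then show ?thesis
        using K(1) by (intro add_mono mult_left_mono mult_mono sW sWA) (auto intro!: sum_nonneg)
    qed
    also have "\<dots> = M * energy U n g * real n ^ 4"
      by (simp add: M_def power_mult_distrib power2_eq_square power4_eq_xxxx algebra_simps)
    finally have "a * b \<le> M * energy U n g" using n(2) by simp
    then show ?thesis using M by (simp add: field_simps)
  qed
  moreover have "a * b / M > 0" using assms M by simp
  ultimately show ?thesis using that[of "a * b / M" N] by blast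
qed

section \<open>Disjoint rays from a long lattice path\<close>

lemma intermediate_level:
  fixes f :: "nat \<Rightarrow> int"
  assumes "\<And>k. Suc k < T \<Longrightarrow> \<bar>f (Suc k) - f k\<bar> \<le> 1" "i < T" "j < T" "f i \<le> c" "c \<le> f j"
  shows "\<exists>k<T. f k = c"
proof (cases "i \<le> j")
  case True
  then show ?thesis
    using nat_intermed_int_val[of i j f c] assms by (auto dest: order_le_less_trans)
next
  case False
  have "\<forall>k. j \<le> k \<and> k < i \<longrightarrow> \<bar>- f (Suc k) - - f k\<bar> \<le> 1"
    using assms(1,2) by (auto simp: abs_minus_commute)
  then show ?thesis
    using nat_intermed_int_val[of j i "\<lambda>k. - f k" "- c"] False assms by (auto dest: order_le_less_trans)
qed

lemma lattice_rotate:
  assumes "d \<in> axes" "z \<in> scaled_lattice n"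
  shows "z * cnj d \<in> scaled_lattice n"
proof -
  obtain a b where "z = lattice_point n (a, b)" using assms(2) by (auto simp: scaled_lattice_eq)
  then have "z * cnj d \<in> lattice_point n ` {(a, b), (-a, -b), (b, -a), (-b, a)}"
    using assms(1) by (auto simp: axes_def lattice_point_def complex_eq_iff)
  then show ?thesis by (auto simp: scaled_lattice_eq)
qed

lemma closed_segment_ray_subset:
  assumes "n > 0" "\<And>u. 0 \<le> u \<Longrightarrow> u \<le> real m / real n \<Longrightarrow> q + of_real u * d \<in> U"
  shows "closed_segment q (ray n d q m) \<subseteq> U"
proof
  fix y assume "y \<in> closed_segment q (ray n d q m)"
  then obtain t where t: "0 \<le> t" "t \<le> 1" "y = (1 - t) *\<^sub>R q + t *\<^sub>R ray n d q m"
    by (auto simp: closed_segment_def)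
  then have "y = q + of_real (t * (real m / real n)) * d"
    by (simp add: ray_def scaleR_conv_of_real algebra_simps)
  moreover have "q + of_real (t * (real m / real n)) * d \<in> U"
    by (rule assms(2)) (use t mult_left_le_one_le[of "real m / real n" t] in auto)
  ultimately show "y \<in> U" by simp
qed

text \<open>Intended for \<phi> a coordinate transversal to the rays: it is constant along each of
  them and separates their starting points, so distinct rays never meet.\<close>

lemma inj_on_rays:
  assumes "n > 0" "d \<in> axes" "inj_on \<phi> Q" "\<And>q k. \<phi> (ray n d q k) = \<phi> q"
  shows "inj_on (\<lambda>(q, k). ray n d q k) (Q \<times> S)"
proof -
  have "q = q' \<and> k = k'" if "q \<in> Q" "q' \<in> Q" "ray n d q k = ray n d q' k'" for q q' k k'
  proof -
    have "\<phi> q = \<phi> q'" using assms(4)[of q k] assms(4)[of q' k'] that(3) by simp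
    then have "q = q'" using assms(3) that by (auto dest: inj_onD)
    moreover have "d \<noteq> 0" using norm_axis[OF assms(2)] by auto
    ultimately show ?thesis using that(3) assms(1) by (simp add: ray_def)
  qed
  then show ?thesis by (auto simp: inj_on_def)
qed

text \<open>Let \<open>d\<close> be the cone direction at the start of the path. If the path moves far transversally to
  \<open>d\<close>, shoot rays in the direction \<open>d\<close>. Otherwise it moves far along \<open>d\<close> within a narrow strip; the
  cone at its lowest point then contains the strip at some height, and we shoot transversal rays
  from there.\<close>

lemma long_path_rays:
  assumes "axis_cone U r" "\<rho> > 0"
  defines "L \<equiv> min r \<rho> / 4"
  assumes n: "n > 0" "64 \<le> real n * L"
    and x0: "x 0 \<in> grid U n" and step: "\<And>k. k < T \<Longrightarrow> x (Suc k) \<in> nbrs U n (x k)"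
    and far: "\<rho> \<le> dist (x 0) (x T)"
  shows "\<exists>d\<in>axes. \<exists>Q m. Q \<subseteq> x ` {..T} \<and> (\<forall>q\<in>Q. closed_segment q (ray n d q m) \<subseteq> U) \<and>
    inj_on (\<lambda>(q, k). ray n d q k) (Q \<times> {..<m}) \<and> L\<^sup>2 / 8192 * (real n)\<^sup>2 \<le> real (card Q) * real m \<and>
    real m \<le> r * real n"
proof -
  have r: "r > 0" using assms(1) by (simp add: axis_cone_def)
  have L: "L > 0" "4 * L \<le> r" "4 * L \<le> \<rho>" using r assms(2) by (auto simp: L_def)
  have nLr: "4 * (real n * L) \<le> r * real n" using mult_left_mono[OF L(2), of "real n"] by (simp add: mult_ac)
  define p where "p = x 0"
  have p: "p \<in> U" using x0 by (auto simp: p_def grid_def)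
  obtain d where d: "d \<in> axes" and cone: "\<And>q s u. q \<in> U \<Longrightarrow> q \<in> ball p r \<Longrightarrow> 0 \<le> s \<Longrightarrow> s \<le> r \<Longrightarrow>
      \<bar>u\<bar> \<le> s / 8 \<Longrightarrow> q + d * Complex s u \<in> U"
    using assms(1) p unfolding axis_cone_def cone_at_def by blast
  have dd: "d * cnj d = 1" using complex_norm_square[of d] norm_axis[OF d] by simp
  have id: "\<i> * d \<in> axes" using d by (auto simp: axes_def)
  \<comment> \<open>Coordinates with origin \<open>p\<close> in which the cone direction is the
    positive real axis.\<close>
  define co where "co q = (q - p) * cnj d" for q
  have d_co: "d * co q = q - p" for q
    using dd by (simp add: co_def mult.assoc[symmetric] mult.commute[of d "q - p"])
  have norm_co: "cmod (co q - co q') = dist q q'" for q q'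
    using norm_axis[OF d] by (simp add: co_def dist_norm norm_mult flip: left_diff_distrib)
  have co_p: "co p = 0" by (simp add: co_def)
  have ray1: "co (ray n d q k) = co q + of_real (real k / real n)" for q k
    using dd by (simp add: co_def ray_def algebra_simps)
  have ray2: "co (ray n (\<i> * d) q k) = co q + \<i> * of_real (real k / real n)" for q k
    using dd by (simp add: co_def ray_def algebra_simps)
  \<comment> \<open>On the grid the scaled coordinates are already integers, so the floors are exact
    there; integer values give access to the discrete intermediate value theorem.\<close>
  define s t where "s q = \<lfloor>real n * Re (co q)\<rfloor>" and "t q = \<lfloor>real n * Im (co q)\<rfloor>" for q
  have x: "x k \<in> grid U n" if "k \<le> T" for k
  proof (cases k)
    case (Suc j)
    then show ?thesis using step[of j] that nbrs_subset_grid by auto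
  qed (use x0 in simp)
  have st: "real_of_int (s q) = real n * Re (co q)" "real_of_int (t q) = real n * Im (co q)" if "q \<in> grid U n" for q
  proof -
    have "co q \<in> scaled_lattice n"
      unfolding co_def using that x0 by (intro lattice_rotate[OF d] lattice_diff) (auto simp: p_def grid_def)
    then obtain a b where "co q = lattice_point n (a, b)" by (auto simp: scaled_lattice_eq)
    then show "real_of_int (s q) = real n * Re (co q)" "real_of_int (t q) = real n * Im (co q)"
      using n by (auto simp: s_def t_def lattice_point_def)
  qed
  have lip: "\<bar>s (x (Suc k)) - s (x k)\<bar> \<le> 1" "\<bar>t (x (Suc k)) - t (x k)\<bar> \<le> 1" if "k < T" for k
  proof -
    have "cmod (co (x (Suc k)) - co (x k)) = 1 / n"
      using step[OF that] by (simp add: norm_co nbrs_def dist_commute)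
    then have "\<bar>Re (co (x (Suc k)) - co (x k))\<bar> \<le> 1 / n" "\<bar>Im (co (x (Suc k)) - co (x k))\<bar> \<le> 1 / n"
      using abs_Re_le_cmod[of "co (x (Suc k)) - co (x k)"] abs_Im_le_cmod[of "co (x (Suc k)) - co (x k)"]
      by linarith+
    then have "real n * \<bar>Re (co (x (Suc k)) - co (x k))\<bar> \<le> 1" "real n * \<bar>Im (co (x (Suc k)) - co (x k))\<bar> \<le> 1"
      using n(1) by (simp_all add: pos_le_divide_eq mult.commute)
    then have "\<bar>real n * Re (co (x (Suc k))) - real n * Re (co (x k))\<bar> \<le> 1"
        "\<bar>real n * Im (co (x (Suc k))) - real n * Im (co (x k))\<bar> \<le> 1"
      by (simp_all add: abs_mult flip: right_diff_distrib)
    then have "\<bar>real_of_int (s (x (Suc k)) - s (x k))\<bar> \<le> 1" "\<bar>real_of_int (t (x (Suc k)) - t (x k))\<bar> \<le> 1"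
      using st[OF x[of "Suc k"]] st[OF x[of k]] that by simp_all
    then show "\<bar>s (x (Suc k)) - s (x k)\<bar> \<le> 1" "\<bar>t (x (Suc k)) - t (x k)\<bar> \<le> 1" by linarith+
  qed
  \<comment> \<open>Only the part before the first exit from the square of half-side
    \<open>L\<close> about \<open>p\<close> is used. It stays within 2 L < r of \<open>p\<close>,
    where the direction \<open>d\<close> is valid. An exit does occur, since the path ends at
    distance at least 4 L from \<open>p\<close>.\<close>
  define out where "out k \<longleftrightarrow> n * L < \<bar>s (x k)\<bar> \<or> n * L < \<bar>t (x k)\<bar>" for k
  have "out T"
  proof (rule ccontr)
    assume "\<not> out T"
    then have "real n * \<bar>Re (co (x T))\<bar> \<le> n * L" "real n * \<bar>Im (co (x T))\<bar> \<le> n * L"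
      using st[OF x[of T]] by (auto simp: out_def abs_mult)
    then have "\<bar>Re (co (x T))\<bar> \<le> L" "\<bar>Im (co (x T))\<bar> \<le> L" using n(1) by auto
    then have "cmod (co (x T) - co p) \<le> 2 * L" using cmod_le[of "co (x T)"] by (simp add: co_p)
    then show False using far L unfolding norm_co by (simp add: p_def dist_commute)
  qed
  define T0 where "T0 = (LEAST k. out k)"
  have T0: "out T0" "T0 \<le> T" unfolding T0_def using \<open>out T\<close> by (auto intro: LeastI Least_le)
  have inside: "\<not> out k" if "k < T0" for k using that not_less_Least unfolding T0_def by blast
  have "s p = 0" "t p = 0" by (simp_all add: s_def t_def co_p)
  then have "\<not> out 0" using n L(1) by (simp add: out_def p_def[symmetric])
  then have T0_pos: "T0 > 0" using T0(1) by (cases T0) auto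
  have in_ball: "x k \<in> ball p r" if "k < T0" for k
  proof -
    have "real n * \<bar>Re (co (x k))\<bar> \<le> n * L" "real n * \<bar>Im (co (x k))\<bar> \<le> n * L"
      using st[OF x[of k]] inside[OF that] T0(2) that by (auto simp: out_def abs_mult)
    then have "\<bar>Re (co (x k))\<bar> \<le> L" "\<bar>Im (co (x k))\<bar> \<le> L" using n(1) by auto
    then have "cmod (co (x k) - co p) \<le> 2 * L" using cmod_le[of "co (x k)"] by (simp add: co_p)
    then show ?thesis using L unfolding norm_co by (simp add: dist_commute)
  qed
  have xU: "x k \<in> U" if "k < T0" for k using x[of k] that T0(2) by (auto simp: grid_def)
  have lip0: "\<bar>s (x (Suc k)) - s (x k)\<bar> \<le> 1" "\<bar>t (x (Suc k)) - t (x k)\<bar> \<le> 1" if "Suc k < T0" for k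
    using lip[of k] that T0(2) by auto
  \<comment> \<open>One path vertex is kept for each attained level, which makes the rays disjoint
    later.\<close>
  have select: "\<exists>Q\<subseteq>x ` {..<T0}. inj_on f Q \<and> f ` Q = J \<and> card Q = card J" if "\<And>c. c \<in> J \<Longrightarrow> \<exists>k<T0. f (x k) = c"
    for f :: "complex \<Rightarrow> int" and J
  proof -
    have "J \<subseteq> f ` x ` {..<T0}" using that by force
    then obtain Q where "Q \<subseteq> x ` {..<T0}" "inj_on f Q" "J = f ` Q" using subset_image_inj by metis
    then show ?thesis using card_image by metis
  qed
  have sub: "x ` {..<T0} \<subseteq> x ` {..T}" using T0(2) by auto
  show ?thesis
  proof (cases "\<exists>k<T0. n * L / 64 \<le> \<bar>t (x k)\<bar>")
    case True
    then obtain k where k: "k < T0" "n * L / 64 \<le> \<bar>t (x k)\<bar>" by blast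
    define J where "J = (if 0 \<le> t (x k) then {0..t (x k)} else {t (x k)..0})"
    have cJ: "n * L / 64 \<le> card J" using k(2) by (auto simp: J_def)
    have t0: "t (x 0) = 0" using \<open>t p = 0\<close> by (simp add: p_def)
    have "\<exists>j<T0. t (x j) = c" if "c \<in> J" for c
      using that intermediate_level[of T0 "\<lambda>k. t (x k)" 0 k c] intermediate_level[of T0 "\<lambda>k. t (x k)" k 0 c]
        lip0(2) k(1) T0_pos t0 by (auto simp: J_def split: if_splits)
    then obtain Q where Q: "Q \<subseteq> x ` {..<T0}" "inj_on t Q" "card Q = card J" using select[of J t] by blast
    \<comment> \<open>Rays along the cone axis may have the full length \<open>r\<close>.\<close>
    define m where "m = nat \<lfloor>r * real n\<rfloor>"
    have m: "real m \<le> r * real n" "r * real n / 2 \<le> m" using nLr n(2) unfolding m_def by linarith+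
    have "closed_segment q (ray n d q m) \<subseteq> U" if "q \<in> Q" for q
    proof (rule closed_segment_ray_subset[OF n(1)])
      fix u assume u: "0 \<le> u" "u \<le> real m / real n"
      have "real m / real n \<le> r" using m(1) n(1) by (simp add: field_simps)
      then have "q + d * Complex u 0 \<in> U" using that Q(1) xU in_ball u by (intro cone) auto
      then show "q + of_real u * d \<in> U" by (simp add: complex_of_real_def mult.commute)
    qed
    moreover have "inj_on (\<lambda>(q, k). ray n d q k) (Q \<times> {..<m})"
      by (rule inj_on_rays[OF n(1) d Q(2)]) (simp add: t_def ray1)
    moreover have "L\<^sup>2 / 8192 * (real n)\<^sup>2 \<le> real (card Q) * real m"
    proof -
      have "L\<^sup>2 / 8192 * (real n)\<^sup>2 \<le> (n * L / 64) * (n * L / 2)"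
        using L(1) by (simp add: power2_eq_square)
      also have "\<dots> \<le> (n * L / 64) * (r * n / 2)" using L nLr n(2) by (intro mult_left_mono) auto
      also have "\<dots> \<le> real (card Q) * real m" using cJ Q(3) m L by (intro mult_mono) auto
      finally show ?thesis .
    qed
    ultimately show ?thesis using d Q(1) sub m(1) by (intro bexI[of _ d] exI[of _ Q] exI[of _ m]) auto
  next
    case False
    then have narrow: "\<bar>real_of_int (t (x k))\<bar> < n * L / 64" if "k < T0" for k using that by fastforce
    define T1 where "T1 = T0 - 1"
    have T1: "T1 < T0" "Suc T1 = T0" "T1 < T" using T0_pos T0(2) by (auto simp: T1_def)
    \<comment> \<open>The exit step adds at most 1 to the transversal bound n L / 64, so the path
      must leave the square in the direction of \<open>s\<close>.\<close>
    have "\<bar>real_of_int (t (x T0))\<bar> \<le> n * L"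
      using narrow[OF T1(1)] lip(2)[OF T1(3)] n(2) unfolding T1(2) by linarith
    then have "n * L < \<bar>s (x T0)\<bar>" using T0(1) by (simp add: out_def)
    then have s1: "n * L - 1 \<le> \<bar>s (x T1)\<bar>" using lip(1)[OF T1(3)] unfolding T1(2) by linarith
    obtain k0 where k0: "k0 < T0" "\<And>k. k < T0 \<Longrightarrow> s (x k0) \<le> s (x k)"
      using ex_min_if_finite[of "(\<lambda>k. s (x k)) ` {..<T0}"] T0_pos
      by (metis (no_types, lifting) arg_min_least finite_lessThan lessThan_iff emptyE arg_min_if_finite(1))
    have s0: "s (x 0) = 0" using \<open>s p = 0\<close> by (simp add: p_def)
    \<comment> \<open>If the path leaves upwards, the vertex before the exit is high above the
      lowest one; if it leaves downwards, the starting vertex is.\<close>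
    obtain k1 where k1: "k1 < T0" "n * L - 1 \<le> s (x k1) - s (x k0)"
      using that[of 0] that[of T1] k0(2)[of 0] k0(2)[of T1] s0 s1 T1(1) T0_pos by linarith
    \<comment> \<open>Heights between n L / 2 and 3 n L / 4 above the lowest vertex: high enough for
      its cone to be wide, below n L - 1 and hence attained, and at least n L / 4 - 1 \<ge> n L / 8
      in number.\<close>
    define J where "J = {s (x k0) + \<lceil>n * L / 2\<rceil> .. s (x k0) + \<lfloor>3 * n * L / 4\<rfloor>}"
    have cJ: "n * L / 8 \<le> card J" using n(2) unfolding J_def by simp linarith
    have "\<exists>j<T0. s (x j) = c" if c: "c \<in> J" for c
    proof (rule intermediate_level[of T0 "\<lambda>k. s (x k)" k0 k1])
      show "s (x k0) \<le> c" using c n(2) by (simp add: J_def) linarith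
      show "c \<le> s (x k1)" using c k1(2) n(2) by (simp add: J_def) linarith
    qed (use lip0(1) k0(1) k1(1) in auto)
    then obtain Q where Q: "Q \<subseteq> x ` {..<T0}" "inj_on s Q" "s ` Q = J" "card Q = card J" using select[of J s] by blast
    \<comment> \<open>With rays of length at most L/32 the transversal offset from the lowest vertex
      is at most L/64 + L/32 + L/64 = L/16, the half-width of its cone at height L/2.\<close>
    define m where "m = nat \<lfloor>n * L / 32\<rfloor>"
    have m: "real m \<le> n * L / 32" "n * L / 64 \<le> m" using n(2) by (simp_all add: m_def) linarith+
    have "closed_segment q (ray n (\<i> * d) q m) \<subseteq> U" if q: "q \<in> Q" for q
    proof (rule closed_segment_ray_subset[OF n(1)])
      fix u assume u: "0 \<le> u" "u \<le> real m / real n"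
      have "real m / real n \<le> L / 32" using m(1) n(1) by (simp add: pos_divide_le_eq mult.commute)
      then have u2: "u \<le> L / 32" using u(2) by (rule order_trans[rotated])
      obtain k where k: "k < T0" "q = x k" using q Q(1) by auto
      have "s q \<in> J" using q Q(3) by blast
      then have "n * L / 2 \<le> s q - s (x k0)" "s q - s (x k0) \<le> n * L"
        using n(2) by (simp_all add: J_def) linarith+
      moreover have "real_of_int (s q) - s (x k0) = n * (Re (co q) - Re (co (x k0)))"
        using st(1)[of q] st(1)[of "x k0"] x k k0(1) T0(2) by (simp add: right_diff_distrib)
      ultimately have "n * (L / 2) \<le> n * (Re (co q) - Re (co (x k0)))" "n * (Re (co q) - Re (co (x k0))) \<le> n * L"
        by simp_all
      then have Re: "L / 2 \<le> Re (co q) - Re (co (x k0))" "Re (co q) - Re (co (x k0)) \<le> L"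
        using n(1) by (simp_all only: mult_le_cancel_left_pos of_nat_0_less_iff)
      have "\<bar>n * Im (co q)\<bar> < n * (L / 64)" "\<bar>n * Im (co (x k0))\<bar> < n * (L / 64)"
        using narrow[OF k(1)] narrow[OF k0(1)] st(2)[of q] st(2)[of "x k0"] x k k0(1) T0(2) by simp_all
      then have Im: "\<bar>Im (co q)\<bar> < L / 64" "\<bar>Im (co (x k0))\<bar> < L / 64"
        using n(1) by (simp_all only: abs_mult abs_of_nat mult_less_cancel_left_pos of_nat_0_less_iff)
      have "x k0 + d * Complex (Re (co q) - Re (co (x k0))) (Im (co q) + u - Im (co (x k0))) \<in> U"
      proof (intro cone xU in_ball k0(1))
        show "\<bar>Im (co q) + u - Im (co (x k0))\<bar> \<le> (Re (co q) - Re (co (x k0))) / 8"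
        proof -
          have "\<bar>Im (co q) + u - Im (co (x k0))\<bar> \<le> \<bar>Im (co q)\<bar> + u + \<bar>Im (co (x k0))\<bar>"
            using u(1) by linarith
          also have "\<dots> \<le> L / 16" using Im u2 by linarith
          also have "\<dots> \<le> (Re (co q) - Re (co (x k0))) / 8" using Re(1) by (simp add: field_simps)
          finally show ?thesis .
        qed
      qed (use Re L in auto)
      also have "x k0 + d * Complex (Re (co q) - Re (co (x k0))) (Im (co q) + u - Im (co (x k0))) = q + of_real u * (\<i> * d)"
      proof -
        have "Complex (Re (co q) - Re (co (x k0))) (Im (co q) + u - Im (co (x k0))) = co q - co (x k0) + \<i> * of_real u"
          by (simp add: complex_eq_iff)
        moreover have "d * (co q - co (x k0)) = q - x k0"
          by (simp add: right_diff_distrib d_co)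
        ultimately show ?thesis by (simp add: distrib_left mult_ac)
      qed
      finally show "q + of_real u * (\<i> * d) \<in> U" .
    qed
    moreover have "inj_on (\<lambda>(q, k). ray n (\<i> * d) q k) (Q \<times> {..<m})"
      by (rule inj_on_rays[OF n(1) id Q(2)]) (simp add: s_def ray2)
    moreover have "L\<^sup>2 / 8192 * (real n)\<^sup>2 \<le> real (card Q) * real m"
    proof -
      have "L\<^sup>2 / 8192 * (real n)\<^sup>2 \<le> (n * L / 8) * (n * L / 64)"
        using L(1) by (simp add: power2_eq_square)
      also have "\<dots> \<le> real (card Q) * real m" using cJ Q(4) m L by (intro mult_mono) auto
      finally show ?thesis .
    qed
    moreover have "real m \<le> r * n"
      using m(1) nLr n(2) by linarith
    ultimately show ?thesis using id Q(1) sub by (intro bexI[of _ "\<i> * d"] exI[of _ Q] exI[of _ m]) auto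
  qed
qed

lemma path_capacity:
  assumes "bounded U" "open U" "connected U" "axis_cone U r" "a > 0" "\<rho> > 0"
  obtains \<kappa> N where "\<kappa> > 0"
    "\<And>n (g::complex \<Rightarrow> real) A x T. \<lbrakk>n \<ge> N; n > 0; A \<subseteq> grid U n; a * (real n)\<^sup>2 \<le> card A;
      \<And>y. y \<in> A \<Longrightarrow> g y = 0; x 0 \<in> grid U n; \<And>k. k < T \<Longrightarrow> x (Suc k) \<in> nbrs U n (x k);
      \<And>k. k \<le> T \<Longrightarrow> g (x k) = 1; \<rho> \<le> dist (x 0) (x T)\<rbrakk> \<Longrightarrow> \<kappa> \<le> energy U n g"
proof -
  have r: "r > 0" using assms(4) by (simp add: axis_cone_def)
  define L where "L = min r \<rho> / 4"
  have L: "L > 0" using r assms(6) by (simp add: L_def)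
  then have "0 < L\<^sup>2 / 8192" by simp
  then obtain \<kappa> N where \<kappa>: "\<kappa> > 0" and cap:
    "\<And>n (g::complex \<Rightarrow> real) A Q d m. \<lbrakk>n \<ge> N; n > 0; A \<subseteq> grid U n; a * (real n)\<^sup>2 \<le> card A;
      \<And>y. y \<in> A \<Longrightarrow> g y = 0; d \<in> axes; Q \<subseteq> grid U n; \<And>q. q \<in> Q \<Longrightarrow> g q = 1;
      \<And>q. q \<in> Q \<Longrightarrow> closed_segment q (ray n d q m) \<subseteq> U;
      inj_on (\<lambda>(q, k). ray n d q k) (Q \<times> {..<m});
      L\<^sup>2 / 8192 * (real n)\<^sup>2 \<le> real (card Q) * real m; real m \<le> r * real n\<rbrakk> \<Longrightarrow> \<kappa> \<le> energy U n g"
    using capacity_of_disjoint_rays[OF assms(1) discrete_poincare[OF assms(1-4)] assms(5) _ r, of "L\<^sup>2 / 8192"]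
    by metis
  obtain M :: nat where M: "M \<ge> 64 / L" using real_arch_simple by blast
  show ?thesis
  proof (rule that[OF \<kappa>, of "max N M"])
    fix n and g :: "complex \<Rightarrow> real" and A x T
    assume n: "n \<ge> max N M" "n > 0" and A: "A \<subseteq> grid U n" "a * (real n)\<^sup>2 \<le> card A" "\<And>y. y \<in> A \<Longrightarrow> g y = 0"
      and x0: "x 0 \<in> grid U n" and step: "\<And>k. k < T \<Longrightarrow> x (Suc k) \<in> nbrs U n (x k)"
      and g1: "\<And>k. k \<le> T \<Longrightarrow> g (x k) = 1" and far: "\<rho> \<le> dist (x 0) (x T)"
    have "64 / L \<le> real n" using M n by linarith
    then have nL: "64 \<le> real n * L" using L by (simp add: field_simps)
    obtain d Q m where d: "d \<in> axes" and Q: "Q \<subseteq> x ` {..T}" "\<And>q. q \<in> Q \<Longrightarrow> closed_segment q (ray n d q m) \<subseteq> U"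
      "inj_on (\<lambda>(q, k). ray n d q k) (Q \<times> {..<m})" "L\<^sup>2 / 8192 * (real n)\<^sup>2 \<le> real (card Q) * real m"
      "real m \<le> r * real n"
      using long_path_rays[OF assms(4,6) n(2) nL[unfolded L_def] x0 step far] unfolding L_def[symmetric] by blast
    have "x k \<in> grid U n" if "k \<le> T" for k
    proof (cases k)
      case (Suc j)
      then show ?thesis using step[of j] that nbrs_subset_grid by auto
    qed (use x0 in simp)
    then have "Q \<subseteq> grid U n" using Q(1) by auto
    moreover have "g q = 1" if "q \<in> Q" for q using that Q(1) g1 by auto
    ultimately show "\<kappa> \<le> energy U n g"
      using n by (intro cap[OF _ n(2) A d _ _ Q(2-5)]) auto
  qed
qed

text \<open>Takes the place of connectedness of the graph. The indicator of a union of components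
  has energy 0. But the cone at any of its vertices contains an axis ray of length about
  \<open>r\<close>, a macroscopic path inside the component, so with \<open>A\<close> elsewhere the
  energy would be bounded below.\<close>

lemma closed_set_meets_large_set:
  assumes "bounded U" "open U" "connected U" "axis_cone U r" "a > 0"
  obtains N where "\<And>n A M. \<lbrakk>n \<ge> N; n > 0; A \<subseteq> grid U n; a * (real n)\<^sup>2 \<le> card A;
      M \<subseteq> grid U n; M \<noteq> {}; \<And>z. z \<in> M \<Longrightarrow> nbrs U n z \<subseteq> M\<rbrakk> \<Longrightarrow> M \<inter> A \<noteq> {}"
proof -
  have r: "r > 0" using assms(4) by (simp add: axis_cone_def)
  then have "r / 2 > 0" by simp
  then obtain \<kappa> N where \<kappa>: "\<kappa> > 0" and cap:
    "\<And>n (g::complex \<Rightarrow> real) A x T. \<lbrakk>n \<ge> N; n > 0; A \<subseteq> grid U n; a * (real n)\<^sup>2 \<le> card A;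
      \<And>y. y \<in> A \<Longrightarrow> g y = 0; x 0 \<in> grid U n; \<And>k. k < T \<Longrightarrow> x (Suc k) \<in> nbrs U n (x k);
      \<And>k. k \<le> T \<Longrightarrow> g (x k) = 1; r / 2 \<le> dist (x 0) (x T)\<rbrakk> \<Longrightarrow> \<kappa> \<le> energy U n g"
    using path_capacity[OF assms] by metis
  obtain M0 :: nat where M0: "M0 \<ge> 2 / r" using real_arch_simple by blast
  show ?thesis
  proof (rule that[of "max N M0"], rule notI)
    fix n A M
    assume n: "n \<ge> max N M0" "n > 0" and A: "A \<subseteq> grid U n" "a * (real n)\<^sup>2 \<le> card A"
      and M: "M \<subseteq> grid U n" "M \<noteq> {}" and closed: "\<And>z. z \<in> M \<Longrightarrow> nbrs U n z \<subseteq> M" and disj: "M \<inter> A = {}"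
    have "2 / r \<le> real n" using M0 n by linarith
    then have nr: "2 \<le> r * real n" using r by (simp add: field_simps)
    obtain q where q: "q \<in> M" using M by blast
    then have qG: "q \<in> U" "q \<in> scaled_lattice n" "q \<in> grid U n" using M by (auto simp: grid_def)
    obtain d where d: "d \<in> axes" and cone: "\<And>s u. 0 \<le> s \<Longrightarrow> s \<le> r \<Longrightarrow> \<bar>u\<bar> \<le> s / 8 \<Longrightarrow> q + d * Complex s u \<in> U"
      using assms(4) qG(1) r unfolding axis_cone_def cone_at_def by (metis IntI centre_in_ball)
    define m where "m = nat \<lfloor>r * real n\<rfloor>"
    have m: "real m \<le> r * real n" "r * real n / 2 \<le> m" using nr unfolding m_def by linarith+
    have seg: "closed_segment q (ray n d q m) \<subseteq> U"
    proof (rule closed_segment_ray_subset[OF n(2)])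
      fix u assume u: "0 \<le> u" "u \<le> real m / real n"
      have "real m / real n \<le> r" using m(1) n(2) by (simp add: field_simps)
      then have "q + d * Complex u 0 \<in> U" using u by (intro cone) auto
      then show "q + of_real u * d \<in> U" by (simp add: complex_of_real_def mult.commute)
    qed
    have nb: "ray n d q (Suc k) \<in> nbrs U n (ray n d q k)" if "k < m" for k
      by (rule ray_step(2)[OF n(2) d qG(2) that seg])
    have inM: "ray n d q k \<in> M" if "k \<le> m" for k
      using that
    proof (induction k)
      case (Suc k)
      then show ?case using closed[of "ray n d q k"] nb[of k] by auto
    qed (use q in simp)
    define g :: "complex \<Rightarrow> real" where "g z = (if z \<in> M then 1 else 0)" for z
    have "energy U n g = 0"
      unfolding energy_def
    proof (rule sum.neutral, rule ballI, rule sum.neutral, rule ballI)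
      fix z w assume "z \<in> grid U n" "w \<in> nbrs U n z"
      then have "w \<in> M \<longleftrightarrow> z \<in> M" using closed nbrs_sym by blast
      then show "(g w - g z)\<^sup>2 = 0" by (simp add: g_def)
    qed
    moreover have "\<kappa> \<le> energy U n g"
    proof (rule cap[OF _ n(2) A, of g "ray n d q" m])
      show "g y = 0" if "y \<in> A" for y using that disj by (auto simp: g_def)
      have "dist q (ray n d q m) = real m / real n"
        using norm_axis[OF d] by (simp add: ray_def dist_norm norm_mult norm_divide)
      moreover have "r / 2 \<le> real m / real n" using m(2) n(2) by (simp add: field_simps)
      ultimately show "r / 2 \<le> dist (ray n d q 0) (ray n d q m)" by simp
    qed (use n nb inM qG in \<open>auto simp: g_def\<close>)
    ultimately show False using \<kappa> by simp
  qed
qed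

text \<open>\<open>Z\<close> collects the vertices reachable through values at least
  \<open>h z\<close>. If \<open>Z\<close> missed \<open>B\<close>, the set where \<open>h\<close> is
  maximal on \<open>Z\<close> would be closed under neighbours, hence would meet \<open>A\<close>,
  where \<open>h\<close> is 0.\<close>

lemma max_principle_path:
  fixes h :: "complex \<Rightarrow> real"
  assumes fin: "bounded U" "n > 0" and z: "z \<in> grid U n" "0 < h z"
    and harm: "\<And>w. w \<in> grid U n \<Longrightarrow> w \<notin> A \<Longrightarrow> w \<notin> B \<Longrightarrow> (\<Sum>v\<in>nbrs U n w. h v - h w) = 0"
    and zero: "\<And>w. w \<in> A \<Longrightarrow> w \<notin> B \<Longrightarrow> h w = 0"
    and closed: "\<And>M. M \<subseteq> grid U n \<Longrightarrow> M \<noteq> {} \<Longrightarrow> (\<And>w. w \<in> M \<Longrightarrow> nbrs U n w \<subseteq> M) \<Longrightarrow> M \<inter> A \<noteq> {}"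
  obtains x T where "x 0 = z" "x T \<in> B" "\<And>k. k < T \<Longrightarrow> x (Suc k) \<in> nbrs U n (x k)"
    "\<And>k. k \<le> T \<Longrightarrow> h z \<le> h (x k)"
proof -
  define R where "R = {(u, v). v \<in> nbrs U n u \<and> h z \<le> h v}"
  define Z where "Z = {w. (z, w) \<in> R\<^sup>*}"
  have Z: "w \<in> grid U n \<and> h z \<le> h w" if "w \<in> Z" for w
    using that z(1) nbrs_subset_grid unfolding Z_def mem_Collect_eq
    by (induction rule: rtrancl_induct) (auto simp: R_def)
  have zZ: "z \<in> Z" by (simp add: Z_def)
  have "Z \<inter> B \<noteq> {}"
  proof
    assume ZB: "Z \<inter> B = {}"
    have finZ: "finite Z" using Z finite_grid[OF fin] by (intro finite_subset[of Z "grid U n"]) auto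
    define \<mu> where "\<mu> = Max (h ` Z)"
    have le: "h w \<le> \<mu>" if "w \<in> Z" for w using finZ that by (simp add: \<mu>_def)
    have "\<mu> \<in> h ` Z" unfolding \<mu>_def using finZ zZ by (intro Max_in) auto
    define M where "M = {w \<in> Z. h w = \<mu>}"
    have ne: "M \<noteq> {}" using \<open>\<mu> \<in> h ` Z\<close> by (auto simp: M_def)
    have \<mu>: "h z \<le> \<mu>" "0 < \<mu>" using le[OF zZ] z(2) by linarith+
    have noA: "w \<notin> A" if "w \<in> M" for w
      using that zero[of w] ZB \<mu> by (auto simp: M_def)
    have "nbrs U n w \<subseteq> M" if w: "w \<in> M" for w
    proof -
      have wZ: "w \<in> Z" "h w = \<mu>" using w by (auto simp: M_def)
      have "(\<Sum>v\<in>nbrs U n w. h v - h w) = 0"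
        using Z[OF wZ(1)] noA[OF w] wZ(1) ZB by (intro harm) auto
      then have "(\<Sum>v\<in>nbrs U n w. h w - h v) = 0" by (simp add: sum_subtractf)
      moreover have inZ: "v \<in> Z" if "v \<in> nbrs U n w" "h z \<le> h v" for v
        using wZ(1) that unfolding Z_def by (auto simp: R_def intro: rtrancl_into_rtrancl)
      \<comment> \<open>A neighbour outside \<open>Z\<close> has a value below \<open>h z\<close>,
        hence below the maximum.\<close>
      have "0 \<le> h w - h v" if "v \<in> nbrs U n w" for v
        using inZ[OF that] le[of v] wZ(2) \<mu>(1) by (cases "h z \<le> h v") auto
      ultimately have "\<forall>v\<in>nbrs U n w. h w - h v = 0"
        by (subst (asm) sum_nonneg_eq_0_iff[OF finite_nbrs[OF fin]]) auto
      then show ?thesis using inZ wZ(2) \<mu>(1) by (auto simp: M_def)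
    qed
    then have "M \<inter> A \<noteq> {}" using ne Z by (intro closed) (auto simp: M_def)
    then show False using noA by blast
  qed
  then obtain b where b: "b \<in> B" "(z, b) \<in> R\<^sup>*" by (auto simp: Z_def)
  then obtain T where "(z, b) \<in> R ^^ T" using rtrancl_imp_relpow by blast
  then obtain x where x: "x 0 = z" "x T = b" "\<And>i. i < T \<Longrightarrow> (x i, x (Suc i)) \<in> R"
    unfolding relpow_fun_conv by blast
  have "h z \<le> h (x k)" if "k \<le> T" for k
  proof (cases k)
    case (Suc j)
    then show ?thesis using x(3)[of j] that by (simp add: R_def)
  qed (simp add: x(1))
  then show ?thesis using that[of x T] x b(1) by (auto simp: R_def)
qed

section \<open>A logarithmic cutoff function\<close>

definition cutoff :: "complex \<Rightarrow> real \<Rightarrow> complex \<Rightarrow> real" where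
  "cutoff c R z = max 0 (min 1 (2 - dist c z / R))"

lemma cutoff_eq_1: "R > 0 \<Longrightarrow> dist c z \<le> R \<Longrightarrow> cutoff c R z = 1"
  by (simp add: cutoff_def min_def field_simps)

lemma cutoff_eq_0: "R > 0 \<Longrightarrow> 2 * R \<le> dist c z \<Longrightarrow> cutoff c R z = 0"
  by (simp add: cutoff_def min_def max_def field_simps)

lemma cutoff_lipschitz:
  assumes "R > 0"
  shows "\<bar>cutoff c R w - cutoff c R z\<bar> \<le> dist z w / R"
proof -
  have "\<bar>cutoff c R w - cutoff c R z\<bar> \<le> \<bar>dist c w / R - dist c z / R\<bar>"
    by (simp add: cutoff_def min_def max_def abs_if)
  also have "\<dots> = \<bar>dist c w - dist c z\<bar> / R"
    using assms by (simp add: diff_divide_distrib[symmetric])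
  also have "\<dots> \<le> dist z w / R"
    using assms dist_triangle[of c w z] dist_triangle[of c z w]
    by (intro divide_right_mono) (auto simp: abs_le_iff dist_commute)
  finally show ?thesis .
qed

text \<open>Locates the edges that carry energy. The annulus is widened by one edge length because
  an edge may cross its rim.\<close>

lemma cutoff_edge:
  assumes "R > 0" "cutoff c R w \<noteq> cutoff c R z" "dist z w = \<delta>"
  shows "R - \<delta> < dist c z" "dist c z < 2 * R + \<delta>"
proof -
  have "dist c w \<le> dist c z + \<delta>" "dist c z \<le> dist c w + \<delta>"
    using assms(3) dist_triangle[of c w z] dist_triangle[of c z w] by (auto simp: dist_commute)
  moreover have "\<delta> \<ge> 0" using assms(3) by auto
  ultimately show "R - \<delta> < dist c z" "dist c z < 2 * R + \<delta>"
    using cutoff_eq_1[OF assms(1), of c w] cutoff_eq_1[OF assms(1), of c z]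
      cutoff_eq_0[OF assms(1), of c w] cutoff_eq_0[OF assms(1), of c z] assms(2)
    by (force, force)
qed

text \<open>Scale invariance: of order (n R)^2 vertices carry edges with squared differences at most
  1 / (n R)^2. The constant is 9 * 3^2 * 4: lattice points in the ball of radius 3 R, times four
  neighbours.\<close>

lemma energy_cutoff_le:
  fixes R :: real
  assumes "bounded U" "n > 0" "R > 0" "1 \<le> n * R"
  shows "energy U n (cutoff c R) \<le> 324"
proof -
  let ?X = "grid_on U (ball c (3 * R)) n"
  have fin: "finite (grid U n)" using finite_grid[OF assms(1,2)] .
  have n: "1 / real n \<le> R" using assms by (simp add: field_simps)
  have inner: "(\<Sum>w\<in>nbrs U n z. (cutoff c R w - cutoff c R z)\<^sup>2) \<le> 4 * (1 / (n * R))\<^sup>2" if z: "z \<in> grid U n" for z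
  proof -
    have "(\<Sum>w\<in>nbrs U n z. (cutoff c R w - cutoff c R z)\<^sup>2) \<le> (\<Sum>w\<in>nbrs U n z. (1 / (n * R))\<^sup>2)"
    proof (rule sum_mono)
      fix w assume "w \<in> nbrs U n z"
      then have "\<bar>cutoff c R w - cutoff c R z\<bar> \<le> 1 / (n * R)"
        using cutoff_lipschitz[OF assms(3), of c w z] by (simp add: nbrs_def)
      then show "(cutoff c R w - cutoff c R z)\<^sup>2 \<le> (1 / (n * R))\<^sup>2"
        using power_mono[of "\<bar>cutoff c R w - cutoff c R z\<bar>" "1 / (n * R)" 2] by simp
    qed
    also have "\<dots> = card (nbrs U n z) * (1 / (n * R))\<^sup>2" by simp
    also have "\<dots> \<le> 4 * (1 / (n * R))\<^sup>2"
      using card_nbrs_le[OF assms(2), of z U] z by (intro mult_right_mono) (auto simp: grid_def)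
    finally show ?thesis .
  qed
  have "energy U n (cutoff c R) = (\<Sum>z\<in>?X. \<Sum>w\<in>nbrs U n z. (cutoff c R w - cutoff c R z)\<^sup>2)"
    unfolding energy_def
  proof (rule sum.mono_neutral_right[OF fin])
    show "\<forall>z\<in>grid U n - ?X. (\<Sum>w\<in>nbrs U n z. (cutoff c R w - cutoff c R z)\<^sup>2) = 0"
    proof (rule ballI, rule sum.neutral, rule ballI)
      fix z w assume z: "z \<in> grid U n - ?X" and w: "w \<in> nbrs U n z"
      then have "3 * R \<le> dist c z" "dist z w = 1 / n" by (auto simp: nbrs_def)
      then show "(cutoff c R w - cutoff c R z)\<^sup>2 = 0"
        using cutoff_edge(2)[OF assms(3), of c w z "1 / n"] n by fastforce
    qed
  qed auto
  also have "\<dots> \<le> (\<Sum>z\<in>?X. 4 * (1 / (n * R))\<^sup>2)" by (intro sum_mono inner) auto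
  also have "\<dots> = card ?X * (4 * (1 / (n * R))\<^sup>2)" by simp
  also have "\<dots> \<le> (9 * (3 * R)\<^sup>2 * (real n)\<^sup>2) * (4 * (1 / (n * R))\<^sup>2)"
  proof (rule mult_right_mono)
    have "card ?X \<le> card (scaled_lattice n \<inter> ball c (3 * R))"
      by (intro card_mono finite_lattice_ball assms) (auto simp: grid_def)
    also have "real \<dots> \<le> 9 * (3 * R)\<^sup>2 * (real n)\<^sup>2"
    proof (rule card_lattice_ball_le[OF assms(2)])
      have "3 * R * n = 3 * (n * R)" by simp
      then show "1 \<le> 3 * R * n" using assms(4) by linarith
    qed (use assms(3) in simp)
    finally show "real (card ?X) \<le> 9 * (3 * R)\<^sup>2 * (real n)\<^sup>2" by simp
  qed auto
  also have "\<dots> = 324" using assms by (simp add: power2_eq_square field_simps)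
  finally show ?thesis .
qed

lemma sum_square_disjoint:
  fixes a :: "'i \<Rightarrow> real"
  assumes "finite I" "\<And>i j. i \<in> I \<Longrightarrow> j \<in> I \<Longrightarrow> i \<noteq> j \<Longrightarrow> a i * a j = 0"
  shows "(\<Sum>i\<in>I. a i)\<^sup>2 = (\<Sum>i\<in>I. (a i)\<^sup>2)"
proof -
  have "(\<Sum>i\<in>I. a i)\<^sup>2 = (\<Sum>i\<in>I. \<Sum>j\<in>I. a i * a j)"
    by (simp add: power2_eq_square sum_product)
  also have "\<dots> = (\<Sum>i\<in>I. \<Sum>j\<in>I. if i = j then a i * a j else 0)"
    using assms(2) by (intro sum.cong) auto
  also have "\<dots> = (\<Sum>i\<in>I. (a i)\<^sup>2)" using assms(1) by (simp add: power2_eq_square)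
  finally show ?thesis .
qed

text \<open>The \<open>K\<close> cutoffs live on disjoint annuli, each has energy at most 324, and they are averaged.\<close>

lemma small_energy_cutoff:
  assumes "bounded U" "R > 0" "K > 0"
  obtains \<epsilon> N where "0 < \<epsilon>" "\<epsilon> \<le> R"
    "\<And>n. n \<ge> N \<Longrightarrow> n > 0 \<Longrightarrow> \<exists>f. (\<forall>z. dist c z \<le> \<epsilon> \<longrightarrow> f z = 1) \<and> (\<forall>z. R \<le> dist c z \<longrightarrow> f z = 0) \<and>
       energy U n f \<le> 324 / real K"
proof -
  \<comment> \<open>The ratio 1/4 separates the scales: a smaller cutoff varies only up to distance
    \<open>\<rho> k / 2 + 1 / n\<close>, the larger one only from \<open>\<rho> k - 1 / n\<close>,
    and the mesh is below \<open>\<rho> k / 4\<close>. Starting at R/2 makes all of them vanish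
    beyond \<open>R\<close>.\<close>
  define \<rho> where "\<rho> k = R / 2 * (1 / 4) ^ k" for k :: nat
  have \<rho>: "\<rho> k > 0" "\<rho> k \<le> R / 2" for k
    using assms(2) power_le_one[of "1 / 4 :: real" k] by (auto simp: \<rho>_def mult_left_le)
  have \<rho>_mono: "\<rho> l \<le> \<rho> k" if "k \<le> l" for k l
    using that assms(2) by (auto simp: \<rho>_def intro!: mult_left_mono power_decreasing)
  have \<rho>_Suc: "\<rho> l \<le> \<rho> k / 4" if "k < l" for k l
    using \<rho>_mono[of "Suc k" l] that by (simp add: \<rho>_def)
  obtain N :: nat where N: "N > 4 / \<rho> K" using reals_Archimedean2 by blast
  define f where "f z = (\<Sum>k<K. cutoff c (\<rho> k) z) / K" for z
  have f1: "f z = 1" if "dist c z \<le> \<rho> K" for z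
  proof -
    have "cutoff c (\<rho> k) z = 1" if "k < K" for k
      using that \<open>dist c z \<le> \<rho> K\<close> \<rho>_mono[of k K] \<rho>(1) by (intro cutoff_eq_1) auto
    then show ?thesis using assms(3) by (simp add: f_def)
  qed
  have f0: "f z = 0" if "R \<le> dist c z" for z
  proof -
    have "cutoff c (\<rho> k) z = 0" for k
      using that \<rho>[of k] by (intro cutoff_eq_0) auto
    then show ?thesis by (simp add: f_def)
  qed
  have fE: "energy U n f \<le> 324 / real K" if n: "n \<ge> N" "n > 0" for n
  proof -
    have "4 / \<rho> K < real n" using N n(1) by linarith
    then have nK: "4 < n * \<rho> K" using \<rho>(1)[of K] by (simp add: field_simps)
    have n\<rho>: "4 < n * \<rho> k" if "k < K" for k
      using nK mult_left_mono[OF \<rho>_mono[of k K], of "real n"] that by simp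
    \<comment> \<open>On each edge at most one of the cutoffs changes, so there are no cross terms:
      the average has K energies divided by K^2.\<close>
    have edge: "(f w - f z)\<^sup>2 = (\<Sum>k<K. (cutoff c (\<rho> k) w - cutoff c (\<rho> k) z)\<^sup>2) / (real K)\<^sup>2"
      if w: "w \<in> nbrs U n z" for z w
    proof -
      have dw: "dist z w = 1 / n" using w by (simp add: nbrs_def)
      have less: "(cutoff c (\<rho> k) w - cutoff c (\<rho> k) z) * (cutoff c (\<rho> l) w - cutoff c (\<rho> l) z) = 0"
        if kl: "k < l" "l < K" for k l
      proof (rule ccontr)
        assume "\<not> ?thesis"
        then have ne: "cutoff c (\<rho> k) w \<noteq> cutoff c (\<rho> k) z" "cutoff c (\<rho> l) w \<noteq> cutoff c (\<rho> l) z" by auto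
        have "\<rho> k - 1 / n < dist c z" using cutoff_edge(1)[OF \<rho>(1) ne(1) dw] .
        moreover have "dist c z < 2 * \<rho> l + 1 / n" using cutoff_edge(2)[OF \<rho>(1) ne(2) dw] .
        moreover have "1 / real n < \<rho> k / 4" using n\<rho>[of k] kl n(2) by (simp add: field_simps)
        ultimately show False using \<rho>_Suc[OF kl(1)] by linarith
      qed
      have "f w - f z = (\<Sum>k<K. cutoff c (\<rho> k) w - cutoff c (\<rho> k) z) / K"
        by (simp add: f_def sum_subtractf diff_divide_distrib)
      moreover have "(\<Sum>k<K. cutoff c (\<rho> k) w - cutoff c (\<rho> k) z)\<^sup>2 = (\<Sum>k<K. (cutoff c (\<rho> k) w - cutoff c (\<rho> k) z)\<^sup>2)"
      proof (rule sum_square_disjoint)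
        fix i j assume "i \<in> {..<K}" "j \<in> {..<K}" "i \<noteq> j"
        then show "(cutoff c (\<rho> i) w - cutoff c (\<rho> i) z) * (cutoff c (\<rho> j) w - cutoff c (\<rho> j) z) = 0"
          using less[of i j] less[of j i] by (cases i j rule: linorder_cases) (auto simp: mult.commute)
      qed simp
      ultimately show ?thesis by (simp add: power_divide)
    qed
    have "energy U n f = (\<Sum>z\<in>grid U n. \<Sum>w\<in>nbrs U n z. (\<Sum>k<K. (cutoff c (\<rho> k) w - cutoff c (\<rho> k) z)\<^sup>2) / (real K)\<^sup>2)"
      unfolding energy_def by (intro sum.cong refl edge)
    also have "\<dots> = (\<Sum>z\<in>grid U n. \<Sum>k<K. \<Sum>w\<in>nbrs U n z. (cutoff c (\<rho> k) w - cutoff c (\<rho> k) z)\<^sup>2) / (real K)\<^sup>2"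
      unfolding sum_divide_distrib[symmetric] by (intro arg_cong2[where f = "(/)"] sum.cong refl sum.swap)
    also have "\<dots> = (\<Sum>k<K. energy U n (cutoff c (\<rho> k))) / (real K)\<^sup>2"
      unfolding energy_def by (subst sum.swap) simp
    also have "\<dots> \<le> (\<Sum>k<K. 324) / (real K)\<^sup>2"
    proof (rule divide_right_mono, rule sum_mono)
      fix k assume "k \<in> {..<K}"
      then show "energy U n (cutoff c (\<rho> k)) \<le> 324"
        using n\<rho>[of k] by (intro energy_cutoff_le[OF assms(1) n(2) \<rho>(1)]) simp
    qed simp
    also have "\<dots> = 324 / K" using assms(3) by (simp add: power2_eq_square)
    finally show ?thesis .
  qed
  show ?thesis
  proof (rule that)
    show "0 < \<rho> K" "\<rho> K \<le> R" using \<rho>[of K] assms(2) by linarith+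
    show "\<exists>f. (\<forall>z. dist c z \<le> \<rho> K \<longrightarrow> f z = 1) \<and> (\<forall>z. R \<le> dist c z \<longrightarrow> f z = 0) \<and> energy U n f \<le> 324 / real K"
      if "n \<ge> N" "n > 0" for n
      using f1 f0 fE[OF that] by (intro exI[of _ f]) blast
  qed
qed

section \<open>The hitting estimate\<close>

text \<open>The vertices of a small interior ball suffice, as each has at least its right-hand
  neighbour.\<close>

lemma sum_degree_ge:
  assumes "bounded U" "open U" "U \<noteq> {}"
  obtains c N where "c > 0" "\<And>n. n \<ge> N \<Longrightarrow> n > 0 \<Longrightarrow> c * (real n)\<^sup>2 \<le> (\<Sum>z\<in>grid U n. real (degree U n z))"
proof -
  obtain p where "p \<in> U" using assms(3) by blast
  then obtain e where e: "e > 0" "ball p e \<subseteq> U" using assms(2) open_contains_ball by blast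
  obtain N :: nat where N: "N > 4 / e" using reals_Archimedean2 by blast
  show ?thesis
  proof (rule that[of "(e / 2)\<^sup>2 / 4" N])
    fix n assume n: "n \<ge> N" "n > 0"
    let ?X = "scaled_lattice n \<inter> ball p (e / 2)"
    have fin: "finite (grid U n)" using finite_grid[OF assms(1) n(2)] .
    have "4 / e < real n" using N n(1) by linarith
    then have ne: "4 < e * n" using e(1) by (simp add: field_simps)
    have X: "?X \<subseteq> grid U n" using e subset_ball[of "e / 2" e p] by (auto simp: grid_def)
    have "1 \<le> real (degree U n z)" if z: "z \<in> ?X" for z
    proof -
      have 1: "(1::complex) \<in> axes" by (simp add: axes_def)
      have "dist p (ray n 1 z 1) \<le> dist p z + 1 / n"
        using dist_triangle[of p "ray n 1 z 1" z] by (simp add: ray_def dist_norm norm_divide)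
      also have "\<dots> < e"
      proof -
        have "1 / real n < e / 4" using ne n(2) by (simp add: field_simps)
        then show ?thesis using z e(1) by simp
      qed
      finally have "closed_segment z (ray n 1 z 1) \<subseteq> ball p e"
        using z e(1) by (intro closed_segment_subset) auto
      then have "ray n 1 z (Suc 0) \<in> nbrs U n (ray n 1 z 0)"
        using z e(2) by (intro ray_step(2)[OF n(2) 1, of z 0 1]) auto
      then have "nbrs U n z \<noteq> {}" by auto
      then show ?thesis
        using finite_nbrs[OF assms(1) n(2), of z] by (simp add: degree_def Suc_le_eq card_gt_0_iff)
    qed
    then have "real (card ?X) \<le> (\<Sum>z\<in>?X. real (degree U n z))"
      using sum_mono[of ?X "\<lambda>_. 1::real" "\<lambda>z. real (degree U n z)"] by simp
    also have "\<dots> \<le> (\<Sum>z\<in>grid U n. real (degree U n z))" by (rule sum_mono2[OF fin X]) auto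
    finally show "(e / 2)\<^sup>2 / 4 * (real n)\<^sup>2 \<le> (\<Sum>z\<in>grid U n. real (degree U n z))"
      using card_lattice_ball_ge[of n "e / 2" p] n(2) e(1) ne by simp
  qed (use e in simp)
qed

text \<open>Translates stationary mass into a count of vertices, the form in which \<open>A\<close>
  enters the capacity bound: degrees are at most 4, while the total degree is at least of order
  n^2.\<close>

lemma card_ge_of_pi_RW:
  assumes "bounded U" "open U" "U \<noteq> {}" "\<alpha> > 0"
  obtains c N where "c > 0"
    "\<And>n A. n \<ge> N \<Longrightarrow> n > 0 \<Longrightarrow> A \<subseteq> grid U n \<Longrightarrow> \<alpha> \<le> pi_RW U n A \<Longrightarrow> c * (real n)\<^sup>2 \<le> card A"
proof -
  obtain c N where c: "c > 0" and deg: "\<And>n. n \<ge> N \<Longrightarrow> n > 0 \<Longrightarrow> c * (real n)\<^sup>2 \<le> (\<Sum>z\<in>grid U n. real (degree U n z))"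
    using sum_degree_ge[OF assms(1-3)] by metis
  show ?thesis
  proof (rule that[of "\<alpha> * c / 4" N])
    fix n A assume n: "n \<ge> N" "n > 0" and A: "A \<subseteq> grid U n" "\<alpha> \<le> pi_RW U n A"
    define D where "D = (\<Sum>z\<in>grid U n. real (degree U n z))"
    have "0 < c * (real n)\<^sup>2" using c n(2) by simp
    moreover have "c * (real n)\<^sup>2 \<le> D" unfolding D_def by (rule deg[OF n])
    ultimately have D: "c * (real n)\<^sup>2 \<le> D" "D > 0" by linarith+
    have "\<alpha> \<le> (\<Sum>z\<in>A. real (degree U n z)) / D"
      using A(2) by (simp add: pi_RW_def D_def sum_divide_distrib)
    then have "\<alpha> * D \<le> (\<Sum>z\<in>A. real (degree U n z))" using D(2) by (simp add: field_simps)
    also have "\<dots> \<le> (\<Sum>z\<in>A. 4)"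
      using A(1) card_nbrs_le[OF n(2), of _ U] by (intro sum_mono) (auto simp: degree_def grid_def)
    finally have "\<alpha> * D \<le> 4 * card A" by simp
    moreover have "\<alpha> * (c * (real n)\<^sup>2) \<le> \<alpha> * D" using D assms(4) by simp
    ultimately show "\<alpha> * c / 4 * (real n)\<^sup>2 \<le> card A" by simp
  qed (use c assms(4) in simp)
qed

text \<open>The truncation is Lipschitz with constant 1 / t, so it contracts every edge difference
  accordingly.\<close>

lemma energy_truncate_le:
  assumes "t > 0"
  shows "t\<^sup>2 * energy U n (\<lambda>z. min (h z / t) 1) \<le> energy U n h"
proof -
  have "t\<^sup>2 * (min (a / t) 1 - min (b / t) 1)\<^sup>2 \<le> (a - b)\<^sup>2" for a b
  proof -
    have "\<bar>min (a / t) 1 - min (b / t) 1\<bar> \<le> \<bar>a / t - b / t\<bar>" by (auto simp: min_def abs_if)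
    then have "(min (a / t) 1 - min (b / t) 1)\<^sup>2 \<le> (a / t - b / t)\<^sup>2" by (simp add: abs_le_square_iff)
    also have "\<dots> = (a - b)\<^sup>2 / t\<^sup>2" by (simp add: power_divide flip: diff_divide_distrib)
    finally show ?thesis using assms by (simp add: field_simps)
  qed
  then show ?thesis unfolding energy_def sum_distrib_left by (intro sum_mono)
qed

text \<open>The level set \<open>{h \<ge> h z}\<close> contains a path from \<open>z\<close> to the target, whose capacity relative
  to \<open>A\<close> is bounded below, whereas the Dirichlet energy of \<open>h\<close> is at most that of the cutoff.\<close>

lemma hit_prob_small:
  assumes "bounded U" "open U" "connected U" "axis_cone U r" "a > 0" "0 < R" "R \<le> 1 / 4" "\<eta> > 0"
  obtains \<epsilon>0 N where "\<epsilon>0 > 0"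
    "\<And>\<epsilon> n A z. \<lbrakk>0 < \<epsilon>; \<epsilon> \<le> \<epsilon>0; n \<ge> N; n > 0; A \<subseteq> grid U n; A \<inter> ball c R = {}; a * (real n)\<^sup>2 \<le> card A;
      z \<in> grid U n; 1 / 2 \<le> dist c z\<rbrakk> \<Longrightarrow> hit_prob U n (ball c \<epsilon> \<inter> grid U n) A z \<le> \<eta>"
proof -
  have "(1 / 4 :: real) > 0" by simp
  then obtain \<kappa> N1 where \<kappa>: "\<kappa> > 0" and cap:
    "\<And>n (g::complex \<Rightarrow> real) A x T. \<lbrakk>n \<ge> N1; n > 0; A \<subseteq> grid U n; a * (real n)\<^sup>2 \<le> card A;
      \<And>y. y \<in> A \<Longrightarrow> g y = 0; x 0 \<in> grid U n; \<And>k. k < T \<Longrightarrow> x (Suc k) \<in> nbrs U n (x k);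
      \<And>k. k \<le> T \<Longrightarrow> g (x k) = 1; 1 / 4 \<le> dist (x 0) (x T)\<rbrakk> \<Longrightarrow> \<kappa> \<le> energy U n g"
    using path_capacity[OF assms(1-5)] by metis
  obtain N2 where meets: "\<And>n A M. \<lbrakk>n \<ge> N2; n > 0; A \<subseteq> grid U n; a * (real n)\<^sup>2 \<le> card A;
      M \<subseteq> grid U n; M \<noteq> {}; \<And>z. z \<in> M \<Longrightarrow> nbrs U n z \<subseteq> M\<rbrakk> \<Longrightarrow> M \<inter> A \<noteq> {}"
    using closed_set_meets_large_set[OF assms(1-5)] by metis
  \<comment> \<open>Makes 324 / K smaller than \<kappa> \<eta>^2, the energy forced by a value of
    \<open>h\<close> above \<eta>.\<close>
  obtain K :: nat where K: "K > 324 / (\<kappa> * \<eta>\<^sup>2)" using reals_Archimedean2 by blast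
  have "0 < 324 / (\<kappa> * \<eta>\<^sup>2)" using \<kappa> assms(8) by simp
  then have K0: "K > 0" using K by (metis of_nat_0_less_iff order_less_trans)
  obtain \<epsilon>0 N3 where \<epsilon>0: "0 < \<epsilon>0" "\<epsilon>0 \<le> R" and cut:
    "\<And>n. n \<ge> N3 \<Longrightarrow> n > 0 \<Longrightarrow> \<exists>f. (\<forall>z. dist c z \<le> \<epsilon>0 \<longrightarrow> f z = 1) \<and> (\<forall>z. R \<le> dist c z \<longrightarrow> f z = 0) \<and>
       energy U n f \<le> 324 / real K"
    using small_energy_cutoff[OF assms(1,6) K0, of c] by metis
  show ?thesis
  proof (rule that[OF \<epsilon>0(1), of "max N1 (max N2 N3)"], rule ccontr)
    fix \<epsilon> n A z
    assume \<epsilon>: "0 < \<epsilon>" "\<epsilon> \<le> \<epsilon>0" and n: "n \<ge> max N1 (max N2 N3)" "n > 0" and A: "A \<subseteq> grid U n" "A \<inter> ball c R = {}"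
      "a * (real n)\<^sup>2 \<le> card A" and z: "z \<in> grid U n" "1 / 2 \<le> dist c z"
    define B where "B = ball c \<epsilon> \<inter> grid U n"
    define h where "h = hit_prob U n B A"
    assume "\<not> hit_prob U n (ball c \<epsilon> \<inter> grid U n) A z \<le> \<eta>"
    then have hz: "\<eta> < h z" by (simp add: h_def B_def)
    have N: "n \<ge> N1" "n \<ge> N2" "n \<ge> N3" using n(1) by auto
    \<comment> \<open>The target is within \<epsilon> \<le> \<epsilon>0 \<le> R of \<open>c\<close>,
      a region without points of \<open>A\<close>; this makes the cutoff agree with \<open>h\<close>
      on both sets.\<close>
    have AB: "A \<inter> B = {}" using A(2) \<epsilon>(2) \<epsilon>0(2) by (auto simp: B_def disjoint_iff)
    have hB: "h w = 1" if "w \<in> B" for w using hit_prob_target[OF assms(1) n(2) that] by (simp add: h_def)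
    have hA: "h w = 0" if "w \<in> A" for w using that AB hit_prob_obstacle[of w A B] by (auto simp: h_def)
    have harm: "(\<Sum>v\<in>nbrs U n w. h v - h w) = 0" if "w \<in> grid U n" "w \<notin> A" "w \<notin> B" for w
      unfolding h_def by (rule hit_prob_harmonic[OF assms(1) n(2) that])
    obtain f where f: "\<And>w. dist c w \<le> \<epsilon>0 \<Longrightarrow> f w = 1" "\<And>w. R \<le> dist c w \<Longrightarrow> f w = 0" "energy U n f \<le> 324 / real K"
      using cut[OF N(3) n(2)] by blast
    have "energy U n h \<le> energy U n f"
    proof (rule energy_harmonic_le[OF assms(1) n(2), of "A \<union> B"])
      show "(\<Sum>w\<in>nbrs U n v. h w - h v) = 0" if "v \<in> grid U n" "v \<notin> A \<union> B" for v
        using harm[of v] that by simp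
      show "f v = h v" if "v \<in> A \<union> B" for v
      proof (cases "v \<in> B")
        case True
        then have "dist c v \<le> \<epsilon>0" using \<epsilon>(2) by (simp add: B_def)
        then show ?thesis using f(1) hB[OF True] by simp
      next
        case False
        then have "v \<in> A" using that by blast
        moreover have "R \<le> dist c v" using A(2) \<open>v \<in> A\<close> by (auto simp: disjoint_iff not_less[symmetric])
        ultimately show ?thesis using f(2) hA by simp
      qed
    qed
    then have Eh: "energy U n h \<le> 324 / real K" using f(3) by simp
    have pos: "0 < h z" using hz assms(8) by simp
    have "\<exists>x T. x 0 = z \<and> x T \<in> B \<and> (\<forall>k<T. x (Suc k) \<in> nbrs U n (x k)) \<and> (\<forall>k\<le>T. h z \<le> h (x k))"
    proof (rule max_principle_path[of U n z h A B])
      show "M \<inter> A \<noteq> {}" if "M \<subseteq> grid U n" "M \<noteq> {}" "\<And>w. w \<in> M \<Longrightarrow> nbrs U n w \<subseteq> M" for M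
        by (rule meets[OF N(2) n(2) A(1,3) that])
      show "\<exists>x T. x 0 = z \<and> x T \<in> B \<and> (\<forall>k<T. x (Suc k) \<in> nbrs U n (x k)) \<and> (\<forall>k\<le>T. h z \<le> h (x k))"
        if "x 0 = z" "x T \<in> B" "\<And>k. k < T \<Longrightarrow> x (Suc k) \<in> nbrs U n (x k)" "\<And>k. k \<le> T \<Longrightarrow> h z \<le> h (x k)" for x T
        using that by (intro exI[of _ x] exI[of _ T]) simp
    qed (use assms(1) n(2) z(1) pos harm hA in auto)
    then obtain x T where x: "x 0 = z" "x T \<in> B" "\<And>k. k < T \<Longrightarrow> x (Suc k) \<in> nbrs U n (x k)" "\<And>k. k \<le> T \<Longrightarrow> h z \<le> h (x k)"
      by blast
    define g where "g w = min (h w / h z) 1" for w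
    \<comment> \<open>The path leads from distance at least 1/2 to distance below R \<le> 1/4, which
      leaves 1/4 between its endpoints.\<close>
    have "dist c (x T) < 1 / 4" using x(2) \<epsilon>(2) \<epsilon>0(2) assms(7) by (simp add: B_def)
    then have far: "1 / 4 \<le> dist (x 0) (x T)" using z(2) x(1) dist_triangle[of c z "x T"] by (simp add: dist_commute)
    have "\<kappa> \<le> energy U n g"
    proof (rule cap[OF N(1) n(2) A(1,3) _ _ x(3) _ far])
      show "g y = 0" if "y \<in> A" for y using hA[OF that] by (simp add: g_def)
      show "g (x k) = 1" if "k \<le> T" for k
      proof -
        have "1 \<le> h (x k) / h z" using x(4)[OF that] pos by (simp add: le_divide_eq)
        then show ?thesis unfolding g_def by (rule min.absorb2)
      qed
    qed (use x(1) z(1) in simp)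
    then have "\<eta>\<^sup>2 * \<kappa> \<le> (h z)\<^sup>2 * energy U n g"
      using hz assms(8) \<kappa> by (intro mult_mono power_mono) auto
    also have "\<dots> \<le> energy U n h" unfolding g_def by (rule energy_truncate_le[OF pos])
    also have "\<dots> \<le> 324 / real K" by (rule Eh)
    finally have "\<eta>\<^sup>2 * \<kappa> * K \<le> 324" using K0 by (simp add: field_simps)
    moreover have "324 < \<eta>\<^sup>2 * \<kappa> * K" using K \<kappa> assms(8) by (simp add: field_simps)
    ultimately show False by simp
  qed
qed

theorem lemma5p2:
  fixes \<alpha> :: real and U :: "complex set" and x\<^sub>1 :: complex
  assumes "0 < \<alpha>" and "\<alpha> < 1"
    and "smooth_domain U"
    and "x\<^sub>1 \<in> frontier U"
  shows "((\<lambda>\<epsilon>. limsup (\<lambda>n.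
            SUP A \<in> {A. A \<subseteq> grid U n \<and> pi_RW U n A \<ge> \<alpha>}.
              SUP z \<in> grid U n - ball x\<^sub>1 (1/2).
                prob_hits_first U n z (ball x\<^sub>1 \<epsilon>) A))
          \<longlongrightarrow> 0) (at_right 0)"
proof -
  have U: "bounded U" "open U" "connected U" "U \<noteq> {}" using assms(3) by (auto simp: smooth_domain_def)
  obtain r where r: "axis_cone U r" using smooth_domain_axis_cone[OF assms(3)] by blast
  obtain c N0 where c: "c > 0" and large:
    "\<And>n A. n \<ge> N0 \<Longrightarrow> n > 0 \<Longrightarrow> A \<subseteq> grid U n \<Longrightarrow> \<alpha> \<le> pi_RW U n A \<Longrightarrow> c * (real n)\<^sup>2 \<le> card A"
    using card_ge_of_pi_RW[OF U(1,2,4) assms(1)] by metis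
  \<comment> \<open>The ball of radius \<open>R\<close> holds at most 9 R^2 n^2 \<le> (c / 2) n^2
    lattice points, so \<open>A\<close> keeps at least half of its guaranteed c n^2 vertices
    outside.\<close>
  define R where "R = min (1 / 4) (sqrt (c / 18))"
  have R: "R > 0" "R \<le> 1 / 4" using c by (auto simp: R_def)
  have "R\<^sup>2 \<le> (sqrt (c / 18))\<^sup>2" using R(1) by (intro power_mono) (auto simp: R_def)
  then have R2: "9 * R\<^sup>2 \<le> c / 2" using c by simp
  let ?F = "\<lambda>\<epsilon> n. SUP A \<in> {A. A \<subseteq> grid U n \<and> pi_RW U n A \<ge> \<alpha>}.
              SUP z \<in> grid U n - ball x\<^sub>1 (1/2). prob_hits_first U n z (ball x\<^sub>1 \<epsilon>) A"
  have small: "\<exists>\<epsilon>0>0. \<forall>\<epsilon>. 0 < \<epsilon> \<and> \<epsilon> < \<epsilon>0 \<longrightarrow> limsup (?F \<epsilon>) \<le> ennreal \<eta>" if "\<eta> > 0" for \<eta>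
  proof -
    have "c / 2 > 0" using c by simp
    then obtain \<epsilon>0 N1 where \<epsilon>0: "\<epsilon>0 > 0" and hit:
      "\<And>\<epsilon> n A z. \<lbrakk>0 < \<epsilon>; \<epsilon> \<le> \<epsilon>0; n \<ge> N1; n > 0; A \<subseteq> grid U n; A \<inter> ball x\<^sub>1 R = {}; c / 2 * (real n)\<^sup>2 \<le> card A;
        z \<in> grid U n; 1 / 2 \<le> dist x\<^sub>1 z\<rbrakk> \<Longrightarrow> hit_prob U n (ball x\<^sub>1 \<epsilon> \<inter> grid U n) A z \<le> \<eta>"
      using hit_prob_small[OF U(1-3) r _ R \<open>\<eta> > 0\<close>] by metis
    obtain N2 :: nat where N2: "N2 \<ge> 1 / R" using real_arch_simple by blast
    have bound: "?F \<epsilon> n \<le> ennreal \<eta>" if \<epsilon>: "0 < \<epsilon>" "\<epsilon> < \<epsilon>0" and n: "n \<ge> max (max N0 N1) (Suc N2)" for \<epsilon> n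
    proof (intro SUP_least)
      fix A z assume A: "A \<in> {A. A \<subseteq> grid U n \<and> pi_RW U n A \<ge> \<alpha>}" and z: "z \<in> grid U n - ball x\<^sub>1 (1/2)"
      have n': "n \<ge> N0" "n \<ge> N1" "n > 0" "n \<ge> N2" using n by auto
      define A' where "A' = A - ball x\<^sub>1 R"
      have sub: "A' \<subseteq> grid U n" using A by (auto simp: A'_def)
      have "1 / R \<le> real n" using N2 n'(4) by linarith
      then have Rn: "1 \<le> R * n" using R(1) by (simp add: field_simps)
      have "A - A' \<subseteq> scaled_lattice n \<inter> ball x\<^sub>1 R" using A by (auto simp: A'_def grid_def)
      then have "card (A - A') \<le> card (scaled_lattice n \<inter> ball x\<^sub>1 R)"
        by (rule card_mono[OF finite_lattice_ball[OF n'(3)]])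
      then have "real (card (A - A')) \<le> 9 * R\<^sup>2 * (real n)\<^sup>2"
        using card_lattice_ball_le[OF n'(3) R(1) Rn, of x\<^sub>1] by linarith
      also have "\<dots> \<le> c / 2 * (real n)\<^sup>2" using R2 by (intro mult_right_mono) auto
      finally have removed: "real (card (A - A')) \<le> c / 2 * (real n)\<^sup>2" .
      have "c * (real n)\<^sup>2 \<le> card A" using A by (intro large n') auto
      moreover have "card A = card A' + card (A - A')"
      proof -
        have "finite A" using A finite_grid[OF U(1) n'(3)] finite_subset by blast
        moreover have "A' \<subseteq> A" by (auto simp: A'_def)
        ultimately show ?thesis
          using card_Diff_subset[of A' A] card_mono[of A A'] finite_subset[of A' A] by simp
      qed
      ultimately have card: "c / 2 * (real n)\<^sup>2 \<le> card A'" using removed by simp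
      have "prob_hits_first U n z (ball x\<^sub>1 \<epsilon>) A \<le> ennreal (hit_prob U n (ball x\<^sub>1 \<epsilon> \<inter> grid U n) (A' \<inter> grid U n) z)"
        using z by (intro prob_hits_first_le_hit_prob[OF U(1) n'(3)]) (auto simp: A'_def)
      also have "A' \<inter> grid U n = A'" using sub by blast
      also have "ennreal (hit_prob U n (ball x\<^sub>1 \<epsilon> \<inter> grid U n) A' z) \<le> ennreal \<eta>"
        using z \<epsilon> by (intro ennreal_leI hit[OF _ _ n'(2,3) sub _ card]) (auto simp: A'_def)
      finally show "prob_hits_first U n z (ball x\<^sub>1 \<epsilon>) A \<le> ennreal \<eta>" .
    qed
    have "limsup (?F \<epsilon>) \<le> ennreal \<eta>" if \<epsilon>: "0 < \<epsilon>" "\<epsilon> < \<epsilon>0" for \<epsilon>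
    proof (rule Limsup_bounded)
      show "\<forall>\<^sub>F n in sequentially. ?F \<epsilon> n \<le> ennreal \<eta>"
        by (rule eventually_sequentiallyI) (rule bound[OF \<epsilon>])
    qed
    then show ?thesis using \<epsilon>0 by (intro exI[of _ \<epsilon>0]) simp
  qed
  show ?thesis
  \<comment> \<open>Nothing in \<open>ennreal\<close> lies below 0, so only the upper bounds have
    content.\<close>
  proof (rule order_tendstoI)
    fix u :: ennreal assume "0 < u"
    then obtain e where e: "0 < e" "e < u" using dense by blast
    then obtain \<eta> where \<eta>: "e = ennreal \<eta>" "\<eta> > 0" by (cases e) auto
    obtain \<epsilon>0 where \<epsilon>0: "\<epsilon>0 > 0" "\<forall>\<epsilon>. 0 < \<epsilon> \<and> \<epsilon> < \<epsilon>0 \<longrightarrow> limsup (?F \<epsilon>) \<le> ennreal \<eta>"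
      using small[OF \<eta>(2)] by (elim exE conjE)
    have "limsup (?F \<epsilon>) < u" if "0 < \<epsilon>" "\<epsilon> < \<epsilon>0" for \<epsilon>
    proof -
      have "limsup (?F \<epsilon>) \<le> ennreal \<eta>" using \<epsilon>0(2) that by simp
      then show ?thesis using e(2) \<eta>(1) by (simp add: order_le_less_trans)
    qed
    then show "\<forall>\<^sub>F \<epsilon> in at_right 0. limsup (?F \<epsilon>) < u"
      using \<epsilon>0(1) unfolding eventually_at_right_field by (intro exI[of _ \<epsilon>0]) simp
  qed (simp add: not_less_zero)
qed

end
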